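(* Let $\mathbf u=(u_0,u_1,u_2,u_3)\in P_3(\mathbb C)$ be generic and let $\mathcal A_{\mathbf u}=C_{\rm alg}(\mathbb C^4(\mathbf u))$. (1) In terms of the generators $Y_\mu$ of $\mathcal A_{\mathbf u}$ the defining relations of $\mathcal A_{\mathbf u}$ take the form $$Y_0Y_k-Y_kY_0=Y_\ell Y_m+Y_mY_\ell,\qquad Y_\ell Y_m-Y_mY_\ell=-J_{\ell m}\,(Y_0Y_k+Y_kY_0)$$ for every cyclic permutation $(k,\ell,m)$ of $(1,2,3)$. (2) The characteristic variety $E_{\mathbf u}$ of $\mathcal A_{\mathbf u}$, viewed in $P_3(\mathbb C)$ with the homogeneous coordinates $Z_\mu$ dual to the generators $Y_\mu$, is the union of $F_{\mathbf u}$ with the four points $e_0,e_1,e_2,e_3$. (3) The automorphism $\sigma$ of $E_{\mathbf u}$ is given by $\psi(z)\mapsto\psi(z-\eta)$ on $F_{\mathbf u}$, and $\sigma(e_\nu)=e_\nu$ for the four points $e_\nu$. (4) The automorphism $\sigma$ is the restriction to $F_{\mathbf u}$ of a birational automorphism of $P_3(\mathbb C)$ which is independent of $\mathbf u$ and defined over $\mathbb Q$.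
   Context: "Generic" means outside some proper algebraic subset of $P_3(\mathbb C)$. $C_{\rm alg}(\mathbb C^4(\mathbf u))$ is the quadratic algebra with generators $y_0,y_1,y_2,y_3$ and relations, for $(k,\ell,m)$ cyclic permutations of $(1,2,3)$, $$u_ky_ky_0-u_0y_0y_k+u_\ell y_\ell y_m-u_my_my_\ell=0,\qquad u_ky_0y_k-u_0y_ky_0+u_my_\ell y_m-u_\ell y_my_\ell=0.$$ The generators $Y_\mu$ are defined (fixing one choice of each square root) by $$y_0=\sqrt{u_1-u_2}\sqrt{u_2-u_3}\sqrt{u_3-u_1}\;Y_0,\quad y_1=\sqrt{u_0+u_2}\sqrt{u_2-u_3}\sqrt{u_0+u_3}\;Y_1,$$ $$y_2=\sqrt{u_0+u_3}\sqrt{u_3-u_1}\sqrt{u_0+u_1}\;Y_2,\quad y_3=\sqrt{u_0+u_1}\sqrt{u_1-u_2}\sqrt{u_0+u_2}\;Y_3.$$ Put $a=(u_0+u_1)(u_2+u_3)$, $b=(u_0+u_2)(u_3+u_1)$, $c=(u_0+u_3)(u_1+u_2)$ and $J_{12}=\frac{a-b}{c}$, $J_{23}=\frac{b-c}{a}$, $J_{31}=\frac{c-a}{b}$. For a quadratic algebra $T(V)/(R)$, $R\subset V\otimes V$, let $\Gamma\subset P(V^* )\times P(V^* )$ be the set of pairs $([\alpha],[\beta])$ with $\langle\omega,\alpha\otimes\beta\rangle=0$ for all $\omega\in R$. The characteristic variety $E$ is the (common) projection of $\Gamma$ to the factors and $\sigma$ is the automorphism of $E$ with graph $\Gamma$.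 $F_{\mathbf u}\subset P_3(\mathbb C)$: on $P_3(\mathbb C)$ with coordinates $(v_0,\dots,v_3)$ let $\Phi(v)=\big((v_0+v_1)(v_2+v_3):(v_0+v_2)(v_3+v_1):(v_0+v_3)(v_1+v_2)\big)\in P_2(\mathbb C)$, defined outside the set $S$ consisting of the 4 coordinate points and of the 4 points $(-1,1,1,1),(1,-1,1,1),(1,1,-1,1),(1,1,1,-1)$. $F_{\mathbf u}$ is the union of $S$ and of the fiber of $\Phi$ through $\mathbf u$. It is placed in the space with coordinates $Z_\mu$ through $Z=Mv$, where $$M=\tfrac12\begin{pmatrix}1&1&1&1\\1&1&-1&-1\\1&-1&1&-1\\1&-1&-1&1\end{pmatrix},$$ so that $F_{\mathbf u}$ has equations $\frac{Z_0^2-Z_1^2}{a}=\frac{Z_0^2-Z_2^2}{b}=\frac{Z_0^2-Z_3^2}{c}$. The point $e_\nu$ is the point all of whose homogeneous coordinates $Z_\mu$ vanish except $Z_\nu$. Theta functions: for $\mathrm{Im}\,\tau>0$ and $q=e^{\pi i\tau}$, $\vartheta_3(z)=\sum_{n\in\mathbb Z}q^{n^2}e^{2\pi inz}$, $i\vartheta_1(z)=q^{1/4}e^{\pi iz}\vartheta_3(z+\frac12+\frac\tau2)$, $\vartheta_2(z)=\vartheta_1(z+\frac12)$, $\vartheta_4(z)=\vartheta_3(z+\frac12)$. One chooses $\tau$ and $\eta\in\mathbb C$ such that $$(a:b:c)=\Big(\tfrac{\vartheta_2(0)^2}{\vartheta_2(\eta)^2}:\tfrac{\vartheta_3(0)^2}{\vartheta_3(\eta)^2}:\tfrac{\vartheta_4(0)^2}{\vartheta_4(\eta)^2}\Big).$$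 Then $\psi:\mathbb C/(\mathbb Z+\mathbb Z\tau)\to F_{\mathbf u}$ is the isomorphism $\psi(z)=\Big(\frac{\vartheta_1(2z-\eta)}{\vartheta_1(\eta)},\frac{\vartheta_2(2z-\eta)}{\vartheta_2(\eta)},\frac{\vartheta_3(2z-\eta)}{\vartheta_3(\eta)},\frac{\vartheta_4(2z-\eta)}{\vartheta_4(\eta)}\Big)=(Z_0,Z_1,Z_2,Z_3)$. *)

theory Defs
  imports "HOL-Analysis.Analysis" "HOL-Library.Poly_Mapping" "HOL-Algebra.QuotRing"
begin

section \<open>Projective spaces, forms and rational maps\<close>

text \<open>A point of projective space is a line through the origin, i.e. a set of vectors. Note that
  \<^term>\<open>pt 0 = {0}\<close> is not a point, so \<open>pt v = pt w\<close> with \<open>w \<noteq> 0\<close> forces \<open>v \<noteq> 0\<close>.\<close>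

definition pt :: "complex^'n \<Rightarrow> (complex^'n) set" where
  "pt v = vec.span {v}"

definition proj_space :: "(complex^'n) set set" where
  "proj_space = {pt v | v. v \<noteq> 0}"

text \<open>Homogeneous polynomials of degree \<open>d\<close> with coefficients in \<open>K\<close>, as functions
  (exponents are functions \<open>'n \<Rightarrow> nat\<close>).\<close>

definition forms :: "complex set \<Rightarrow> nat \<Rightarrow> (complex^'n \<Rightarrow> complex) set" where
  "forms K d = {\<lambda>v. \<Sum>e | (\<Sum>i\<in>UNIV. e i) = d. c e * (\<Prod>i\<in>UNIV. v $ i ^ e i) | c :: ('n \<Rightarrow> nat) \<Rightarrow> complex.
                  range c \<subseteq> K}"

definition form_maps :: "complex set \<Rightarrow> nat \<Rightarrow> (complex^'n \<Rightarrow> complex^'n) set" where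
  "form_maps K d = {f. \<forall>i. (\<lambda>v. f v $ i) \<in> forms K d}"

definition algebraic_subset :: "(complex^'n) set set \<Rightarrow> bool" where
  "algebraic_subset X \<longleftrightarrow>
     (\<exists>G. G \<subseteq> (\<Union>d. forms UNIV d) \<and> X = {pt v | v. v \<noteq> 0 \<and> (\<forall>g\<in>G. g v = 0)})"

definition proper_algebraic_subset :: "(complex^'n) set set \<Rightarrow> bool" where
  "proper_algebraic_subset X \<longleftrightarrow> algebraic_subset X \<and> X \<noteq> proj_space"

text \<open>Regular maps on a subset of projective space: locally (on the Zariski open set where the
  forms do not all vanish) given by forms of a common degree.\<close>

definition regular_on :: "(complex^'n) set set \<Rightarrow> ((complex^'n) set \<Rightarrow> (complex^'n) set) \<Rightarrow> bool" where
  "regular_on A s \<longleftrightarrow>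
     (\<forall>v. v \<noteq> 0 \<longrightarrow> pt v \<in> A \<longrightarrow>
        (\<exists>d. \<exists>f\<in>form_maps UNIV d. f v \<noteq> 0 \<and>
           (\<forall>w. w \<noteq> 0 \<longrightarrow> pt w \<in> A \<longrightarrow> f w \<noteq> 0 \<longrightarrow> s (pt w) = pt (f w))))"

definition variety_automorphism ::
  "(complex^'n) set set \<Rightarrow> ((complex^'n) set \<Rightarrow> (complex^'n) set) \<Rightarrow> bool" where
  "variety_automorphism A s \<longleftrightarrow>
     bij_betw s A A \<and> regular_on A s \<and> regular_on A (the_inv_into A s)"

text \<open>The rational map \<open>[v] \<mapsto> [f v]\<close> is defined where \<open>f\<close> does not vanish; it is birational, with
  inverse \<open>[v] \<mapsto> [g v]\<close>, if the two composites are the identity outside a proper algebraic subset.\<close>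

definition birational_automorphism :: "complex set \<Rightarrow> (complex^'n \<Rightarrow> complex^'n) \<Rightarrow> bool" where
  "birational_automorphism K f \<longleftrightarrow>
     (\<exists>d. f \<in> form_maps K d) \<and>
     (\<exists>e. \<exists>g\<in>form_maps K e. \<exists>W. proper_algebraic_subset W \<and>
        (\<forall>v. v \<noteq> 0 \<longrightarrow> pt v \<notin> W \<longrightarrow>
           f v \<noteq> 0 \<and> g (f v) \<noteq> 0 \<and> pt (g (f v)) = pt v \<and>
           g v \<noteq> 0 \<and> f (g v) \<noteq> 0 \<and> pt (f (g v)) = pt v))"


section \<open>The free algebra and quadratic algebras\<close>

text \<open>The tensor algebra \<open>T(V)\<close> of \<open>V = \<complex>\<^sup>4\<close> is the monoid algebra of the free monoid on the index
  type \<open>4\<close>, whose elements are \<open>0, 1, 2, 3\<close>. The monoid is written additively because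
  \<open>\<Rightarrow>\<^sub>0\<close> uses addition of keys for the convolution product.\<close>

datatype word = Word "4 list"

instantiation word :: monoid_add
begin
definition zero_word where "0 = Word []"
fun plus_word where "Word xs + Word ys = Word (xs @ ys)"
instance
proof
  fix a b c :: word
  show "a + b + c = a + (b + c)" by (cases a; cases b; cases c) simp
  show "0 + a = a" by (cases a) (simp add: zero_word_def)
  show "a + 0 = a" by (cases a) (simp add: zero_word_def)
qed
end

type_synonym tens = "word \<Rightarrow>\<^sub>0 complex"

definition smul :: "complex \<Rightarrow> tens \<Rightarrow> tens" (infixr \<open>\<odot>\<close> 75) where
  "c \<odot> x = Poly_Mapping.single 0 c * x"

interpretation tens: vector_space "(\<odot>)"
proof
  fix a b :: complex and x y :: tens
  show "a \<odot> (x + y) = a \<odot> x + a \<odot> y" by (simp add: smul_def distrib_left)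
  show "(a + b) \<odot> x = a \<odot> x + b \<odot> x" by (simp add: smul_def single_add distrib_right)
  show "a \<odot> b \<odot> x = (a * b) \<odot> x" by (simp add: smul_def mult_single flip: mult.assoc)
  show "1 \<odot> x = x" by (simp add: smul_def)
qed

definition gen :: "4 \<Rightarrow> tens" where
  "gen i = Poly_Mapping.single (Word [i]) 1"

definition tens_ring :: "tens ring" where
  "tens_ring = \<lparr>carrier = UNIV, mult = (*), one = 1, zero = 0, add = (+)\<rparr>"

text \<open>The algebra \<open>T(V)/(R)\<close> (ring ideals of \<open>T(V)\<close> are automatically \<open>\<complex>\<close>-subspaces).\<close>

definition quadratic_algebra :: "tens set \<Rightarrow> tens set ring" where
  "quadratic_algebra R = tens_ring Quot (Idl\<^bsub>tens_ring\<^esub> R)"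

text \<open>Evaluation of the degree one resp. degree two part of a tensor on \<open>\<alpha>\<close> resp. \<open>\<alpha> \<otimes> \<beta>\<close>, where
  a linear form \<open>\<alpha> \<in> V\<^sup>*\<close> is given by its values \<open>\<alpha> $ i\<close> on the generators \<^term>\<open>gen i\<close>.\<close>

definition pair1 :: "tens \<Rightarrow> complex^4 \<Rightarrow> complex" where
  "pair1 x \<alpha> = (\<Sum>i\<in>UNIV. Poly_Mapping.lookup x (Word [i]) * \<alpha> $ i)"

definition pair2 :: "tens \<Rightarrow> complex^4 \<Rightarrow> complex^4 \<Rightarrow> complex" where
  "pair2 x \<alpha> \<beta> = (\<Sum>i\<in>UNIV. \<Sum>j\<in>UNIV. Poly_Mapping.lookup x (Word [i, j]) * \<alpha> $ i * \<beta> $ j)"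

definition char_graph :: "tens set \<Rightarrow> ((complex^4) set \<times> (complex^4) set) set" where
  "char_graph R = {(pt \<alpha>, pt \<beta>) | \<alpha> \<beta>. \<alpha> \<noteq> 0 \<and> \<beta> \<noteq> 0 \<and> (\<forall>\<omega>\<in>R. pair2 \<omega> \<alpha> \<beta> = 0)}"

definition char_variety :: "tens set \<Rightarrow> (complex^4) set set" where
  "char_variety R = fst ` char_graph R"

text \<open>Only meaningful when \<^term>\<open>char_graph R\<close> is the graph of a map.\<close>

definition char_map :: "tens set \<Rightarrow> (complex^4) set \<Rightarrow> (complex^4) set" where
  "char_map R p = (THE q. (p, q) \<in> char_graph R)"

text \<open>The point of \<open>P\<^sub>3\<close> whose homogeneous coordinates are those of \<open>p \<in> P(V\<^sup>*)\<close> dual to a basis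
  \<open>Y\<close> of \<open>V\<close>, that is \<open>Z\<^sub>\<mu>(\<alpha>) = \<alpha>(Y\<^sub>\<mu>)\<close>.\<close>

definition coords :: "(4 \<Rightarrow> tens) \<Rightarrow> (complex^4) set \<Rightarrow> (complex^4) set" where
  "coords Y p = (\<lambda>\<alpha>. \<chi> \<mu>. pair1 (Y \<mu>) \<alpha>) ` p"


section \<open>The algebra $\mathcal{A}_u$\<close>

definition cyc :: "(4 \<times> 4 \<times> 4) set" where
  "cyc = {(1, 2, 3), (2, 3, 1), (3, 1, 2)}"

definition rels :: "complex^4 \<Rightarrow> tens set" where
  "rels u = (\<Union>(k, l, m)\<in>cyc.
     {(u$k) \<odot> (gen k * gen 0) - (u$0) \<odot> (gen 0 * gen k)
        + (u$l) \<odot> (gen l * gen m) - (u$m) \<odot> (gen m * gen l),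
      (u$k) \<odot> (gen 0 * gen k) - (u$0) \<odot> (gen k * gen 0)
        + (u$m) \<odot> (gen l * gen m) - (u$l) \<odot> (gen m * gen l)})"

definition rel_space :: "complex^4 \<Rightarrow> tens set" where
  "rel_space u = tens.span (rels u)"

definition alg_u :: "complex^4 \<Rightarrow> tens set ring" where
  "alg_u u = quadratic_algebra (rel_space u)"

definition par_a :: "complex^4 \<Rightarrow> complex" where
  "par_a u = (u$0 + u$1) * (u$2 + u$3)"

definition par_b :: "complex^4 \<Rightarrow> complex" where
  "par_b u = (u$0 + u$2) * (u$3 + u$1)"

definition par_c :: "complex^4 \<Rightarrow> complex" where
  "par_c u = (u$0 + u$3) * (u$1 + u$2)"

definition par_J :: "complex^4 \<Rightarrow> 4 \<Rightarrow> 4 \<Rightarrow> complex" where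
  "par_J u l m =
     (if (l, m) = (1, 2) then (par_a u - par_b u) / par_c u
      else if (l, m) = (2, 3) then (par_b u - par_c u) / par_a u
      else if (l, m) = (3, 1) then (par_c u - par_a u) / par_b u
      else undefined)"

text \<open>The rescaling factors in \<open>y\<^sub>\<mu> = scale\<^sub>\<mu> Y\<^sub>\<mu>\<close>. For \<open>(k, l, m)\<close> cyclic, \<open>r k\<close> is a square root of
  \<open>u\<^sub>l - u\<^sub>m\<close> and \<open>s k\<close> is a square root of \<open>u\<^sub>0 + u\<^sub>k\<close>.\<close>

definition roots_for :: "complex^4 \<Rightarrow> (4 \<Rightarrow> complex) \<Rightarrow> (4 \<Rightarrow> complex) \<Rightarrow> bool" where
  "roots_for u r s \<longleftrightarrow> (\<forall>(k, l, m)\<in>cyc. (r k)\<^sup>2 = u$l - u$m \<and> (s k)\<^sup>2 = u$0 + u$k)"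

definition scaling :: "(4 \<Rightarrow> complex) \<Rightarrow> (4 \<Rightarrow> complex) \<Rightarrow> 4 \<Rightarrow> complex" where
  "scaling r s \<mu> =
     (if \<mu> = 0 then r 3 * r 1 * r 2
      else if \<mu> = 1 then s 2 * r 1 * s 3
      else if \<mu> = 2 then s 3 * r 2 * s 1
      else s 1 * r 3 * s 2)"

definition genY :: "(4 \<Rightarrow> complex) \<Rightarrow> (4 \<Rightarrow> complex) \<Rightarrow> 4 \<Rightarrow> tens" where
  "genY r s \<mu> = inverse (scaling r s \<mu>) \<odot> gen \<mu>"

text \<open>The relations \<open>lhs - rhs\<close> of the normal form in the generators \<open>Y\<close>.\<close>

definition relsY :: "complex^4 \<Rightarrow> (4 \<Rightarrow> tens) \<Rightarrow> tens set" where
  "relsY u Y = (\<Union>(k, l, m)\<in>cyc.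
     {(Y 0 * Y k - Y k * Y 0) - (Y l * Y m + Y m * Y l),
      (Y l * Y m - Y m * Y l) - (- par_J u l m) \<odot> (Y 0 * Y k + Y k * Y 0)})"


section \<open>The curve $F_u$ and its theta parametrization\<close>

definition Phi :: "complex^4 \<Rightarrow> complex^3" where
  "Phi v = vector [par_a v, par_b v, par_c v]"

definition base_points :: "(complex^4) set set" where
  "base_points = range (\<lambda>\<nu>. pt (axis \<nu> 1)) \<union> range (\<lambda>\<nu>. pt (\<chi> \<mu>. if \<mu> = \<nu> then - 1 else 1))"

definition fiber :: "complex^4 \<Rightarrow> (complex^4) set set" where
  "fiber u = {pt v | v. v \<noteq> 0 \<and> pt v \<notin> base_points \<and> pt (Phi v) = pt (Phi u)}"

definition matM :: "complex^4^4" where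
  "matM = (\<chi> \<mu> \<nu>. (if \<mu> = 0 \<or> \<nu> = 0 \<or> \<mu> = \<nu> then 1 else - 1) / 2)"

definition curveF :: "complex^4 \<Rightarrow> (complex^4) set set" where
  "curveF u = (\<lambda>p. (\<lambda>v. matM *v v) ` p) ` (base_points \<union> fiber u)"

definition theta3 :: "complex \<Rightarrow> complex \<Rightarrow> complex" where
  "theta3 \<tau> z = (\<Sum>\<^sub>\<infinity>n\<in>(UNIV :: int set).
     exp (of_real pi * \<i> * \<tau> * of_int n ^ 2) * exp (2 * of_real pi * \<i> * of_int n * z))"

definition theta1 :: "complex \<Rightarrow> complex \<Rightarrow> complex" where
  "theta1 \<tau> z = exp (of_real pi * \<i> * \<tau> / 4) * exp (of_real pi * \<i> * z) * theta3 \<tau> (z + 1/2 + \<tau>/2) / \<i>"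

definition theta2 :: "complex \<Rightarrow> complex \<Rightarrow> complex" where
  "theta2 \<tau> z = theta1 \<tau> (z + 1/2)"

definition theta4 :: "complex \<Rightarrow> complex \<Rightarrow> complex" where
  "theta4 \<tau> z = theta3 \<tau> (z + 1/2)"

text \<open>The parameters \<open>\<tau>, \<eta>\<close> are adapted to \<open>u\<close>. When \<open>a, b, c\<close> are nonzero the proportion
  cannot hold with a vanishing denominator, since Isabelle's \<open>x / 0\<close> is \<open>0\<close>.\<close>

definition theta_params :: "complex^4 \<Rightarrow> complex \<Rightarrow> complex \<Rightarrow> bool" where
  "theta_params u \<tau> \<eta> \<longleftrightarrow> Im \<tau> > 0 \<and>
     pt (vector [par_a u, par_b u, par_c u] :: complex^3) =
     pt (vector [(theta2 \<tau> 0)\<^sup>2 / (theta2 \<tau> \<eta>)\<^sup>2,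
                 (theta3 \<tau> 0)\<^sup>2 / (theta3 \<tau> \<eta>)\<^sup>2,
                 (theta4 \<tau> 0)\<^sup>2 / (theta4 \<tau> \<eta>)\<^sup>2])"

definition psi :: "complex \<Rightarrow> complex \<Rightarrow> complex \<Rightarrow> (complex^4) set" where
  "psi \<tau> \<eta> z = pt (\<chi> \<mu>.
     if \<mu> = 0 then theta1 \<tau> (2 * z - \<eta>) / theta1 \<tau> \<eta>
     else if \<mu> = 1 then theta2 \<tau> (2 * z - \<eta>) / theta2 \<tau> \<eta>
     else if \<mu> = 2 then theta3 \<tau> (2 * z - \<eta>) / theta3 \<tau> \<eta>
     else theta4 \<tau> (2 * z - \<eta>) / theta4 \<tau> \<eta>)"

end

(* In the coordinates Z dual to the Y, a pair (Z, W) lies on Gamma iff three equations R1, R2, R3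
   without parameters and three equations S1, S2, S3 in a, b, c hold, all linear in W. Solving R1, R2, R3 for W by 3x3
   minors gives a cubic map f, which is a Cremona transformation: up to the sign of Z0, in the four linear forms
   -Z0+Z1+Z2+Z3, ..., Z0+Z1+Z2-Z3 it is l |-> (1/l). Substituting W = f(Z) in S1, S2, S3 leaves the curve and the four
   coordinate points; the zeros of f on the curve are four points, where other minors of the 6x4 system are used.
   The system is invariant under (Z, W) |-> (DW, DZ), D = diag(-1,1,1,1), which makes sigma an automorphism.

   The theta functions enter through the addition formula expressing products of translates by theta functions with
   period 2 tau: it gives the six bilinear equations for (psi(z), psi(z - eta)) and the equations of the curve.
   Surjectivity of psi follows from Liouville's theorem: a linear combination of the two even theta functions with
   period 2 tau and argument 2x has a zero, so the squares of the coordinates take all values on the curve, and signs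
   are adjusted by x |-> -x, x + 1, x + tau. *)
theory Submission
  imports Defs "HOL-Complex_Analysis.Complex_Analysis"
begin

no_notation fps_nth (infixl "$" 75)

subsection \<open>The relations in the coordinates Z\<close>

text \<open>Membership in the characteristic variety is a rank condition on six rows that depend
  linearly on Z. The three rows without parameters are dependent exactly on the six edges of the
  tetrahedron cut out by the four linear forms. On these edges the equations with parameters leave
  only the four vertices, and there the kernel is computed explicitly. The conditions on
  \<open>u\<close> come out of this analysis: a, b, c and their differences are nonzero, and so are
  a + b - c = 2 (u0 u3 + u1 u2) and its cyclic analogues. The latter guarantee that two of three
  quadrics already cut out the curve and that no further point of an edge survives. Since b - c =
  (u1 - u0) (u2 - u3), the same conditions keep all rescaling factors nonzero. On the theta side the
  squares of the four coordinates are linear in two functions without common zeros, so that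
  surjectivity becomes the statement that the ratio of these two functions takes every
  value.\<close>

lemma index4_cases: "(i::4) = 0 \<or> i = 1 \<or> i = 2 \<or> i = 3"
  using exhaust_4[of i] by auto

lemma forall_index4: "(\<forall>i::4. P i) \<longleftrightarrow> P 0 \<and> P 1 \<and> P 2 \<and> P 3"
  using index4_cases by metis

lemma UNIV_index4: "(UNIV :: 4 set) = {0, 1, 2, 3}"
  using index4_cases by auto

lemma sum_index4: "(\<Sum>i\<in>UNIV. f (i::4)) = f 0 + f 1 + f 2 + f 3"
  unfolding UNIV_index4 by (simp add: add.assoc)

definition vec4 :: "complex \<Rightarrow> complex \<Rightarrow> complex \<Rightarrow> complex \<Rightarrow> complex^4" where
  "vec4 p q r s = (\<chi> \<mu>. if \<mu> = 0 then p else if \<mu> = 1 then q else if \<mu> = 2 then r else s)"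

lemma vec4_nth [simp]:
  "vec4 p q r s $ 0 = p" "vec4 p q r s $ 1 = q" "vec4 p q r s $ 2 = r" "vec4 p q r s $ 3 = s"
  by (simp_all add: vec4_def)

lemma vec4_eq_iff: "(v :: complex^4) = w \<longleftrightarrow> v$0 = w$0 \<and> v$1 = w$1 \<and> v$2 = w$2 \<and> v$3 = w$3"
  by (simp add: vec_eq_iff forall_index4)

lemma vec4_collapse: "vec4 (v$0) (v$1) (v$2) (v$3) = v"
  by (simp add: vec4_eq_iff)

section \<open>Kernels of three linear equations in four unknowns\<close>

definition dot4 :: "complex^4 \<Rightarrow> complex^4 \<Rightarrow> complex" where
  "dot4 x w = x$0 * w$0 + x$1 * w$1 + x$2 * w$2 + x$3 * w$3"

definition det3 :: "complex \<Rightarrow> complex \<Rightarrow> complex \<Rightarrow> complex \<Rightarrow> complex \<Rightarrow> complex \<Rightarrow> complex \<Rightarrow> complex \<Rightarrow> complex \<Rightarrow> complex" where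
  "det3 x1 x2 x3 y1 y2 y3 z1 z2 z3 =
     x1 * y2 * z3 - x1 * y3 * z2 - x2 * y1 * z3 + x2 * y3 * z1 + x3 * y1 * z2 - x3 * y2 * z1"

text \<open>The generalised cross product: the signed 3x3 minors of the matrix with rows x, y, z. It
  is zero exactly when the rows are dependent, and otherwise spans their common kernel.\<close>

definition cross4 :: "complex^4 \<Rightarrow> complex^4 \<Rightarrow> complex^4 \<Rightarrow> complex^4" where
  "cross4 x y z = vec4
     (det3 (x$1) (x$2) (x$3) (y$1) (y$2) (y$3) (z$1) (z$2) (z$3))
     (- det3 (x$0) (x$2) (x$3) (y$0) (y$2) (y$3) (z$0) (z$2) (z$3))
     (det3 (x$0) (x$1) (x$3) (y$0) (y$1) (y$3) (z$0) (z$1) (z$3))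
     (- det3 (x$0) (x$1) (x$2) (y$0) (y$1) (y$2) (z$0) (z$1) (z$2))"

lemma proportional_if_minors:
  fixes v n :: "complex^4"
  assumes "\<And>i j. v$i * n$j = v$j * n$i" "n \<noteq> 0" "v \<noteq> 0"
  obtains k where "k \<noteq> 0" "v = k *s n"
proof -
  obtain j where j: "n$j \<noteq> 0" using assms(2) by (auto simp: vec_eq_iff)
  have "v$i = (v$j / n$j) * n$i" for i
  proof -
    have "v$i * n$j = v$j * n$i" by (rule assms(1))
    then show ?thesis using j by (metis nonzero_eq_divide_eq times_divide_eq_left)
  qed
  then have "v = (v$j / n$j) *s n" unfolding vec_eq_iff vector_smult_component by blast
  moreover from this have "v$j / n$j \<noteq> 0" using assms(3) by auto
  ultimately show ?thesis using that by blast
qed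

text \<open>Cramer's rule: each 2x2 minor of the pair formed by w and the vector of minors is, up to
  sign, a 3x3 determinant with one column replaced by the three values of \<open>dot4\<close>. These
  are zero, so w is a multiple of the vector of minors.\<close>

lemma kernel_cross4:
  assumes "dot4 x w = 0" "dot4 y w = 0" "dot4 z w = 0" "cross4 x y z \<noteq> 0" "w \<noteq> 0"
  obtains k where "k \<noteq> 0" "w = k *s cross4 x y z"
proof (rule proportional_if_minors[OF _ assms(4,5)])
  define n where "n = cross4 x y z"
  have det0: "det3 0 p q 0 p' q' 0 p'' q'' = 0" for p q p' q' p'' q'' by (simp add: det3_def)
  have "w$0 * n$1 - w$1 * n$0 = - det3 (dot4 x w) (x$2) (x$3) (dot4 y w) (y$2) (y$3) (dot4 z w) (z$2) (z$3)"
    unfolding n_def cross4_def det3_def dot4_def vec4_nth by (simp add: algebra_simps)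
  then have "w$0 * n$1 = w$1 * n$0" using assms(1-3) det0 by simp
  moreover
  have "w$0 * n$2 - w$2 * n$0 =  det3 (dot4 x w) (x$1) (x$3) (dot4 y w) (y$1) (y$3) (dot4 z w) (z$1) (z$3)"
    unfolding n_def cross4_def det3_def dot4_def vec4_nth by (simp add: algebra_simps)
  then have "w$0 * n$2 = w$2 * n$0" using assms(1-3) det0 by simp
  moreover
  have "w$0 * n$3 - w$3 * n$0 = - det3 (dot4 x w) (x$1) (x$2) (dot4 y w) (y$1) (y$2) (dot4 z w) (z$1) (z$2)"
    unfolding n_def cross4_def det3_def dot4_def vec4_nth by (simp add: algebra_simps)
  then have "w$0 * n$3 = w$3 * n$0" using assms(1-3) det0 by simp
  moreover
  have "w$1 * n$2 - w$2 * n$1 = - det3 (dot4 x w) (x$0) (x$3) (dot4 y w) (y$0) (y$3) (dot4 z w) (z$0) (z$3)"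
    unfolding n_def cross4_def det3_def dot4_def vec4_nth by (simp add: algebra_simps)
  then have "w$1 * n$2 = w$2 * n$1" using assms(1-3) det0 by simp
  moreover
  have "w$1 * n$3 - w$3 * n$1 =  det3 (dot4 x w) (x$0) (x$2) (dot4 y w) (y$0) (y$2) (dot4 z w) (z$0) (z$2)"
    unfolding n_def cross4_def det3_def dot4_def vec4_nth by (simp add: algebra_simps)
  then have "w$1 * n$3 = w$3 * n$1" using assms(1-3) det0 by simp
  moreover
  have "w$2 * n$3 - w$3 * n$2 = - det3 (dot4 x w) (x$0) (x$1) (dot4 y w) (y$0) (y$1) (dot4 z w) (z$0) (z$1)"
    unfolding n_def cross4_def det3_def dot4_def vec4_nth by (simp add: algebra_simps)
  then have "w$2 * n$3 = w$3 * n$2" using assms(1-3) det0 by simp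
  ultimately show "w$i * cross4 x y z $ j = w$j * cross4 x y z $ i" for i j
    using index4_cases[of i] index4_cases[of j] unfolding n_def[symmetric] by (elim disjE) (simp_all only:)
qed (use that in auto)

section \<open>The six bilinear equations and the equations of the curve\<close>

definition rowR1 :: "complex^4 \<Rightarrow> complex^4" where "rowR1 Z = vec4 (- Z$1) (Z$0) (- Z$3) (- Z$2)"
definition rowR2 :: "complex^4 \<Rightarrow> complex^4" where "rowR2 Z = vec4 (- Z$2) (- Z$3) (Z$0) (- Z$1)"
definition rowR3 :: "complex^4 \<Rightarrow> complex^4" where "rowR3 Z = vec4 (- Z$3) (- Z$2) (- Z$1) (Z$0)"

text \<open>Coefficients in W of \<open>a (Z2 W3 - Z3 W2) + (b - c) (Z0 W1 + Z1 W0)\<close>: the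
  second relation of the normal form multiplied by a, so that J23 = (b - c) / a leaves no
  denominator. The other two arise by cyclic permutation.\<close>

definition rowS1 :: "complex \<Rightarrow> complex \<Rightarrow> complex \<Rightarrow> complex^4 \<Rightarrow> complex^4" where
  "rowS1 a b c Z = vec4 ((b - c) * Z$1) ((b - c) * Z$0) (- a * Z$3) (a * Z$2)"
definition rowS2 :: "complex \<Rightarrow> complex \<Rightarrow> complex \<Rightarrow> complex^4 \<Rightarrow> complex^4" where
  "rowS2 a b c Z = vec4 ((c - a) * Z$2) (b * Z$3) ((c - a) * Z$0) (- b * Z$1)"
definition rowS3 :: "complex \<Rightarrow> complex \<Rightarrow> complex \<Rightarrow> complex^4 \<Rightarrow> complex^4" where
  "rowS3 a b c Z = vec4 ((a - b) * Z$3) (- c * Z$2) (c * Z$1) ((a - b) * Z$0)"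

definition rel_pair :: "complex \<Rightarrow> complex \<Rightarrow> complex \<Rightarrow> complex^4 \<Rightarrow> complex^4 \<Rightarrow> bool" where
  "rel_pair a b c Z W \<longleftrightarrow> dot4 (rowR1 Z) W = 0 \<and> dot4 (rowR2 Z) W = 0 \<and> dot4 (rowR3 Z) W = 0 \<and>
     dot4 (rowS1 a b c Z) W = 0 \<and> dot4 (rowS2 a b c Z) W = 0 \<and> dot4 (rowS3 a b c Z) W = 0"

definition on_curve :: "complex \<Rightarrow> complex \<Rightarrow> complex \<Rightarrow> complex^4 \<Rightarrow> bool" where
  "on_curve a b c Z \<longleftrightarrow>
     b * ((Z$0)\<^sup>2 - (Z$1)\<^sup>2) = a * ((Z$0)\<^sup>2 - (Z$2)\<^sup>2) \<and>
     c * ((Z$0)\<^sup>2 - (Z$1)\<^sup>2) = a * ((Z$0)\<^sup>2 - (Z$3)\<^sup>2) \<and>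
     c * ((Z$0)\<^sup>2 - (Z$2)\<^sup>2) = b * ((Z$0)\<^sup>2 - (Z$3)\<^sup>2)"

definition cremona :: "complex^4 \<Rightarrow> complex^4" where
  "cremona Z = cross4 (rowR1 Z) (rowR2 Z) (rowR3 Z)"

definition flip0 :: "complex^4 \<Rightarrow> complex^4" where
  "flip0 Z = vec4 (- Z$0) (Z$1) (Z$2) (Z$3)"

lemmas row_defs = rowR1_def rowR2_def rowR3_def rowS1_def rowS2_def rowS3_def

lemma cremona_nth:
  "cremona Z $ 0 = (Z$0)^3 - Z$0 * ((Z$1)\<^sup>2 + (Z$2)\<^sup>2 + (Z$3)\<^sup>2) - 2 * Z$1 * Z$2 * Z$3"
  "cremona Z $ 1 = Z$1 * ((Z$0)\<^sup>2 - (Z$1)\<^sup>2 + (Z$2)\<^sup>2 + (Z$3)\<^sup>2) + 2 * Z$0 * Z$2 * Z$3"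
  "cremona Z $ 2 = Z$2 * ((Z$0)\<^sup>2 + (Z$1)\<^sup>2 - (Z$2)\<^sup>2 + (Z$3)\<^sup>2) + 2 * Z$0 * Z$1 * Z$3"
  "cremona Z $ 3 = Z$3 * ((Z$0)\<^sup>2 + (Z$1)\<^sup>2 + (Z$2)\<^sup>2 - (Z$3)\<^sup>2) + 2 * Z$0 * Z$1 * Z$2"
  unfolding cremona_def cross4_def row_defs det3_def vec4_nth by Groebner_Basis.algebra+

text \<open>Exchanging Z and W reverses the sign of \<open>Z0 Wk - Zk W0\<close> and of
  \<open>Zl Wm - Zm Wl\<close> and preserves the symmetric sums. Negating the coordinates with index
  0 then restores the R-equations and turns the S-equations into their negatives. The inverse
  correspondence is therefore the correspondence conjugated by \<open>flip0\<close>, which transfers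
  every statement about the first factor to the second.\<close>

lemma rel_pair_flip0: "rel_pair a b c (flip0 W) (flip0 Z) \<longleftrightarrow> rel_pair a b c Z W"
proof -
  have "dot4 (rowR1 (flip0 W)) (flip0 Z) = dot4 (rowR1 Z) W"
    "dot4 (rowR2 (flip0 W)) (flip0 Z) = dot4 (rowR2 Z) W"
    "dot4 (rowR3 (flip0 W)) (flip0 Z) = dot4 (rowR3 Z) W"
    "dot4 (rowS1 a b c (flip0 W)) (flip0 Z) = - dot4 (rowS1 a b c Z) W"
    "dot4 (rowS2 a b c (flip0 W)) (flip0 Z) = - dot4 (rowS2 a b c Z) W"
    "dot4 (rowS3 a b c (flip0 W)) (flip0 Z) = - dot4 (rowS3 a b c Z) W"
    unfolding dot4_def row_defs flip0_def vec4_nth by Groebner_Basis.algebra+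
  then show ?thesis by (auto simp: rel_pair_def)
qed

lemma rel_pair_scale:
  "j \<noteq> 0 \<Longrightarrow> k \<noteq> 0 \<Longrightarrow> rel_pair a b c (j *s Z) (k *s W) \<longleftrightarrow> rel_pair a b c Z W"
proof -
  assume "j \<noteq> 0" "k \<noteq> 0"
  moreover have "dot4 (rowR1 (j *s Z)) (k *s W) = j * k * dot4 (rowR1 Z) W"
    "dot4 (rowR2 (j *s Z)) (k *s W) = j * k * dot4 (rowR2 Z) W"
    "dot4 (rowR3 (j *s Z)) (k *s W) = j * k * dot4 (rowR3 Z) W"
    "dot4 (rowS1 a b c (j *s Z)) (k *s W) = j * k * dot4 (rowS1 a b c Z) W"
    "dot4 (rowS2 a b c (j *s Z)) (k *s W) = j * k * dot4 (rowS2 a b c Z) W"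
    "dot4 (rowS3 a b c (j *s Z)) (k *s W) = j * k * dot4 (rowS3 a b c Z) W"
    unfolding dot4_def row_defs vec4_nth vector_smult_component by Groebner_Basis.algebra+
  ultimately show ?thesis by (simp add: rel_pair_def)
qed

section \<open>The tetrahedron of the Cremona transformation\<close>

definition face0 :: "complex^4 \<Rightarrow> complex" where "face0 Z = - Z$0 + Z$1 + Z$2 + Z$3"
definition face1 :: "complex^4 \<Rightarrow> complex" where "face1 Z = Z$0 - Z$1 + Z$2 + Z$3"
definition face2 :: "complex^4 \<Rightarrow> complex" where "face2 Z = Z$0 + Z$1 - Z$2 + Z$3"
definition face3 :: "complex^4 \<Rightarrow> complex" where "face3 Z = Z$0 + Z$1 + Z$2 - Z$3"

lemmas face_defs = face0_def face1_def face2_def face3_def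

lemma face_cremona:
  "face0 (flip0 (cremona Z)) = face1 Z * face2 Z * face3 Z"
  "face1 (flip0 (cremona Z)) = face0 Z * face2 Z * face3 Z"
  "face2 (flip0 (cremona Z)) = face0 Z * face1 Z * face3 Z"
  "face3 (flip0 (cremona Z)) = face0 Z * face1 Z * face2 Z"
  unfolding face_defs flip0_def vec4_nth cremona_nth by Groebner_Basis.algebra+

lemma faces_eqI:
  assumes "face0 Z = face0 W" "face1 Z = face1 W" "face2 Z = face2 W" "face3 Z = face3 W"
  shows "Z = W"
proof -
  have "Z$0 = W$0" "Z$1 = W$1" "Z$2 = W$2" "Z$3 = W$3"
    using assms unfolding face_defs by Groebner_Basis.algebra+
  then show ?thesis by (simp add: vec4_eq_iff)
qed

lemma faces_eq_0_iff: "Z = 0 \<longleftrightarrow> face0 Z = 0 \<and> face1 Z = 0 \<and> face2 Z = 0 \<and> face3 Z = 0"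
  using faces_eqI[of Z 0] by (auto simp: face_defs)

lemma face_scale: "face0 (k *s Z) = k * face0 Z" "face1 (k *s Z) = k * face1 Z"
  "face2 (k *s Z) = k * face2 Z" "face3 (k *s Z) = k * face3 Z"
  by (simp_all add: face_defs algebra_simps)

definition face_prod :: "complex^4 \<Rightarrow> complex" where
  "face_prod Z = face0 Z * face1 Z * (face2 Z * face3 Z)"

lemma flip0_flip0 [simp]: "flip0 (flip0 Z) = Z"
  by (simp add: flip0_def vec4_eq_iff)

lemma flip0_scale: "flip0 (k *s Z) = k *s flip0 Z"
  by (simp add: flip0_def vec4_eq_iff)

lemma flip0_eq_0 [simp]: "flip0 Z = 0 \<longleftrightarrow> Z = 0"
  by (auto simp add: flip0_def vec4_eq_iff)

text \<open>Let l0, ..., l3 be the values of the face forms and P their product. The map sends each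
  l to P/l; applied twice it gives P^3 / (P/l) = P^2 l, because the product of the four values P/l
  is P^3.\<close>

lemma cremona_cremona: "flip0 (cremona (flip0 (cremona Z))) = (face_prod Z)\<^sup>2 *s Z"
  by (rule faces_eqI; unfold face_cremona face_scale face_prod_def; Groebner_Basis.algebra)

text \<open>The four products of three face forms vanish together exactly when two of the forms
  vanish, so the zero locus is the union of the six edges.\<close>

lemma cremona_eq_0_iff:
  "cremona Z = 0 \<longleftrightarrow>
     face0 Z = 0 \<and> face1 Z = 0 \<or> face0 Z = 0 \<and> face2 Z = 0 \<or> face0 Z = 0 \<and> face3 Z = 0 \<or>
     face1 Z = 0 \<and> face2 Z = 0 \<or> face1 Z = 0 \<and> face3 Z = 0 \<or> face2 Z = 0 \<and> face3 Z = 0"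
  (is "?L \<longleftrightarrow> ?R")
proof -
  have "?L \<longleftrightarrow> flip0 (cremona Z) = 0" by simp
  also have "\<dots> \<longleftrightarrow> face0 (flip0 (cremona Z)) = 0 \<and> face1 (flip0 (cremona Z)) = 0 \<and>
      face2 (flip0 (cremona Z)) = 0 \<and> face3 (flip0 (cremona Z)) = 0"
    by (rule faces_eq_0_iff)
  also have "\<dots> \<longleftrightarrow> ?R" unfolding face_cremona by auto
  finally show ?thesis .
qed

lemma cremona_zero_cases:
  assumes "cremona Z = 0"
  shows "Z$1 = Z$0 \<and> Z$3 = - Z$2 \<or> Z$1 = - Z$0 \<and> Z$3 = Z$2 \<or>
         Z$2 = Z$0 \<and> Z$1 = - Z$3 \<or> Z$2 = - Z$0 \<and> Z$1 = Z$3 \<or>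
         Z$3 = Z$0 \<and> Z$2 = - Z$1 \<or> Z$3 = - Z$0 \<and> Z$2 = Z$1"
proof -
  have "face0 Z = 0 \<and> face1 Z = 0 \<Longrightarrow> Z$1 = Z$0 \<and> Z$3 = - Z$2"
    "face2 Z = 0 \<and> face3 Z = 0 \<Longrightarrow> Z$1 = - Z$0 \<and> Z$3 = Z$2"
    "face0 Z = 0 \<and> face2 Z = 0 \<Longrightarrow> Z$2 = Z$0 \<and> Z$1 = - Z$3"
    "face1 Z = 0 \<and> face3 Z = 0 \<Longrightarrow> Z$2 = - Z$0 \<and> Z$1 = Z$3"
    "face0 Z = 0 \<and> face3 Z = 0 \<Longrightarrow> Z$3 = Z$0 \<and> Z$2 = - Z$1"
    "face1 Z = 0 \<and> face2 Z = 0 \<Longrightarrow> Z$3 = - Z$0 \<and> Z$2 = Z$1"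
    unfolding face_defs by Groebner_Basis.algebra+
  then show ?thesis using assms unfolding cremona_eq_0_iff by blast
qed

text \<open>After substitution each equation with parameters splits into a quadric that contains the
  curve and a factor \<open>Z0 Zk + Zl Zm\<close>, which is responsible for the coordinate
  points.\<close>

lemma dot4_S_cremona:
  "dot4 (rowS1 a b c Z) (cremona Z) =
     2 * (Z$0 * Z$1 + Z$2 * Z$3) * (a * ((Z$2)\<^sup>2 - (Z$3)\<^sup>2) + (b - c) * ((Z$0)\<^sup>2 - (Z$1)\<^sup>2))"
  "dot4 (rowS2 a b c Z) (cremona Z) =
     2 * (Z$0 * Z$2 + Z$3 * Z$1) * (b * ((Z$3)\<^sup>2 - (Z$1)\<^sup>2) + (c - a) * ((Z$0)\<^sup>2 - (Z$2)\<^sup>2))"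
  "dot4 (rowS3 a b c Z) (cremona Z) =
     2 * (Z$0 * Z$3 + Z$1 * Z$2) * (c * ((Z$1)\<^sup>2 - (Z$2)\<^sup>2) + (a - b) * ((Z$0)\<^sup>2 - (Z$3)\<^sup>2))"
  unfolding dot4_def row_defs vec4_nth cremona_nth by Groebner_Basis.algebra+

lemma dot4_R_cremona:
  "dot4 (rowR1 Z) (cremona Z) = 0" "dot4 (rowR2 Z) (cremona Z) = 0" "dot4 (rowR3 Z) (cremona Z) = 0"
  unfolding dot4_def row_defs vec4_nth cremona_nth by Groebner_Basis.algebra+

section \<open>From the factored equations to the curve\<close>

text \<open>Here x, y, z stand for the differences Z0^2 - Zk^2. Adding b times the first equation to
  a times the second eliminates z and leaves \<open>(a + b - c) * (b * x - a * y) = 0\<close>; this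
  is the origin of the condition on a + b - c.\<close>

lemma proportional_if_two_vanish:
  fixes a b c x y z :: complex
  assumes "a * (z - y) + (b - c) * x = 0" "b * (x - z) + (c - a) * y = 0"
    and "a + b \<noteq> c" "a \<noteq> 0" "b \<noteq> 0"
  shows "b * x = a * y \<and> c * x = a * z \<and> c * y = b * z"
proof -
  have "(a + b - c) * (b * x - a * y) = 0" using assms(1,2) by Groebner_Basis.algebra
  then have 1: "b * x = a * y" using assms(3) by simp
  have "a * (c * x - a * z) = 0" using assms(1) 1 by Groebner_Basis.algebra
  then have 2: "c * x = a * z" using assms(4) by simp
  have "a * (c * y - b * z) = 0" using 1 2 by Groebner_Basis.algebra
  then show ?thesis using 1 2 assms(4) by simp
qed

text \<open>The assumptions are stable under cyclic permutation of a, b, c, so that an argument made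
  for one of the indices 1, 2, 3 can be instantiated for the other two.\<close>

locale nondegenerate =
  fixes a b c :: complex
  assumes nz: "a \<noteq> 0" "b \<noteq> 0" "c \<noteq> 0"
    and distinct: "a \<noteq> b" "b \<noteq> c" "c \<noteq> a"
    and triangle: "a + b \<noteq> c" "b + c \<noteq> a" "c + a \<noteq> b"
begin

text \<open>A second triple of rows. At the vertices of the tetrahedron R1, R2, R3 are dependent,
  whereas R1, S1, S2 still have rank three there, see \<open>chart2_nonzero\<close>.\<close>

definition chart2 :: "complex^4 \<Rightarrow> complex^4" where
  "chart2 Z = cross4 (rowR1 Z) (rowS1 a b c Z) (rowS2 a b c Z)"

lemma rel_pair_cremona:
  assumes "rel_pair a b c Z W" "W \<noteq> 0" "cremona Z \<noteq> 0"
  obtains k where "k \<noteq> 0" "W = k *s cremona Z"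
  using kernel_cross4[of "rowR1 Z" W "rowR2 Z" "rowR3 Z"] assms
  unfolding cremona_def rel_pair_def by metis

lemma rel_pair_chart2:
  assumes "rel_pair a b c Z W" "W \<noteq> 0" "chart2 Z \<noteq> 0"
  obtains k where "k \<noteq> 0" "W = k *s chart2 Z"
  using kernel_cross4[of "rowR1 Z" W "rowS1 a b c Z" "rowS2 a b c Z"] assms
  unfolding chart2_def rel_pair_def by metis

lemma rel_pair_cremona_iff:
  "rel_pair a b c Z (cremona Z) \<longleftrightarrow>
     (Z$0 * Z$1 + Z$2 * Z$3 = 0 \<or> a * ((Z$2)\<^sup>2 - (Z$3)\<^sup>2) + (b - c) * ((Z$0)\<^sup>2 - (Z$1)\<^sup>2) = 0) \<and>
     (Z$0 * Z$2 + Z$3 * Z$1 = 0 \<or> b * ((Z$3)\<^sup>2 - (Z$1)\<^sup>2) + (c - a) * ((Z$0)\<^sup>2 - (Z$2)\<^sup>2) = 0) \<and>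
     (Z$0 * Z$3 + Z$1 * Z$2 = 0 \<or> c * ((Z$1)\<^sup>2 - (Z$2)\<^sup>2) + (a - b) * ((Z$0)\<^sup>2 - (Z$3)\<^sup>2) = 0)"
proof -
  have "(2::complex) \<noteq> 0" by simp
  then show ?thesis unfolding rel_pair_def dot4_S_cremona dot4_R_cremona mult_eq_0_iff by blast
qed

lemma on_curveI:
  assumes "a * ((Z$2)\<^sup>2 - (Z$3)\<^sup>2) + (b - c) * ((Z$0)\<^sup>2 - (Z$1)\<^sup>2) = 0 \<and>
      b * ((Z$3)\<^sup>2 - (Z$1)\<^sup>2) + (c - a) * ((Z$0)\<^sup>2 - (Z$2)\<^sup>2) = 0 \<or>
    b * ((Z$3)\<^sup>2 - (Z$1)\<^sup>2) + (c - a) * ((Z$0)\<^sup>2 - (Z$2)\<^sup>2) = 0 \<and>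
      c * ((Z$1)\<^sup>2 - (Z$2)\<^sup>2) + (a - b) * ((Z$0)\<^sup>2 - (Z$3)\<^sup>2) = 0 \<or>
    c * ((Z$1)\<^sup>2 - (Z$2)\<^sup>2) + (a - b) * ((Z$0)\<^sup>2 - (Z$3)\<^sup>2) = 0 \<and>
      a * ((Z$2)\<^sup>2 - (Z$3)\<^sup>2) + (b - c) * ((Z$0)\<^sup>2 - (Z$1)\<^sup>2) = 0"
  shows "on_curve a b c Z"
proof -
  define x y z where "x = (Z$0)\<^sup>2 - (Z$1)\<^sup>2" and "y = (Z$0)\<^sup>2 - (Z$2)\<^sup>2" and "z = (Z$0)\<^sup>2 - (Z$3)\<^sup>2"
  note xyz = this
  have "(Z$2)\<^sup>2 - (Z$3)\<^sup>2 = z - y" "(Z$3)\<^sup>2 - (Z$1)\<^sup>2 = x - z" "(Z$1)\<^sup>2 - (Z$2)\<^sup>2 = y - x"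
    by (simp_all add: xyz)
  note A = assms[unfolded this, folded xyz]
  have "b * x = a * y \<and> c * x = a * z \<and> c * y = b * z"
    using A triangle proportional_if_two_vanish[of a z y b c x] proportional_if_two_vanish[of b x z c a y]
      proportional_if_two_vanish[of c y x a b z] nz by (smt (verit))
  then show ?thesis unfolding on_curve_def xyz by blast
qed

lemma on_curveD:
  assumes "on_curve a b c Z"
  shows "a * ((Z$2)\<^sup>2 - (Z$3)\<^sup>2) + (b - c) * ((Z$0)\<^sup>2 - (Z$1)\<^sup>2) = 0"
    "b * ((Z$3)\<^sup>2 - (Z$1)\<^sup>2) + (c - a) * ((Z$0)\<^sup>2 - (Z$2)\<^sup>2) = 0"
    "c * ((Z$1)\<^sup>2 - (Z$2)\<^sup>2) + (a - b) * ((Z$0)\<^sup>2 - (Z$3)\<^sup>2) = 0"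
  using assms unfolding on_curve_def by Groebner_Basis.algebra+

lemma rel_pair_cremona_if_on_curve: "on_curve a b c Z \<Longrightarrow> rel_pair a b c Z (cremona Z)"
  using on_curveD[of Z] unfolding rel_pair_cremona_iff by blast

text \<open>Sum and difference of the two equations factor as (z0 + z3) (z1 + z2) and (z0 - z3) (z1
  - z2), so the solutions form four lines. Two of them are edges of the tetrahedron. On the other
  two, where two coordinates are zero, the third condition leaves coordinate points and points of
  the edges.\<close>

lemma on_curve_if_two_zero:
  fixes z0 z1 z2 z3 d e :: complex
  assumes "z0 * z1 + z2 * z3 = 0" "z0 * z2 + z3 * z1 = 0"
    "z0 * z3 + z1 * z2 = 0 \<or> e * (z1\<^sup>2 - z2\<^sup>2) + d * (z0\<^sup>2 - z3\<^sup>2) = 0" "e \<noteq> 0" "d \<noteq> 0"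
  shows "z0 = 0 \<and> z1 = 0 \<and> z2 = 0 \<or> z0 = 0 \<and> z1 = 0 \<and> z3 = 0 \<or>
     z0 = 0 \<and> z2 = 0 \<and> z3 = 0 \<or> z1 = 0 \<and> z2 = 0 \<and> z3 = 0 \<or>
     z3 = z0 \<and> z2 = - z1 \<or> z3 = - z0 \<and> z2 = z1"
proof -
  have "(z0 + z3) * (z1 + z2) = 0" "(z0 - z3) * (z1 - z2) = 0"
    using assms(1,2) by Groebner_Basis.algebra+
  then have "(z3 = - z0 \<or> z2 = - z1) \<and> (z3 = z0 \<or> z2 = z1)"
    by (auto simp: add_eq_0_iff)
  moreover have "z3 = - z0 \<Longrightarrow> z3 = z0 \<Longrightarrow> z3 = 0 \<and> z0 = 0" "z2 = - z1 \<Longrightarrow> z2 = z1 \<Longrightarrow> z1 = 0 \<and> z2 = 0"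
    by auto
  ultimately consider "z3 = - z0" "z2 = z1" | "z3 = 0" "z0 = 0" | "z1 = 0" "z2 = 0" | "z3 = z0" "z2 = - z1"
    by blast
  then show ?thesis
  proof cases
    case 2
    then have "z1 = 0 \<or> z2 = 0 \<or> z1\<^sup>2 = z2\<^sup>2" using assms(3,4) by auto
    then show ?thesis using 2 by (auto simp: power2_eq_iff)
  next
    case 3
    then have "z0 = 0 \<or> z3 = 0 \<or> z0\<^sup>2 = z3\<^sup>2" using assms(3,5) by auto
    then show ?thesis using 3 by (auto simp: power2_eq_iff)
  qed auto
qed

lemma on_curve_or_axis_if_cremona:
  assumes "rel_pair a b c Z (cremona Z)" "cremona Z \<noteq> 0"
  shows "on_curve a b c Z \<or> (\<exists>\<nu>. Z = Z$\<nu> *s axis \<nu> 1)"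
proof (cases "on_curve a b c Z")
  case False
  note A = assms(1)[unfolded rel_pair_cremona_iff]
  have d: "a - b \<noteq> 0" "b - c \<noteq> 0" "c - a \<noteq> 0" using distinct by auto
  have ax: "(Z = Z$0 *s axis 0 1) \<longleftrightarrow> Z$1 = 0 \<and> Z$2 = 0 \<and> Z$3 = 0"
    "(Z = Z$1 *s axis 1 1) \<longleftrightarrow> Z$0 = 0 \<and> Z$2 = 0 \<and> Z$3 = 0"
    "(Z = Z$2 *s axis 2 1) \<longleftrightarrow> Z$0 = 0 \<and> Z$1 = 0 \<and> Z$3 = 0"
    "(Z = Z$3 *s axis 3 1) \<longleftrightarrow> Z$0 = 0 \<and> Z$1 = 0 \<and> Z$2 = 0"
    by (simp_all add: vec4_eq_iff axis_def)
  have nf: "\<not> (Z$3 = Z$0 \<and> Z$2 = - Z$1 \<or> Z$3 = - Z$0 \<and> Z$2 = Z$1)"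
    "\<not> (Z$1 = Z$0 \<and> Z$3 = - Z$2 \<or> Z$1 = - Z$0 \<and> Z$3 = Z$2)"
    "\<not> (Z$2 = Z$0 \<and> Z$1 = - Z$3 \<or> Z$2 = - Z$0 \<and> Z$1 = Z$3)"
    using assms(2) unfolding cremona_eq_0_iff face_defs by auto
  \<comment> \<open>Off the curve at most one of the three quadrics vanishes, so for at least two
    indices k it is the factor \<open>Z0 Zk + Zl Zm\<close> that does.\<close>
  from False A on_curveI[of Z] consider
      "Z$0 * Z$1 + Z$2 * Z$3 = 0" "Z$0 * Z$2 + Z$3 * Z$1 = 0"
    | "Z$0 * Z$2 + Z$3 * Z$1 = 0" "Z$0 * Z$3 + Z$1 * Z$2 = 0"
    | "Z$0 * Z$3 + Z$1 * Z$2 = 0" "Z$0 * Z$1 + Z$2 * Z$3 = 0"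
    by blast
  then have "\<exists>\<nu>\<in>{0, 1, 2, 3}. Z = Z$\<nu> *s axis \<nu> 1"
  proof cases
    case 1
    from on_curve_if_two_zero[OF 1 _ nz(3) d(1)] A nf(1) show ?thesis unfolding bex_simps ax by blast
  next
    case 2
    from on_curve_if_two_zero[OF 2 _ nz(1) d(2)] A nf(2) show ?thesis unfolding bex_simps ax by blast
  next
    case 3
    from on_curve_if_two_zero[OF 3 _ nz(2) d(3)] A nf(3) show ?thesis unfolding bex_simps ax by blast
  qed
  then show ?thesis by blast
qed simp

end

section \<open>The zeros of the Cremona map on the characteristic variety\<close>

lemma rel_pair_iff:
  "rel_pair a b c Z W \<longleftrightarrow>
     Z$0 * W$1 - Z$1 * W$0 = Z$2 * W$3 + Z$3 * W$2 \<and>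
     Z$0 * W$2 - Z$2 * W$0 = Z$3 * W$1 + Z$1 * W$3 \<and>
     Z$0 * W$3 - Z$3 * W$0 = Z$1 * W$2 + Z$2 * W$1 \<and>
     a * (Z$2 * W$3 - Z$3 * W$2) + (b - c) * (Z$0 * W$1 + Z$1 * W$0) = 0 \<and>
     b * (Z$3 * W$1 - Z$1 * W$3) + (c - a) * (Z$0 * W$2 + Z$2 * W$0) = 0 \<and>
     c * (Z$1 * W$2 - Z$2 * W$1) + (a - b) * (Z$0 * W$3 + Z$3 * W$0) = 0"
proof -
  have "dot4 (rowR1 Z) W = Z$0 * W$1 - Z$1 * W$0 - (Z$2 * W$3 + Z$3 * W$2)"
    "dot4 (rowR2 Z) W = Z$0 * W$2 - Z$2 * W$0 - (Z$3 * W$1 + Z$1 * W$3)"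
    "dot4 (rowR3 Z) W = Z$0 * W$3 - Z$3 * W$0 - (Z$1 * W$2 + Z$2 * W$1)"
    "dot4 (rowS1 a b c Z) W = a * (Z$2 * W$3 - Z$3 * W$2) + (b - c) * (Z$0 * W$1 + Z$1 * W$0)"
    "dot4 (rowS2 a b c Z) W = b * (Z$3 * W$1 - Z$1 * W$3) + (c - a) * (Z$0 * W$2 + Z$2 * W$0)"
    "dot4 (rowS3 a b c Z) W = c * (Z$1 * W$2 - Z$2 * W$1) + (a - b) * (Z$0 * W$3 + Z$3 * W$0)"
    unfolding dot4_def row_defs vec4_nth by Groebner_Basis.algebra+
  then show ?thesis unfolding rel_pair_def by simp
qed

text \<open>The six lines on which \<^term>\<open>cremona\<close> vanishes are given by \<open>z\<^sub>1 = e z\<^sub>0\<close>, \<open>z\<^sub>3 = - e z\<^sub>2\<close> for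
  \<open>e = 1, -1\<close> and the cyclic permutations of the last three coordinates.\<close>

lemma squares_eq_on_line:
  fixes z0 z1 z2 z3 w0 w1 w2 w3 a b c e :: complex
  assumes e: "e * e = 1" and z: "z1 = e * z0" "z3 = - (e * z2)"
    and R: "z0 * w1 - z1 * w0 = z2 * w3 + z3 * w2" "z0 * w2 - z2 * w0 = z3 * w1 + z1 * w3"
    and S1: "a * (z2 * w3 - z3 * w2) + (b - c) * (z0 * w1 + z1 * w0) = 0"
    and S2: "b * (z3 * w1 - z1 * w3) + (c - a) * (z0 * w2 + z2 * w0) = 0"
    and S3: "c * (z1 * w2 - z2 * w1) + (a - b) * (z0 * w3 + z3 * w0) = 0"
    and nz: "\<not> (z0 = 0 \<and> z1 = 0 \<and> z2 = 0 \<and> z3 = 0)" "\<not> (w0 = 0 \<and> w1 = 0 \<and> w2 = 0 \<and> w3 = 0)"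
    and abc: "a \<noteq> 0" "b \<noteq> c" "a + b \<noteq> c" "c + a \<noteq> b"
  shows "z0\<^sup>2 = z2\<^sup>2"
proof (rule ccontr)
  assume "z0\<^sup>2 \<noteq> z2\<^sup>2"
  then have d: "z0 * z0 - z2 * z2 \<noteq> 0" by (simp add: power2_eq_square)
  have e0: "e \<noteq> 0" using e by auto
  \<comment> \<open>Away from the vertices W lies, up to the sign of w0, on the opposite edge: this
    is the line into which the Cremona map blows up a point of an edge.\<close>
  have "(z0 * z0 - z2 * z2) * (w1 - e * w0) = 0" "(z0 * z0 - z2 * z2) * (w3 - e * w2) = 0"
    using R e unfolding z by Groebner_Basis.algebra+
  then have w: "w1 = e * w0" "w3 = e * w2" using d by auto
  have "2 * e * (a * (z2 * w2) + (b - c) * (z0 * w0)) = 0" using S1 unfolding w z by Groebner_Basis.algebra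
  then have 1: "a * (z2 * w2) + (b - c) * (z0 * w0) = 0" using e0 by simp
  have n: "c - (a + b) \<noteq> 0" "c + a - b \<noteq> 0" using abc by auto
  have "(c - (a + b)) * (z0 * w2 + z2 * w0) = 0" using S2 e unfolding w z by Groebner_Basis.algebra
  then have 2: "z0 * w2 + z2 * w0 = 0" using n(1) unfolding mult_eq_0_iff by blast
  have "e * (c + a - b) * (z0 * w2 - z2 * w0) = 0" using S3 e unfolding w z by Groebner_Basis.algebra
  then have 3: "z0 * w2 - z2 * w0 = 0" using n(2) e0 unfolding mult_eq_0_iff by blast
  have 4: "z0 * w2 = 0" "z2 * w0 = 0" using 2 3 by auto
  have nz': "w0 \<noteq> 0 \<or> w2 \<noteq> 0" "z0 \<noteq> 0 \<or> z2 \<noteq> 0" using nz w z by auto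
  have "b - c \<noteq> 0" using abc by simp
  then have "z2 * w2 = 0 \<longleftrightarrow> z0 * w0 = 0" using 1 abc(1) by auto
  then show False using 4 nz' unfolding mult_eq_0_iff by blast
qed

context nondegenerate
begin

text \<open>For nonzero Z these are the multiples of the sign vectors (1, e1, e2, e3) with e1 e2 e3
  = -1, that is, the four vertices of the tetrahedron. The quadratic form of the conditions is the
  one in which they are substituted into the six equations.\<close>

definition special_point :: "complex^4 \<Rightarrow> bool" where
  "special_point Z \<longleftrightarrow> (Z$1)\<^sup>2 = (Z$0)\<^sup>2 \<and> (Z$2)\<^sup>2 = (Z$0)\<^sup>2 \<and> (Z$3)\<^sup>2 = (Z$0)\<^sup>2 \<and>
     Z$2 * Z$3 = - (Z$0 * Z$1) \<and> Z$3 * Z$1 = - (Z$0 * Z$2) \<and> Z$1 * Z$2 = - (Z$0 * Z$3)"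

lemma special_pointI:
  fixes Z :: "complex^4"
  assumes "cremona Z = 0"
    and c1: "Z$1 = Z$0 \<and> Z$3 = - Z$2 \<Longrightarrow> (Z$0)\<^sup>2 = (Z$2)\<^sup>2"
    and c2: "Z$1 = - Z$0 \<and> Z$3 = Z$2 \<Longrightarrow> (Z$0)\<^sup>2 = (Z$2)\<^sup>2"
    and c3: "Z$2 = Z$0 \<and> Z$1 = - Z$3 \<Longrightarrow> (Z$0)\<^sup>2 = (Z$3)\<^sup>2"
    and c4: "Z$2 = - Z$0 \<and> Z$1 = Z$3 \<Longrightarrow> (Z$0)\<^sup>2 = (Z$3)\<^sup>2"
    and c5: "Z$3 = Z$0 \<and> Z$2 = - Z$1 \<Longrightarrow> (Z$0)\<^sup>2 = (Z$1)\<^sup>2"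
    and c6: "Z$3 = - Z$0 \<and> Z$2 = Z$1 \<Longrightarrow> (Z$0)\<^sup>2 = (Z$1)\<^sup>2"
  shows "special_point Z"
  using cremona_zero_cases[OF assms(1)]
proof (elim disjE)
  assume "Z$1 = Z$0 \<and> Z$3 = - Z$2"
  with c1[OF this] show ?thesis by (elim conjE) (simp add: special_point_def power2_eq_square)
next
  assume "Z$1 = - Z$0 \<and> Z$3 = Z$2"
  with c2[OF this] show ?thesis by (elim conjE) (simp add: special_point_def power2_eq_square)
next
  assume "Z$2 = Z$0 \<and> Z$1 = - Z$3"
  with c3[OF this] show ?thesis by (elim conjE) (simp add: special_point_def power2_eq_square)
next
  assume "Z$2 = - Z$0 \<and> Z$1 = Z$3"
  with c4[OF this] show ?thesis by (elim conjE) (simp add: special_point_def power2_eq_square)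
next
  assume "Z$3 = Z$0 \<and> Z$2 = - Z$1"
  with c5[OF this] show ?thesis by (elim conjE) (simp add: special_point_def power2_eq_square)
next
  assume "Z$3 = - Z$0 \<and> Z$2 = Z$1"
  with c6[OF this] show ?thesis by (elim conjE) (simp add: special_point_def power2_eq_square)
qed

lemma on_curve_if_special_point: "special_point Z \<Longrightarrow> on_curve a b c Z"
  by (simp add: special_point_def on_curve_def)

lemma special_point_if_on_curve:
  assumes "on_curve a b c Z" "cremona Z = 0"
  shows "special_point Z"
proof -
  have *: "(Z$0)\<^sup>2 = (Z$1)\<^sup>2 \<or> (Z$0)\<^sup>2 = (Z$2)\<^sup>2 \<or> (Z$0)\<^sup>2 = (Z$3)\<^sup>2 \<Longrightarrow>
      (Z$0)\<^sup>2 = (Z$1)\<^sup>2 \<and> (Z$0)\<^sup>2 = (Z$2)\<^sup>2 \<and> (Z$0)\<^sup>2 = (Z$3)\<^sup>2"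
    using assms(1) nz unfolding on_curve_def by auto
  show ?thesis by (rule special_pointI[OF assms(2)]; (use * in simp))
qed

text \<open>\<open>squares_eq_on_line\<close>, applied with e = 1 and e = -1 to the three cyclic
  permutations of the indices, covers the six edges.\<close>

lemma special_point_if_rel_pair:
  assumes "rel_pair a b c Z W" "Z \<noteq> 0" "W \<noteq> 0" "cremona Z = 0"
  shows "special_point Z"
proof -
  have nzZ: "\<not> (Z$0 = 0 \<and> Z$1 = 0 \<and> Z$2 = 0 \<and> Z$3 = 0)" "\<not> (W$0 = 0 \<and> W$1 = 0 \<and> W$2 = 0 \<and> W$3 = 0)"
    using assms(2,3) by (auto simp: vec4_eq_iff)
  have nzZ2: "\<not> (Z$0 = 0 \<and> Z$2 = 0 \<and> Z$3 = 0 \<and> Z$1 = 0)" "\<not> (W$0 = 0 \<and> W$2 = 0 \<and> W$3 = 0 \<and> W$1 = 0)"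
    "\<not> (Z$0 = 0 \<and> Z$3 = 0 \<and> Z$1 = 0 \<and> Z$2 = 0)" "\<not> (W$0 = 0 \<and> W$3 = 0 \<and> W$1 = 0 \<and> W$2 = 0)"
    using nzZ by auto
  have R: "Z$0 * W$1 - Z$1 * W$0 = Z$2 * W$3 + Z$3 * W$2"
     "Z$0 * W$2 - Z$2 * W$0 = Z$3 * W$1 + Z$1 * W$3"
     "Z$0 * W$3 - Z$3 * W$0 = Z$1 * W$2 + Z$2 * W$1"
     "a * (Z$2 * W$3 - Z$3 * W$2) + (b - c) * (Z$0 * W$1 + Z$1 * W$0) = 0"
     "b * (Z$3 * W$1 - Z$1 * W$3) + (c - a) * (Z$0 * W$2 + Z$2 * W$0) = 0"
     "c * (Z$1 * W$2 - Z$2 * W$1) + (a - b) * (Z$0 * W$3 + Z$3 * W$0) = 0"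
    using assms(1) unfolding rel_pair_iff by auto
  have 1: "Z$1 = e * Z$0 \<Longrightarrow> Z$3 = - (e * Z$2) \<Longrightarrow> (Z$0)\<^sup>2 = (Z$2)\<^sup>2" if "e * e = 1" for e
    by (rule squares_eq_on_line[OF that _ _ R(1,2,4,5,6) nzZ]) (use nz distinct triangle in auto)
  have 2: "Z$2 = e * Z$0 \<Longrightarrow> Z$1 = - (e * Z$3) \<Longrightarrow> (Z$0)\<^sup>2 = (Z$3)\<^sup>2" if "e * e = 1" for e
    by (rule squares_eq_on_line[OF that _ _ R(2,3,5,6,4) nzZ2(1,2)]) (use nz distinct triangle in auto)
  have 3: "Z$3 = e * Z$0 \<Longrightarrow> Z$2 = - (e * Z$1) \<Longrightarrow> (Z$0)\<^sup>2 = (Z$1)\<^sup>2" if "e * e = 1" for e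
    by (rule squares_eq_on_line[OF that _ _ R(3,1,6,4,5) nzZ2(3,4)]) (use nz distinct triangle in auto)
  have c1: "Z$1 = Z$0 \<and> Z$3 = - Z$2 \<Longrightarrow> (Z$0)\<^sup>2 = (Z$2)\<^sup>2"
    by (elim conjE, rule 1[of "1"]; simp)
  have c2: "Z$1 = - Z$0 \<and> Z$3 = Z$2 \<Longrightarrow> (Z$0)\<^sup>2 = (Z$2)\<^sup>2"
    by (elim conjE, rule 1[of "-1"]; simp)
  have c3: "Z$2 = Z$0 \<and> Z$1 = - Z$3 \<Longrightarrow> (Z$0)\<^sup>2 = (Z$3)\<^sup>2"
    by (elim conjE, rule 2[of "1"]; simp)
  have c4: "Z$2 = - Z$0 \<and> Z$1 = Z$3 \<Longrightarrow> (Z$0)\<^sup>2 = (Z$3)\<^sup>2"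
    by (elim conjE, rule 2[of "-1"]; simp)
  have c5: "Z$3 = Z$0 \<and> Z$2 = - Z$1 \<Longrightarrow> (Z$0)\<^sup>2 = (Z$1)\<^sup>2"
    by (elim conjE, rule 3[of "1"]; simp)
  have c6: "Z$3 = - Z$0 \<and> Z$2 = Z$1 \<Longrightarrow> (Z$0)\<^sup>2 = (Z$1)\<^sup>2"
    by (elim conjE, rule 3[of "-1"]; simp)
  show ?thesis by (rule special_pointI[OF assms(4) c1 c2 c3 c4 c5 c6])
qed

text \<open>At a vertex Z put W = (t0 Z0, t1 Z1, t2 Z2, t3 Z3). The R-equations reduce to t0 = t1 +
  t2 + t3, and the first S-equation to a (t3 - t2) = (b - c) (t0 + t1). With wk = - (t0 + tk) / 4
  the latter becomes a (w3 - w2) = (b - c) w1, and the cyclic system is solved by w1 = a (b + c - a)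
  and its analogues. Then t0 = - w0 and tk = w0 - 4 wk with w0 = w1 + w2 + w3.\<close>

definition special_weights :: "complex^4" where
  "special_weights = vec4 (a * (b + c - a) + b * (c + a - b) + c * (a + b - c))
     (a * (b + c - a)) (b * (c + a - b)) (c * (a + b - c))"

definition special_image :: "complex^4 \<Rightarrow> complex^4" where
  "special_image Z = vec4 (- (Z$0 * special_weights$0)) (Z$1 * (special_weights$0 - 4 * special_weights$1)) (Z$2 * (special_weights$0 - 4 * special_weights$2)) (Z$3 * (special_weights$0 - 4 * special_weights$3))"

lemma rel_pair_special_image:
  assumes "special_point Z"
  shows "rel_pair a b c Z (special_image Z)"
proof -
  have d0: "special_weights$0 = special_weights$1 + special_weights$2 + special_weights$3" by (simp add: special_weights_def)
  have d: "a * (special_weights$3 - special_weights$2) = (b - c) * special_weights$1" "b * (special_weights$1 - special_weights$3) = (c - a) * special_weights$2" "c * (special_weights$2 - special_weights$1) = (a - b) * special_weights$3"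
    by (simp_all add: special_weights_def algebra_simps)
  show ?thesis
    using assms d unfolding special_point_def rel_pair_iff special_image_def vec4_nth d0
    by (intro conjI; elim conjE; Groebner_Basis.algebra)
qed

text \<open>If the factors of Z0 and Z1 were both zero, then a (b + c - a) would be zero.\<close>

lemma special_image_nonzero:
  assumes "special_point Z" "Z \<noteq> 0"
  shows "special_image Z \<noteq> 0"
proof
  assume 0: "special_image Z = 0"
  have z: "Z$0 \<noteq> 0" "Z$1 \<noteq> 0" using assms unfolding special_point_def vec4_eq_iff by auto
  have "special_weights$0 = 0" "special_weights$0 - 4 * special_weights$1 = 0"
    using 0 z unfolding special_image_def vec4_eq_iff vec4_nth by auto
  then have "special_weights$1 = 0" by simp
  then show False using nz triangle by (simp add: special_weights_def)
qed

text \<open>At a vertex the minors of R1, S1, S2 are Z0 Z2 times the explicit solution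
  \<open>special_image Z\<close>, and all coordinates of a vertex are nonzero.\<close>

lemma chart2_nonzero:
  assumes "special_point Z" "Z \<noteq> 0"
  shows "chart2 Z \<noteq> 0"
proof -
  have "chart2 Z $ 0 = Z$0 * Z$2 * special_image Z $ 0" "chart2 Z $ 1 = Z$0 * Z$2 * special_image Z $ 1"
    "chart2 Z $ 2 = Z$0 * Z$2 * special_image Z $ 2" "chart2 Z $ 3 = Z$0 * Z$2 * special_image Z $ 3"
    using assms(1) unfolding special_point_def chart2_def special_image_def special_weights_def cross4_def row_defs det3_def vec4_nth
    by - (elim conjE; Groebner_Basis.algebra)+
  then have "chart2 Z = (Z$0 * Z$2) *s special_image Z"
    unfolding vec4_eq_iff vector_smult_component by blast
  moreover have "Z$0 \<noteq> 0" "Z$2 \<noteq> 0"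
    using assms unfolding special_point_def vec4_eq_iff by auto
  ultimately show ?thesis using special_image_nonzero[OF assms] by auto
qed

text \<open>Every term of the six equations is a product of two coordinates with different
  indices.\<close>

lemma rel_pair_axis: "rel_pair a b c (axis \<nu> 1) (axis \<nu> 1)"
  using index4_cases[of \<nu>] by (auto simp: rel_pair_iff axis_def)

definition on_char :: "complex^4 \<Rightarrow> bool" where
  "on_char Z \<longleftrightarrow> on_curve a b c Z \<or> (\<exists>\<nu>. Z = Z$\<nu> *s axis \<nu> 1)"

lemma on_char_if_rel_pair:
  assumes "rel_pair a b c Z W" "Z \<noteq> 0" "W \<noteq> 0"
  shows "on_char Z"
proof (cases "cremona Z = 0")
  case True
  then show ?thesis
    using special_point_if_rel_pair[OF assms] on_curve_if_special_point unfolding on_char_def by blast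
next
  case False
  obtain k where k: "k \<noteq> 0" "W = k *s cremona Z"
    using rel_pair_cremona[OF assms(1,3) False] by blast
  then have "rel_pair a b c Z (cremona Z)"
    using assms(1) rel_pair_scale[of 1 k a b c Z "cremona Z"] by simp
  then show ?thesis using on_curve_or_axis_if_cremona[OF _ False] unfolding on_char_def by blast
qed

lemma rel_pair_exists:
  assumes "on_char Z" "Z \<noteq> 0"
  obtains W where "W \<noteq> 0" "rel_pair a b c Z W"
  using assms(1) unfolding on_char_def
proof
  assume c: "on_curve a b c Z"
  show thesis
  proof (cases "cremona Z = 0")
    case True
    then show ?thesis
      using that special_point_if_on_curve[OF c] special_image_nonzero rel_pair_special_image assms(2) by blast
  qed (use that rel_pair_cremona_if_on_curve[OF c] in blast)
next
  assume "\<exists>\<nu>. Z = Z$\<nu> *s axis \<nu> 1"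
  then obtain \<nu> where \<nu>: "Z = Z$\<nu> *s axis \<nu> 1" by blast
  then have "Z$\<nu> \<noteq> 0" using assms(2) by auto
  then have "rel_pair a b c Z (1 *s axis \<nu> 1)"
    using rel_pair_axis[of \<nu>] rel_pair_scale[of "Z$\<nu>" 1 a b c "axis \<nu> 1"] \<nu> by force
  then show thesis by (intro that[of "axis \<nu> 1"]) auto
qed

lemma special_point_if_on_char:
  assumes "on_char Z" "Z \<noteq> 0" "cremona Z = 0"
  shows "special_point Z"
  using rel_pair_exists[OF assms(1,2)] special_point_if_rel_pair[OF _ assms(2) _ assms(3)] by metis

lemma rel_pair_unique:
  assumes "rel_pair a b c Z W" "rel_pair a b c Z W'" "Z \<noteq> 0" "W \<noteq> 0" "W' \<noteq> 0"
  obtains k where "k \<noteq> 0" "W' = k *s W"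
proof -
  have "\<exists>V j k. j \<noteq> 0 \<and> k \<noteq> 0 \<and> W = j *s V \<and> W' = k *s V"
  proof (cases "cremona Z = 0")
    case True
    then have "chart2 Z \<noteq> 0"
      using chart2_nonzero[OF special_point_if_rel_pair[OF assms(1,3,4)] assms(3)] by blast
    then show ?thesis using rel_pair_chart2[OF assms(1,4)] rel_pair_chart2[OF assms(2,5)] by metis
  qed (use rel_pair_cremona[OF assms(1,4)] rel_pair_cremona[OF assms(2,5)] in metis)
  then obtain V j k where "j \<noteq> 0" "k \<noteq> 0" "W = j *s V" "W' = k *s V" by blast
  then show ?thesis by (intro that[of "k / j"]) (simp_all add: vector_smult_assoc)
qed

end

subsection \<open>Forms and hypersurfaces\<close>

definition monom_exps :: "nat \<Rightarrow> ('n::finite \<Rightarrow> nat) set" where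
  "monom_exps d = {e. (\<Sum>i\<in>UNIV. e i) = d}"

definition monom_at :: "('n::finite \<Rightarrow> nat) \<Rightarrow> complex^'n \<Rightarrow> complex" where
  "monom_at e v = (\<Prod>i\<in>UNIV. v $ i ^ e i)"

lemma forms_eq: "forms K d = {\<lambda>v. \<Sum>e\<in>monom_exps d. c e * monom_at e v | c. range c \<subseteq> K}"
  unfolding forms_def monom_exps_def monom_at_def ..

lemma finite_monom_exps: "finite (monom_exps d :: ('n::finite \<Rightarrow> nat) set)"
proof (rule finite_subset)
  show "monom_exps d \<subseteq> (PiE UNIV (\<lambda>_. {..d}) :: ('n \<Rightarrow> nat) set)"
  proof
    fix e :: "'n \<Rightarrow> nat" assume e: "e \<in> monom_exps d"
    have "e i \<le> (\<Sum>i\<in>UNIV. e i)" for i by (rule member_le_sum) auto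
    then show "e \<in> PiE UNIV (\<lambda>_. {..d})" using e by (auto simp: monom_exps_def)
  qed
qed (rule finite_PiE, auto)

lemma forms_homogeneous:
  assumes "f \<in> forms K d"
  shows "f (k *s v) = k ^ d * f v"
proof -
  obtain c where c: "f = (\<lambda>v. \<Sum>e\<in>monom_exps d. c e * monom_at e v)"
    using assms by (auto simp: forms_eq)
  have "monom_at e (k *s v) = k ^ d * monom_at e v" if "e \<in> monom_exps d" for e
    using that by (simp add: monom_at_def monom_exps_def power_mult_distrib prod.distrib flip: power_sum)
  then show ?thesis
    by (simp add: c sum_distrib_left mult.left_commute)
qed

text \<open>One treatment for two coefficient sets: the rational numbers for the birational map, the
  complex numbers for the regular maps and for the excluded hypersurface.\<close>

locale coefficient_ring =
  fixes K :: "complex set"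
  assumes zero: "0 \<in> K" and one: "1 \<in> K" and uminus: "x \<in> K \<Longrightarrow> - x \<in> K"
    and add: "x \<in> K \<Longrightarrow> y \<in> K \<Longrightarrow> x + y \<in> K" and mult: "x \<in> K \<Longrightarrow> y \<in> K \<Longrightarrow> x * y \<in> K"
begin

lemma sum_closed: "(\<And>i. i \<in> I \<Longrightarrow> f i \<in> K) \<Longrightarrow> (\<Sum>i\<in>I. f i) \<in> K"
  by (induction I rule: infinite_finite_induct) (auto simp: zero add)

lemma forms_coordinate: "(\<lambda>v. v $ i) \<in> forms K 1"
proof -
  define e0 where "e0 = (\<lambda>j. if j = i then 1 else 0 :: nat)"
  have e0: "e0 \<in> monom_exps 1" by (simp add: monom_exps_def e0_def)
  have "monom_at e0 v = v $ i" for v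
    unfolding monom_at_def e0_def by (simp add: if_distrib[of "\<lambda>n. _ ^ n"] cong: if_cong)
  then have "(\<lambda>v. v $ i) = (\<lambda>v. \<Sum>e\<in>monom_exps 1. (if e = e0 then 1 else 0) * monom_at e v)"
    using e0 by (simp add: finite_monom_exps if_distrib[of "\<lambda>x. x * _"] cong: if_cong)
  moreover have "range (\<lambda>e. if e = e0 then 1 else 0 :: complex) \<subseteq> K" using zero one by auto
  ultimately show ?thesis unfolding forms_eq
    by (intro CollectI exI[of _ "\<lambda>e. if e = e0 then 1 else 0"] conjI)
qed

lemma forms_add:
  assumes "f \<in> forms K d" "g \<in> forms K d"
  shows "(\<lambda>v. f v + g v) \<in> forms K d"
proof -
  obtain c c' where c: "f = (\<lambda>v. \<Sum>e\<in>monom_exps d. c e * monom_at e v)" "range c \<subseteq> K"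
    and c': "g = (\<lambda>v. \<Sum>e\<in>monom_exps d. c' e * monom_at e v)" "range c' \<subseteq> K"
    using assms by (auto simp: forms_eq)
  have "(\<lambda>v. f v + g v) = (\<lambda>v. \<Sum>e\<in>monom_exps d. (c e + c' e) * monom_at e v)"
    by (simp add: c c' sum.distrib distrib_right)
  moreover have "range (\<lambda>e. c e + c' e) \<subseteq> K" using c c' by (auto intro!: add)
  ultimately show ?thesis unfolding forms_eq by (intro CollectI exI[of _ "\<lambda>e. c e + c' e"]) simp
qed

lemma forms_cmult:
  assumes "f \<in> forms K d" "k \<in> K"
  shows "(\<lambda>v. k * f v) \<in> forms K d"
proof -
  obtain c where c: "f = (\<lambda>v. \<Sum>e\<in>monom_exps d. c e * monom_at e v)" "range c \<subseteq> K"
    using assms by (auto simp: forms_eq)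
  have "(\<lambda>v. k * f v) = (\<lambda>v. \<Sum>e\<in>monom_exps d. (k * c e) * monom_at e v)"
    by (simp add: c sum_distrib_left mult.assoc)
  moreover have "range (\<lambda>e. k * c e) \<subseteq> K" using c assms(2) by (auto intro!: mult)
  ultimately show ?thesis unfolding forms_eq by (intro CollectI exI[of _ "\<lambda>e. k * c e"]) simp
qed

lemma forms_uminus: "f \<in> forms K d \<Longrightarrow> (\<lambda>v. - f v) \<in> forms K d"
  using forms_cmult[of f d "-1"] uminus[OF one] by simp

lemma forms_diff: "f \<in> forms K d \<Longrightarrow> g \<in> forms K d \<Longrightarrow> (\<lambda>v. f v - g v) \<in> forms K d"
  using forms_add[OF _ forms_uminus, of f d g] by simp

text \<open>Cauchy product: pairs of exponent functions are grouped by their sum, and the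
  coefficient \<open>C\<close> collects the finitely many pairs with a given sum.\<close>

lemma forms_mult:
  fixes f g :: "complex^'n::finite \<Rightarrow> complex"
  assumes "f \<in> forms K d" "g \<in> forms K d'"
  shows "(\<lambda>v. f v * g v) \<in> forms K (d + d')"
proof -
  obtain c c' where c: "f = (\<lambda>v. \<Sum>e\<in>monom_exps d. c e * monom_at e v)" "range c \<subseteq> K"
    and c': "g = (\<lambda>v. \<Sum>e\<in>monom_exps d'. c' e * monom_at e v)" "range c' \<subseteq> K"
    using assms by (auto simp: forms_eq)
  define S :: "(('n \<Rightarrow> nat) \<times> ('n \<Rightarrow> nat)) set" where "S = monom_exps d \<times> monom_exps d'"
  define p where "p = (\<lambda>(e :: 'n \<Rightarrow> nat, e' :: 'n \<Rightarrow> nat) i. e i + e' i)"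
  define C where "C = (\<lambda>g. \<Sum>x\<in>{x\<in>S. p x = g}. c (fst x) * c' (snd x))"
  have fS: "finite S" by (simp add: S_def finite_monom_exps)
  have im: "p ` S \<subseteq> monom_exps (d + d')"
    by (auto simp: S_def p_def monom_exps_def sum.distrib)
  have mon: "monom_at (p x) v = monom_at (fst x) v * monom_at (snd x) v" for x v
    by (simp add: monom_at_def p_def power_add prod.distrib case_prod_unfold)
  have "f v * g v = (\<Sum>e\<in>monom_exps (d + d'). C e * monom_at e v)" for v
  proof -
    have "f v * g v = (\<Sum>x\<in>S. c (fst x) * c' (snd x) * monom_at (p x) v)"
      unfolding c c' sum_product S_def sum.cartesian_product
      by (rule sum.cong) (auto simp: mon mult.commute mult.left_commute)
    also have "\<dots> = (\<Sum>e\<in>monom_exps (d + d'). \<Sum>x\<in>{x\<in>S. p x = e}. c (fst x) * c' (snd x) * monom_at (p x) v)"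
      by (rule sum.group[OF fS finite_monom_exps im, symmetric])
    also have "\<dots> = (\<Sum>e\<in>monom_exps (d + d'). C e * monom_at e v)"
      unfolding C_def sum_distrib_right by (intro sum.cong) auto
    finally show ?thesis .
  qed
  moreover have "range C \<subseteq> K"
    using c c' unfolding C_def by (auto intro!: sum_closed mult)
  ultimately show ?thesis unfolding forms_eq by (intro CollectI exI[of _ C]) auto
qed

end

interpretation complex_coefficients: coefficient_ring UNIV
  by unfold_locales auto

interpretation rational_coefficients: coefficient_ring \<rat>
  by unfold_locales auto

lemma pt_eq: "pt v = range (\<lambda>k. k *s v)"
  by (auto simp: pt_def vec.span_singleton)

lemma mem_pt: "v \<in> pt v"
  unfolding pt_eq by (rule image_eqI[of _ _ 1]) auto

lemma pt_eq_iff: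
  assumes "w \<noteq> 0"
  shows "pt v = pt w \<longleftrightarrow> (\<exists>k. k \<noteq> 0 \<and> v = k *s w)"
proof
  assume *: "pt v = pt w"
  obtain k where k: "v = k *s w" using mem_pt[of v, unfolded *] unfolding pt_eq by auto
  obtain j where "w = j *s v" using mem_pt[of w, folded *] unfolding pt_eq by auto
  then have "k \<noteq> 0" using assms k by auto
  then show "\<exists>k. k \<noteq> 0 \<and> v = k *s w" using k by blast
next
  assume "\<exists>k. k \<noteq> 0 \<and> v = k *s w"
  then obtain k where k: "k \<noteq> 0" "v = k *s w" by blast
  have "j *s w \<in> pt v" for j
    unfolding pt_eq using k by (intro range_eqI[of _ _ "j / k"]) (simp add: vector_smult_assoc)
  moreover have "j *s v \<in> pt w" for j
    unfolding pt_eq using k by (intro range_eqI[of _ _ "j * k"]) (simp add: vector_smult_assoc)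
  ultimately show "pt v = pt w" unfolding pt_eq by blast
qed

lemma pt_scale: "k \<noteq> 0 \<Longrightarrow> pt (k *s v) = pt v"
  by (cases "v = 0") (auto simp: pt_eq_iff)

lemma pt_eq_0: "pt v = pt w \<Longrightarrow> v = 0 \<longleftrightarrow> w = 0"
proof -
  assume *: "pt v = pt w"
  have "w \<noteq> 0 \<Longrightarrow> v \<noteq> 0" using * pt_eq_iff[of w v] by auto
  moreover have "v \<noteq> 0 \<Longrightarrow> w \<noteq> 0" using *[symmetric] pt_eq_iff[of v w] by auto
  ultimately show ?thesis by blast
qed

definition hypersurface :: "(complex^'n \<Rightarrow> complex) \<Rightarrow> (complex^'n) set set" where
  "hypersurface g = {pt v | v. v \<noteq> 0 \<and> g v = 0}"

lemma pt_in_hypersurface: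
  assumes "g \<in> forms K d" "v \<noteq> 0"
  shows "pt v \<in> hypersurface g \<longleftrightarrow> g v = 0"
proof
  assume "pt v \<in> hypersurface g"
  then obtain w where w: "w \<noteq> 0" "g w = 0" "pt v = pt w" by (auto simp: hypersurface_def)
  then obtain k where "v = k *s w" using pt_eq_iff[OF w(1)] by auto
  then show "g v = 0" using forms_homogeneous[OF assms(1), of k w] w by simp
qed (use assms(2) in \<open>auto simp: hypersurface_def\<close>)

lemma proper_hypersurface:
  assumes "g \<in> forms UNIV d" "g v \<noteq> 0" "v \<noteq> 0"
  shows "proper_algebraic_subset (hypersurface g)"
proof -
  have "algebraic_subset (hypersurface g)"
    unfolding algebraic_subset_def hypersurface_def by (rule exI[of _ "{g}"]) (use assms(1) in auto)
  moreover have "pt v \<notin> hypersurface g" using assms by (simp add: pt_in_hypersurface)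
  then have "hypersurface g \<noteq> proj_space" using assms(3) by (auto simp: proj_space_def)
  ultimately show ?thesis by (simp add: proper_algebraic_subset_def)
qed

context coefficient_ring
begin

lemma linear_form: "k \<in> K \<Longrightarrow> (\<lambda>v. k * v $ i) \<in> forms K 1" "(\<lambda>v. - v $ i) \<in> forms K 1"
  by (intro forms_cmult forms_uminus forms_coordinate; assumption)+

lemma forms_det3:
  assumes "f1 \<in> forms K 1" "f2 \<in> forms K 1" "f3 \<in> forms K 1" "g1 \<in> forms K 1" "g2 \<in> forms K 1" "g3 \<in> forms K 1"
    "h1 \<in> forms K 1" "h2 \<in> forms K 1" "h3 \<in> forms K 1"
  shows "(\<lambda>v. det3 (f1 v) (f2 v) (f3 v) (g1 v) (g2 v) (g3 v) (h1 v) (h2 v) (h3 v)) \<in> forms K 3"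
proof -
  have "(\<lambda>v. f v * g v * h v) \<in> forms K 3" if "f \<in> forms K 1" "g \<in> forms K 1" "h \<in> forms K 1" for f g h
    using forms_mult[OF forms_mult[OF that(1,2)] that(3)] by (simp add: numeral_3_eq_3)
  then show ?thesis unfolding det3_def using assms by (intro forms_add forms_diff) blast+
qed

lemma form_maps_cross4:
  assumes "f \<in> form_maps K 1" "g \<in> form_maps K 1" "h \<in> form_maps K 1"
  shows "(\<lambda>v. cross4 (f v) (g v) (h v)) \<in> form_maps K 3"
proof -
  have "\<forall>i. (\<lambda>v. cross4 (f v) (g v) (h v) $ i) \<in> forms K 3"
    using assms unfolding forall_index4 cross4_def vec4_nth form_maps_def
    by (intro conjI forms_det3 forms_uminus) auto
  then show ?thesis by (simp add: form_maps_def)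
qed

lemma form_maps_rowR: "rowR1 \<in> form_maps K 1" "rowR2 \<in> form_maps K 1" "rowR3 \<in> form_maps K 1"
  unfolding form_maps_def row_defs mem_Collect_eq forall_index4 vec4_nth
  by (intro conjI linear_form forms_coordinate)+

lemma form_maps_cremona: "cremona \<in> form_maps K 3"
  unfolding cremona_def[abs_def] by (intro form_maps_cross4 form_maps_rowR)

end

subsection \<open>The Cremona transformation and the curve\<close>

lemma (in coefficient_ring) form_maps_flip0:
  assumes "f \<in> form_maps K d"
  shows "(\<lambda>v. flip0 (f v)) \<in> form_maps K d"
proof -
  have f: "(\<lambda>v. f v $ i) \<in> forms K d" for i using assms by (simp add: form_maps_def)
  have "\<forall>i. (\<lambda>v. flip0 (f v) $ i) \<in> forms K d"
    unfolding forall_index4 flip0_def vec4_nth by (intro conjI forms_uminus f)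
  then show ?thesis by (simp add: form_maps_def)
qed

lemma (in coefficient_ring) form_maps_cremona_flip0: "(\<lambda>v. cremona (flip0 v)) \<in> form_maps K 3"
proof -
  have "(\<lambda>v. rowR1 (flip0 v)) \<in> form_maps K 1" "(\<lambda>v. rowR2 (flip0 v)) \<in> form_maps K 1" "(\<lambda>v. rowR3 (flip0 v)) \<in> form_maps K 1"
    unfolding form_maps_def row_defs mem_Collect_eq forall_index4 flip0_def vec4_nth
    by (intro conjI linear_form forms_uminus forms_coordinate)+
  then show ?thesis unfolding cremona_def by (rule form_maps_cross4)
qed

lemma (in coefficient_ring) forms_face_prod:
  "(\<lambda>v. face_prod v) \<in> forms K 4" "(\<lambda>v. face_prod (flip0 v)) \<in> forms K 4"
proof -
  have *: "(\<lambda>v. f v * g v * (h v * k v)) \<in> forms K 4"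
    if "f \<in> forms K 1" "g \<in> forms K 1" "h \<in> forms K 1" "k \<in> forms K 1" for f g h k :: "complex^4 \<Rightarrow> complex"
    using forms_mult[OF forms_mult[OF that(1,2)] forms_mult[OF that(3,4)]] by (simp add: eval_nat_numeral)
  show "(\<lambda>v. face_prod v) \<in> forms K 4" unfolding face_prod_def face_defs
    by (intro * forms_add forms_diff linear_form forms_coordinate)
  show "(\<lambda>v. face_prod (flip0 v)) \<in> forms K 4" unfolding face_prod_def face_defs flip0_def vec4_nth
    by (intro * forms_add forms_diff forms_uminus linear_form forms_coordinate)
qed

lemma flip0_0 [simp]: "flip0 0 = 0"
  by simp

lemma cremona_0 [simp]: "cremona 0 = 0"
  by (simp add: vec4_eq_iff cremona_nth)

text \<open>The inverse is \<open>cremona\<close> conjugated by \<open>flip0\<close>. One composite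
  is multiplication by the square of \<open>face_prod v\<close>, the other by the square of
  \<open>face_prod (flip0 v)\<close>; hence the product of both, a form of degree 8, defines the
  excluded set.\<close>

lemma birational_cremona: "birational_automorphism \<rat> cremona"
proof -
  define W where "W = hypersurface (\<lambda>v. face_prod v * face_prod (flip0 v))"
  define g where "g = (\<lambda>v. flip0 (cremona (flip0 v)))"
  have fW: "(\<lambda>v. face_prod v * face_prod (flip0 v)) \<in> forms UNIV 8"
    using complex_coefficients.forms_mult[OF complex_coefficients.forms_face_prod] by simp
  have W: "proper_algebraic_subset W"
    unfolding W_def
    by (rule proper_hypersurface[OF fW, of "vec4 1 0 0 0"])
       (simp_all add: face_prod_def face_defs flip0_def vec4_eq_iff)
  have g: "g \<in> form_maps \<rat> 3"
    unfolding g_def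
    by (intro rational_coefficients.form_maps_flip0 rational_coefficients.form_maps_cremona_flip0)
  have gf: "g (cremona v) = (face_prod v)\<^sup>2 *s v" for v
    unfolding g_def by (rule cremona_cremona)
  have fg: "cremona (g v) = (face_prod (flip0 v))\<^sup>2 *s v" for v
  proof -
    have "flip0 (flip0 (cremona (flip0 (cremona (flip0 v))))) = flip0 ((face_prod (flip0 v))\<^sup>2 *s flip0 v)"
      by (simp only: cremona_cremona)
    then show ?thesis by (simp add: g_def flip0_scale)
  qed
  have "cremona v \<noteq> 0 \<and> g (cremona v) \<noteq> 0 \<and> pt (g (cremona v)) = pt v \<and>
      g v \<noteq> 0 \<and> cremona (g v) \<noteq> 0 \<and> pt (cremona (g v)) = pt v" if v: "v \<noteq> 0" "pt v \<notin> W" for v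
  proof -
    have "face_prod v * face_prod (flip0 v) \<noteq> 0"
      using v pt_in_hypersurface[OF fW v(1)] by (simp add: W_def)
    then have n: "(face_prod v)\<^sup>2 \<noteq> 0" "(face_prod (flip0 v))\<^sup>2 \<noteq> 0" by auto
    have 1: "g (cremona v) \<noteq> 0" "pt (g (cremona v)) = pt v" unfolding gf using n v by (auto simp: pt_scale)
    have 2: "cremona (g v) \<noteq> 0" "pt (cremona (g v)) = pt v" unfolding fg using n v by (auto simp: pt_scale)
    have "cremona v \<noteq> 0" using 1(1) by (auto simp: g_def)
    moreover have "g v \<noteq> 0" using 2(1) by auto
    ultimately show ?thesis using 1 2 by blast
  qed
  then show ?thesis
    unfolding birational_automorphism_def using rational_coefficients.form_maps_cremona g W by blast
qed

section \<open>The matrix M and the fibre of Phi\<close>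

lemma matM_mult: "matM *v v = vec4 ((v$0 + v$1 + v$2 + v$3) / 2) ((v$0 + v$1 - v$2 - v$3) / 2)
    ((v$0 - v$1 + v$2 - v$3) / 2) ((v$0 - v$1 - v$2 + v$3) / 2)"
  by (simp add: vec4_eq_iff matrix_vector_mult_def sum_index4 matM_def field_simps)

lemma matM_involution: "matM *v (matM *v v) = v"
  by (simp add: matM_mult vec4_eq_iff field_simps)

lemma matM_scale: "matM *v (k *s v) = k *s (matM *v v)"
  unfolding matM_mult by (simp add: vec4_eq_iff field_simps)

lemma matM_eq_0: "matM *v v = 0 \<longleftrightarrow> v = 0"
proof
  assume "matM *v v = 0"
  then have "matM *v (matM *v v) = 0" by simp
  then show "v = 0" by (simp only: matM_involution)
qed simp

lemma matM_image_pt: "(\<lambda>v. matM *v v) ` pt v = pt (matM *v v)"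
  unfolding pt_eq image_image by (simp add: matM_scale)

text \<open>Z0 + Z1 = v0 + v1 and Z0 - Z1 = v2 + v3 for Z = Mv, and similarly for the other indices.
  Thus M turns the components of \<open>Phi\<close> into differences of squares and the fibre
  condition into the equations of the curve.\<close>

lemma matM_squares:
  "((matM *v v)$0)\<^sup>2 - ((matM *v v)$1)\<^sup>2 = par_a v" "((matM *v v)$0)\<^sup>2 - ((matM *v v)$2)\<^sup>2 = par_b v"
  "((matM *v v)$0)\<^sup>2 - ((matM *v v)$3)\<^sup>2 = par_c v"
  unfolding matM_mult vec4_nth par_a_def par_b_def par_c_def by (simp_all add: field_simps power2_eq_square)

lemma par_scale: "par_a (k *s v) = k\<^sup>2 * par_a v" "par_b (k *s v) = k\<^sup>2 * par_b v" "par_c (k *s v) = k\<^sup>2 * par_c v"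
  by (simp_all add: par_a_def par_b_def par_c_def algebra_simps power2_eq_square)

lemma Phi_eq_iff: "Phi v = k *s Phi u \<longleftrightarrow> par_a v = k * par_a u \<and> par_b v = k * par_b u \<and> par_c v = k * par_c u"
  by (simp add: Phi_def vec_eq_iff forall_3)

lemma Phi_eq_0_iff: "Phi v = 0 \<longleftrightarrow> par_a v = 0 \<and> par_b v = 0 \<and> par_c v = 0"
  by (simp add: Phi_def vec_eq_iff forall_3)

lemma sign_vecs:
  "(\<chi> \<mu>. if \<mu> = (0::4) then - 1 else 1) = vec4 (- 1) 1 1 1" "(\<chi> \<mu>. if \<mu> = (1::4) then - 1 else 1) = vec4 1 (- 1) 1 1"
  "(\<chi> \<mu>. if \<mu> = (2::4) then - 1 else 1) = vec4 1 1 (- 1) 1" "(\<chi> \<mu>. if \<mu> = (3::4) then - 1 else 1) = vec4 1 1 1 (- 1)"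
  by (simp_all add: vec4_eq_iff)

lemma axis_vecs:
  "axis (0::4) 1 = vec4 1 0 0 0" "axis (1::4) 1 = vec4 0 1 0 0" "axis (2::4) 1 = vec4 0 0 1 0" "axis (3::4) 1 = vec4 0 0 0 1"
  by (simp_all add: vec4_eq_iff axis_def)

lemma all_zero_if_sums_zero:
  fixes x y z :: complex
  assumes "x + y = 0" "x + z = 0" "y + z = 0"
  shows "x = 0 \<and> y = 0 \<and> z = 0"
proof -
  have "2 * x = 0" "2 * y = 0" "2 * z = 0" using assms by Groebner_Basis.algebra+
  then show ?thesis by simp
qed

text \<open>\<open>Phi\<close> vanishes when one of the two sums is zero in each of the three
  products. Viewed on the complete graph with vertices 0, 1, 2, 3, this selects one edge from each
  perfect matching, which gives a star or a triangle. A star at i forces a multiple of the sign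
  vector with -1 at i (facts \<open>c\<close>), and a triangle omitting i forces a multiple of the
  i-th coordinate vector (facts \<open>d\<close>).\<close>

lemma base_points_iff:
  assumes "v \<noteq> 0"
  shows "pt v \<in> base_points \<longleftrightarrow> Phi v = 0"
proof
  assume "pt v \<in> base_points"
  then obtain w where w: "pt v = pt w" "w \<in> range (\<lambda>\<nu>. axis \<nu> 1) \<union> range (\<lambda>\<nu>. \<chi> \<mu>. if \<mu> = \<nu> then - 1 else 1)"
    by (auto simp: base_points_def)
  have "w \<noteq> 0" using pt_eq_0[OF w(1)] assms by simp
  then obtain k where "v = k *s w" using w(1) pt_eq_iff by blast
  moreover have "par_a w = 0 \<and> par_b w = 0 \<and> par_c w = 0"
    using w(2) index4_cases by (fastforce simp: par_a_def par_b_def par_c_def axis_def)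
  ultimately show "Phi v = 0" by (simp add: Phi_eq_0_iff par_scale)
next
  have base: "pt v \<in> base_points" if "v = k *s w" "w \<in> range (\<lambda>\<nu>. axis \<nu> 1) \<union> range (\<lambda>\<nu>. \<chi> \<mu>. if \<mu> = \<nu> then - 1 else 1)" for k w
  proof -
    have "k \<noteq> 0" using that assms by auto
    then have "pt v = pt w" using that by (simp add: pt_scale)
    then show ?thesis using that(2) by (auto simp: base_points_def)
  qed
  have r: "axis \<nu> 1 \<in> range (\<lambda>\<nu>. axis \<nu> 1) \<union> range (\<lambda>\<nu>. \<chi> \<mu>. if \<mu> = \<nu> then - 1 else 1)"
    "(\<chi> \<mu>. if \<mu> = \<nu> then - 1 else 1) \<in> range (\<lambda>\<nu>. axis \<nu> 1) \<union> range (\<lambda>\<nu>. \<chi> \<mu>. if \<mu> = \<nu> then - 1 else 1)" for \<nu> :: 4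
    by auto
  assume "Phi v = 0"
  then have dis: "(v$0 + v$1 = 0 \<or> v$2 + v$3 = 0) \<and> (v$0 + v$2 = 0 \<or> v$1 + v$3 = 0) \<and> (v$0 + v$3 = 0 \<or> v$1 + v$2 = 0)"
    by (simp add: Phi_eq_0_iff par_a_def par_b_def par_c_def add.commute[of "v$3" "v$1"])
  have c:
    "v$0 + v$1 = 0 \<Longrightarrow> v$0 + v$2 = 0 \<Longrightarrow> v$0 + v$3 = 0 \<Longrightarrow> v = (- v$0) *s (\<chi> \<mu>. if \<mu> = 0 then - 1 else 1)"
    "v$0 + v$1 = 0 \<Longrightarrow> v$1 + v$3 = 0 \<Longrightarrow> v$1 + v$2 = 0 \<Longrightarrow> v = (- v$1) *s (\<chi> \<mu>. if \<mu> = 1 then - 1 else 1)"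
    "v$2 + v$3 = 0 \<Longrightarrow> v$0 + v$2 = 0 \<Longrightarrow> v$1 + v$2 = 0 \<Longrightarrow> v = (- v$2) *s (\<chi> \<mu>. if \<mu> = 2 then - 1 else 1)"
    "v$2 + v$3 = 0 \<Longrightarrow> v$1 + v$3 = 0 \<Longrightarrow> v$0 + v$3 = 0 \<Longrightarrow> v = (- v$3) *s (\<chi> \<mu>. if \<mu> = 3 then - 1 else 1)"
    unfolding sign_vecs unfolding vec4_eq_iff vector_smult_component vec4_nth
    by (auto simp: add_eq_0_iff)
  have d:
    "v$2 + v$3 = 0 \<Longrightarrow> v$1 + v$3 = 0 \<Longrightarrow> v$1 + v$2 = 0 \<Longrightarrow> v = v$0 *s axis 0 1"
    "v$2 + v$3 = 0 \<Longrightarrow> v$0 + v$2 = 0 \<Longrightarrow> v$0 + v$3 = 0 \<Longrightarrow> v = v$1 *s axis 1 1"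
    "v$0 + v$1 = 0 \<Longrightarrow> v$1 + v$3 = 0 \<Longrightarrow> v$0 + v$3 = 0 \<Longrightarrow> v = v$2 *s axis 2 1"
    "v$0 + v$1 = 0 \<Longrightarrow> v$0 + v$2 = 0 \<Longrightarrow> v$1 + v$2 = 0 \<Longrightarrow> v = v$3 *s axis 3 1"
    unfolding axis_vecs vec4_eq_iff vector_smult_component vec4_nth mult_zero_right mult_1_right
    using all_zero_if_sums_zero[of "v$1" "v$2" "v$3"] all_zero_if_sums_zero[of "v$0" "v$2" "v$3"]
      all_zero_if_sums_zero[of "v$0" "v$1" "v$3"] all_zero_if_sums_zero[of "v$0" "v$1" "v$2"]
    by blast+
  note m = base[OF c(1) r(2)] base[OF c(2) r(2)] base[OF c(3) r(2)] base[OF c(4) r(2)]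
    base[OF d(1) r(1)] base[OF d(2) r(1)] base[OF d(3) r(1)] base[OF d(4) r(1)]
  from dis show "pt v \<in> base_points" by (elim conjE disjE) (rule m; assumption)+
qed

lemma curveF_eq:
  assumes "par_a u \<noteq> 0"
  shows "curveF u = {pt Z | Z. Z \<noteq> 0 \<and> on_curve (par_a u) (par_b u) (par_c u) Z}"
proof -
  have Phi0: "Phi u \<noteq> 0" using assms by (simp add: Phi_eq_0_iff)
  have oc: "on_curve (par_a u) (par_b u) (par_c u) (matM *v v) \<longleftrightarrow> Phi v = 0 \<or> (\<exists>k. k \<noteq> 0 \<and> Phi v = k *s Phi u)" for v
  proof
    assume "on_curve (par_a u) (par_b u) (par_c u) (matM *v v)"
    then have e: "par_b u * par_a v = par_a u * par_b v" "par_c u * par_a v = par_a u * par_c v"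
      unfolding on_curve_def matM_squares by auto
    \<comment> \<open>The value k = 0 is the case of the base points; a nonzero k places v on the
      fibre.\<close>
    define k where "k = par_a v / par_a u"
    have "par_a v = k * par_a u" "par_b v = k * par_b u" "par_c v = k * par_c u"
      using e assms by (simp_all add: k_def field_simps)
    then have "Phi v = k *s Phi u" unfolding Phi_eq_iff by simp
    then show "Phi v = 0 \<or> (\<exists>k. k \<noteq> 0 \<and> Phi v = k *s Phi u)" by (cases "k = 0") auto
  next
    assume "Phi v = 0 \<or> (\<exists>k. k \<noteq> 0 \<and> Phi v = k *s Phi u)"
    then obtain k where "Phi v = k *s Phi u" by (metis vector_smult_lzero)
    then show "on_curve (par_a u) (par_b u) (par_c u) (matM *v v)"
      unfolding on_curve_def matM_squares Phi_eq_iff by simp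
  qed
  have "base_points \<union> fiber u = {pt v | v. v \<noteq> 0 \<and> on_curve (par_a u) (par_b u) (par_c u) (matM *v v)}"
  proof -
    have b0: "\<exists>v. p = pt v \<and> v \<noteq> 0" if "p \<in> base_points" for p
    proof -
      have "axis \<nu> 1 \<noteq> (0 :: complex^4)" for \<nu> by simp
      moreover have "(\<chi> \<mu>. if \<mu> = \<nu> then - 1 else 1) \<noteq> (0 :: complex^4)" for \<nu>
        by (auto simp: vec_eq_iff)
      ultimately show ?thesis using that unfolding base_points_def by blast
    qed
    show ?thesis
    proof (intro equalityI subsetI)
      fix p assume "p \<in> base_points \<union> fiber u"
      then obtain v where "v \<noteq> 0" "p = pt v" "Phi v = 0 \<or> pt (Phi v) = pt (Phi u)"
        using b0 base_points_iff unfolding fiber_def by blast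
      then show "p \<in> {pt v | v. v \<noteq> 0 \<and> on_curve (par_a u) (par_b u) (par_c u) (matM *v v)}"
        unfolding oc pt_eq_iff[OF Phi0] by blast
    next
      fix p assume "p \<in> {pt v | v. v \<noteq> 0 \<and> on_curve (par_a u) (par_b u) (par_c u) (matM *v v)}"
      then obtain v where "v \<noteq> 0" "p = pt v" "Phi v = 0 \<or> pt (Phi v) = pt (Phi u)"
        unfolding oc pt_eq_iff[OF Phi0] by blast
      then show "p \<in> base_points \<union> fiber u"
        using base_points_iff unfolding fiber_def by blast
    qed
  qed
  then have "curveF u = {pt (matM *v v) | v. v \<noteq> 0 \<and> on_curve (par_a u) (par_b u) (par_c u) (matM *v v)}"
    by (simp only: curveF_def setcompr_eq_image image_image matM_image_pt)
  also have "\<dots> = {pt Z | Z. Z \<noteq> 0 \<and> on_curve (par_a u) (par_b u) (par_c u) Z}"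
  proof (intro equalityI subsetI)
    fix p assume "p \<in> {pt Z | Z. Z \<noteq> 0 \<and> on_curve (par_a u) (par_b u) (par_c u) Z}"
    then obtain Z where Z: "p = pt Z" "Z \<noteq> 0" "on_curve (par_a u) (par_b u) (par_c u) Z" by blast
    then have "p = pt (matM *v (matM *v Z))" "matM *v Z \<noteq> 0" "on_curve (par_a u) (par_b u) (par_c u) (matM *v (matM *v Z))"
      by (simp_all add: matM_involution matM_eq_0)
    then show "p \<in> {pt (matM *v v) | v. v \<noteq> 0 \<and> on_curve (par_a u) (par_b u) (par_c u) (matM *v v)}"
      by blast
  next
    fix p assume "p \<in> {pt (matM *v v) | v. v \<noteq> 0 \<and> on_curve (par_a u) (par_b u) (par_c u) (matM *v v)}"
    then show "p \<in> {pt Z | Z. Z \<noteq> 0 \<and> on_curve (par_a u) (par_b u) (par_c u) Z}"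
      using matM_eq_0 by blast
  qed
  finally show ?thesis .
qed

subsection \<open>Theta functions with characteristics\<close>

text \<open>The characteristic s is an arbitrary real number rather than 0 or 1/2, because the
  product of theta functions with different characteristics leads to the values 1/4 and 3/4.\<close>

definition theta_term :: "complex \<Rightarrow> real \<Rightarrow> complex \<Rightarrow> int \<Rightarrow> complex" where
  "theta_term t s z n = exp (of_real pi * \<i> * t * (of_int n + of_real s)\<^sup>2 +
     2 * of_real pi * \<i> * (of_int n + of_real s) * z)"

definition Theta :: "complex \<Rightarrow> real \<Rightarrow> complex \<Rightarrow> complex" where
  "Theta t s z = (\<Sum>\<^sub>\<infinity>n. theta_term t s z n)"

lemma summable_on_power_abs_int:
  fixes r :: real
  assumes "0 \<le> r" "r < 1"
  shows "(\<lambda>n::int. r ^ nat \<bar>n\<bar>) summable_on UNIV"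
proof -
  have g: "(\<lambda>n. r ^ n) summable_on (UNIV :: nat set)"
    using assms by (intro norm_summable_imp_summable_on) (simp add: summable_geometric)
  have "(\<lambda>n::int. r ^ nat \<bar>n\<bar>) summable_on range int"
    using g by (subst summable_on_reindex) (auto simp: o_def)
  moreover have "(\<lambda>n::int. r ^ nat \<bar>n\<bar>) summable_on range (\<lambda>n. - int n)"
    using g by (subst summable_on_reindex) (auto simp: o_def inj_on_def)
  ultimately have "(\<lambda>n::int. r ^ nat \<bar>n\<bar>) summable_on (range int \<union> range (\<lambda>n. - int n))"
    by (rule summable_on_union)
  also have "range int \<union> range (\<lambda>n. - int n) = UNIV"
    by (auto simp: image_iff) (metis int_cases2)
  finally show ?thesis .
qed

text \<open>A geometric majorant in n that is uniform on a disc, as the Weierstrass test requires: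
  the Gaussian decay in v = n + s absorbs the exponential growth coming from Im z.\<close>

lemma theta_term_bound:
  assumes "Im t > 0"
  obtains C where "\<And>z n. norm z \<le> B \<Longrightarrow> norm (theta_term t s z n) \<le> C * exp (-1) ^ nat \<bar>n\<bar>"
proof -
  define h where "h = pi * Im t"
  \<comment> \<open>The summand 1 holds back a decay of exp (- |v|), while the rest of
    \<open>k * |v|\<close> is dominated by the Gaussian through completion of the square.\<close>
  define k where "k = 2 * pi * \<bar>B\<bar> + 1"
  have h: "h > 0" using assms by (simp add: h_def)
  have "norm (theta_term t s z n) \<le> exp (k\<^sup>2 / (4 * h) + \<bar>s\<bar>) * exp (-1) ^ nat \<bar>n\<bar>" if "norm z \<le> B" for z n
  proof -
    define v where "v = of_int n + s"
    have v: "(of_int n + of_real s :: complex) = of_real v" by (simp add: v_def)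
    have "norm (theta_term t s z n) = exp (- h * v\<^sup>2 - 2 * pi * v * Im z)"
      unfolding theta_term_def v norm_exp_eq_Re by (simp add: h_def power2_eq_square algebra_simps)
    moreover have "- h * v\<^sup>2 - 2 * pi * v * Im z \<le> k\<^sup>2 / (4 * h) + \<bar>s\<bar> - \<bar>of_int n\<bar>"
    proof -
      have "\<bar>Im z\<bar> \<le> \<bar>B\<bar>" using that abs_Im_le_cmod[of z] by linarith
      then have "- (2 * pi * (v * Im z)) \<le> 2 * pi * (\<bar>v\<bar> * \<bar>B\<bar>)"
      proof -
        have "\<bar>v * Im z\<bar> \<le> \<bar>v\<bar> * \<bar>B\<bar>"
          using \<open>\<bar>Im z\<bar> \<le> \<bar>B\<bar>\<close> by (simp add: abs_mult mult_left_mono)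
        then have "- (v * Im z) \<le> \<bar>v\<bar> * \<bar>B\<bar>" by linarith
        from mult_left_mono[OF this, of "2 * pi"] show ?thesis by simp
      qed
      moreover have "0 \<le> (2 * h * \<bar>v\<bar> - k)\<^sup>2" by simp
      then have "4 * h * (k * \<bar>v\<bar> - h * v\<^sup>2) \<le> k\<^sup>2"
        by (simp add: power2_eq_square algebra_simps)
      then have "k * \<bar>v\<bar> - h * v\<^sup>2 \<le> k\<^sup>2 / (4 * h)"
        using h by (simp add: pos_le_divide_eq mult.commute)
      moreover have "\<bar>of_int n\<bar> \<le> \<bar>v\<bar> + \<bar>s\<bar>" by (simp add: v_def)
      ultimately show ?thesis by (simp add: k_def algebra_simps)
    qed
    ultimately have "norm (theta_term t s z n) \<le> exp (k\<^sup>2 / (4 * h) + \<bar>s\<bar> - \<bar>of_int n\<bar>)" by simp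
    also have "\<dots> = exp (k\<^sup>2 / (4 * h) + \<bar>s\<bar>) * exp (-1) ^ nat \<bar>n\<bar>"
    proof -
      have "exp (-1 :: real) ^ nat \<bar>n\<bar> = exp (- \<bar>of_int n\<bar>)"
        using exp_of_nat_mult[of "nat \<bar>n\<bar>" "-1 :: real"] by simp
      then show ?thesis by (simp only: exp_add[symmetric] diff_conv_add_uminus)
    qed
    finally show ?thesis .
  qed
  then show ?thesis using that by blast
qed

lemma summable_on_exp_bound: "(\<lambda>n::int. C * exp (-1) ^ nat \<bar>n\<bar> :: real) summable_on UNIV"
  by (intro summable_on_cmult_right summable_on_power_abs_int) auto

lemma theta_term_abs_summable:
  assumes "Im t > 0"
  shows "(\<lambda>n. norm (theta_term t s z n)) summable_on UNIV"
proof -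
  obtain C where C: "\<And>w n. norm w \<le> norm z \<Longrightarrow> norm (theta_term t s w n) \<le> C * exp (-1) ^ nat \<bar>n\<bar>"
    using theta_term_bound[OF assms] by blast
  show ?thesis
    by (rule Infinite_Sum.abs_summable_on_comparison_test'[OF summable_on_exp_bound[of C]]) (use C in auto)
qed

lemma Theta_holomorphic:
  assumes "Im t > 0"
  shows "Theta t s holomorphic_on A"
proof -
  have "Theta t s holomorphic_on ball 0 r" if "r > 0" for r
  proof -
    obtain C where C: "\<And>w n. norm w \<le> r \<Longrightarrow> norm (theta_term t s w n) \<le> C * exp (-1) ^ nat \<bar>n\<bar>"
      using theta_term_bound[OF assms] by blast
    have "uniform_limit (cball 0 r) (\<lambda>X z. \<Sum>n\<in>X. theta_term t s z n) (\<lambda>z. \<Sum>\<^sub>\<infinity>n. theta_term t s z n)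
        (finite_subsets_at_top UNIV)"
      by (rule Weierstrass_m_test_general[OF _ summable_on_exp_bound[of C]]) (use C in auto)
    then have u: "uniform_limit (cball 0 r) (\<lambda>X z. \<Sum>n\<in>X. theta_term t s z n) (Theta t s)
        (finite_subsets_at_top UNIV)"
      by (simp add: Theta_def[abs_def])
    have "(\<lambda>z. \<Sum>n\<in>X. theta_term t s z n) holomorphic_on UNIV" for X
      unfolding theta_term_def by (intro holomorphic_intros)
    then have "\<forall>\<^sub>F X in finite_subsets_at_top UNIV. continuous_on (cball 0 r) (\<lambda>z. \<Sum>n\<in>X. theta_term t s z n) \<and>
        (\<lambda>z. \<Sum>n\<in>X. theta_term t s z n) holomorphic_on ball 0 r"
      by (intro always_eventually) (meson holomorphic_on_imp_continuous_on holomorphic_on_subset subset_UNIV)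
    then show ?thesis
      using holomorphic_uniform_limit[OF _ u] by (metis finite_subsets_at_top_neq_bot)
  qed
  then have "Theta t s field_differentiable at z" for z
    by (rule holomorphic_on_imp_differentiable_at[of _ "ball 0 (norm z + 1)"]) (auto simp: add_pos_nonneg add.commute)
  then show ?thesis by (simp add: holomorphic_on_def field_differentiable_at_within)
qed

lemma Theta_char_Suc: "Theta t (s + 1) z = Theta t s z"
  unfolding Theta_def
  by (rule infsum_reindex_bij_witness[of _ "\<lambda>n. n - 1" "\<lambda>n. n + 1"]) (auto simp: theta_term_def algebra_simps)

lemma Theta_uminus: "Theta t (- s) (- z) = Theta t s z"
  unfolding Theta_def
  by (rule infsum_reindex_bij_witness[of _ uminus uminus]) (auto simp: theta_term_def power2_eq_square algebra_simps)

lemma Theta_plus_1: "Theta t s (z + 1) = exp (2 * of_real pi * \<i> * of_real s) * Theta t s z"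
proof -
  have "theta_term t s (z + 1) n = exp (2 * of_real pi * \<i> * of_real s) * theta_term t s z n" for n
  proof -
    have "theta_term t s (z + 1) n = exp (2 * of_real pi * \<i> * of_real s + (of_real pi * \<i> * t * (of_int n + of_real s)\<^sup>2 +
       2 * of_real pi * \<i> * (of_int n + of_real s) * z) + 2 * of_real pi * of_int n * \<i>)"
      unfolding theta_term_def by (rule arg_cong[where f = exp]) (simp add: algebra_simps)
    also have "\<dots> = exp (2 * of_real pi * \<i> * of_real s) * theta_term t s z n"
    proof -
      have "exp (2 * of_real pi * of_int n * \<i>) = 1"
        using exp_integer_2pi[of "of_int n"] by (simp add: ac_simps)
      then show ?thesis by (simp only: exp_add theta_term_def mult_1_right)
    qed
    finally show ?thesis .
  qed
  then have e: "theta_term t s (z + 1) = (\<lambda>n. exp (2 * of_real pi * \<i> * of_real s) * theta_term t s z n)"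
    by (rule ext)
  show ?thesis unfolding Theta_def e by (rule infsum_cmult_right')
qed

lemma Theta_plus_period: "Theta t s (z + t) = exp (- (of_real pi * \<i> * t) - 2 * of_real pi * \<i> * z) * Theta t s z"
proof -
  have e: "theta_term t s (z + t) = (\<lambda>n. exp (- (of_real pi * \<i> * t) - 2 * of_real pi * \<i> * z) * theta_term t s z (n + 1))"
    unfolding fun_eq_iff theta_term_def exp_add[symmetric]
    by (intro allI arg_cong[where f = exp]) (simp add: algebra_simps power2_eq_square)
  have "(\<Sum>\<^sub>\<infinity>n. theta_term t s z (n + 1)) = (\<Sum>\<^sub>\<infinity>n. theta_term t s z n)"
    by (rule infsum_reindex_bij_witness[of _ "\<lambda>n. n - 1" "\<lambda>n. n + 1"]) auto
  then show ?thesis unfolding Theta_def e infsum_cmult_right' by simp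
qed

lemma abs_summable_on_times:
  fixes f g :: "_ \<Rightarrow> complex"
  assumes "(\<lambda>x. norm (f x)) summable_on A" "(\<lambda>x. norm (g x)) summable_on B"
  shows "(\<lambda>p. norm (case p of (x, y) \<Rightarrow> f x * g y)) summable_on A \<times> B"
  unfolding Infinite_Sum.abs_summable_on_Sigma_iff
  using assms by (auto simp: norm_mult infsum_cmult_right' abs_mult
      intro!: summable_on_cmult_right summable_on_cmult_left)

lemma infsum_times:
  fixes f g :: "_ \<Rightarrow> complex"
  assumes "(\<lambda>x. norm (f x)) summable_on A" "(\<lambda>x. norm (g x)) summable_on B"
  shows "(\<Sum>\<^sub>\<infinity>(x, y)\<in>A \<times> B. f x * g y) = infsum f A * infsum g B"
  using infsum_Sigma_banach[OF Infinite_Sum.abs_summable_summable[OF abs_summable_on_times[OF assms]]]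
  by (simp add: infsum_cmult_right' infsum_cmult_left')

text \<open>Parallelogram law. For A = i + j + e + s and B = i - j + s' one has A^2 + B^2 = ((A +
  B)^2 + (A - B)^2) / 2 and A (x + y) + B (x - y) = (A + B) x + (A - B) y, where A + B involves only
  i and A - B only j.\<close>

lemma theta_term_mult:
  "theta_term t s (x + y) (i + j + e) * theta_term t s' (x - y) (i - j) =
   theta_term (2 * t) ((s + s' + of_int e) / 2) (2 * x) i * theta_term (2 * t) ((s - s' + of_int e) / 2) (2 * y) j"
proof -
  define p where "p = complex_of_real pi * \<i>"
  show ?thesis
    unfolding theta_term_def exp_add[symmetric]
    by (rule arg_cong[where f = exp], simp add: mult.assoc flip: p_def)
       (simp add: field_simps power2_eq_square)
qed

text \<open>A lattice point \<open>(n, m)\<close> is \<open>(i + j + e, i - j)\<close> where \<open>e\<close> is the parity of \<open>n + m\<close>.\<close>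

lemma Theta_mult:
  assumes "Im t > 0"
  shows "Theta t s (x + y) * Theta t s' (x - y) =
    Theta (2 * t) ((s + s') / 2) (2 * x) * Theta (2 * t) ((s - s') / 2) (2 * y) +
    Theta (2 * t) ((s + s' + 1) / 2) (2 * x) * Theta (2 * t) ((s - s' + 1) / 2) (2 * y)"
proof -
  define F where "F = (\<lambda>(n, m). theta_term t s (x + y) n * theta_term t s' (x - y) m)"
  define h where "h = (\<lambda>e (i, j). (i + j + e, i - j) :: int \<times> int)"
  have t2: "Im (2 * t) > 0" using assms by simp
  note S = theta_term_abs_summable[OF assms] theta_term_abs_summable[OF t2]
  have sF: "F summable_on UNIV"
    unfolding F_def using Infinite_Sum.abs_summable_summable[OF abs_summable_on_times[OF S(1) S(1)]] by simp
  have inj: "inj (h e)" for e by (auto simp: inj_on_def h_def)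
  have U: "range (h 0) \<union> range (h 1) = UNIV"
  proof -
    have "(n, m) \<in> range (h 0) \<union> range (h 1)" for n m
    proof (cases "even (n + m)")
      case True
      then obtain k where "n + m = 2 * k" by (elim evenE)
      then have "(n, m) = h 0 (k, k - m)" by (simp add: h_def)
      then show ?thesis by blast
    next
      case False
      then obtain k where "n + m = 2 * k + 1" by (elim oddE)
      then have "(n, m) = h 1 (k, k - m)" by (simp add: h_def)
      then show ?thesis by blast
    qed
    then show ?thesis by auto
  qed
  have D: "range (h 0) \<inter> range (h 1) = {}"
    by (auto simp: h_def) presburger
  have part: "infsum F (range (h e)) = Theta (2 * t) ((s + s' + of_int e) / 2) (2 * x) *
      Theta (2 * t) ((s - s' + of_int e) / 2) (2 * y)" for e
  proof -
    have "infsum F (range (h e)) = infsum (F \<circ> h e) UNIV" by (rule infsum_reindex[OF inj])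
    also have "F \<circ> h e = (\<lambda>(i, j). theta_term (2 * t) ((s + s' + of_int e) / 2) (2 * x) i *
        theta_term (2 * t) ((s - s' + of_int e) / 2) (2 * y) j)"
      by (auto simp: fun_eq_iff F_def h_def theta_term_mult)
    finally show ?thesis unfolding Theta_def using infsum_times[OF S(2) S(2)] by simp
  qed
  have "Theta t s (x + y) * Theta t s' (x - y) = infsum F UNIV"
    unfolding Theta_def F_def using infsum_times[OF S(1) S(1)] by simp
  also have "\<dots> = infsum F (range (h 0) \<union> range (h 1))" by (simp only: U)
  also have "\<dots> = infsum F (range (h 0)) + infsum F (range (h 1))"
    by (rule infsum_Un_disjoint[OF _ _ D]; rule summable_on_subset_banach[OF sF]; simp)
  finally show ?thesis unfolding part by simp
qed

section \<open>The classical theta functions and products of their translates\<close>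

lemma theta3_eq: "theta3 \<tau> z = Theta \<tau> 0 z"
  unfolding theta3_def Theta_def theta_term_def
  by (rule infsum_cong) (simp add: exp_add)

lemma exp_pi_half: "exp (2 * of_real pi * \<i> * of_real (1 / 2)) = -1"
  using exp_pi_i by (simp add: mult.commute)

lemma theta1_eq: "theta1 \<tau> z = - Theta \<tau> (1/2) (z + 1/2)"
proof -
  have e: "theta_term \<tau> (1/2) (z + 1/2) = (\<lambda>n. (exp (of_real pi * \<i> * \<tau> / 4) * exp (of_real pi * \<i> * z) * exp (of_real pi * \<i> / 2)) *
      theta_term \<tau> 0 (z + 1/2 + \<tau>/2) n)"
    unfolding theta_term_def exp_add[symmetric] fun_eq_iff
    by (intro allI arg_cong[where f = exp]) (simp add: algebra_simps power2_eq_square)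
  have i: "exp (of_real pi * \<i> / 2) = \<i>"
    using cis_pi_half by (simp add: cis_conv_exp mult.commute)
  show ?thesis
    unfolding theta1_def theta3_eq Theta_def e infsum_cmult_right' i by (simp add: divide_i)
qed

lemma theta2_eq: "theta2 \<tau> z = Theta \<tau> (1/2) z"
  using Theta_plus_1[of \<tau> "1/2" z] unfolding theta2_def theta1_eq exp_pi_half by (simp add: add.assoc)

lemma theta4_eq: "theta4 \<tau> z = Theta \<tau> 0 (z + 1/2)"
  unfolding theta4_def theta3_eq ..

lemma theta1_theta2: "theta1 \<tau> z = - theta2 \<tau> (z + 1/2)"
  unfolding theta1_eq theta2_eq ..

lemmas theta_eqs = theta1_eq theta2_eq theta3_eq theta4_eq

text \<open>The four functions are eigenfunctions of x \<mapsto> x + 1/2 with eigenvalues 1, i, -1,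
  -i, the powers of i.\<close>

definition T0 :: "complex \<Rightarrow> complex \<Rightarrow> complex" where "T0 \<tau> x = Theta (2 * \<tau>) 0 (2 * x)"
definition T1 :: "complex \<Rightarrow> complex \<Rightarrow> complex" where "T1 \<tau> x = Theta (2 * \<tau>) (1/4) (2 * x)"
definition T2 :: "complex \<Rightarrow> complex \<Rightarrow> complex" where "T2 \<tau> x = Theta (2 * \<tau>) (1/2) (2 * x)"
definition T3 :: "complex \<Rightarrow> complex \<Rightarrow> complex" where "T3 \<tau> x = Theta (2 * \<tau>) (3/4) (2 * x)"

lemmas T_defs = T0_def T1_def T2_def T3_def

lemma T_uminus: "T0 \<tau> (- x) = T0 \<tau> x" "T1 \<tau> (- x) = T3 \<tau> x" "T2 \<tau> (- x) = T2 \<tau> x" "T3 \<tau> (- x) = T1 \<tau> x"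
  unfolding T_defs
  using Theta_uminus[of "2 * \<tau>" 0 "2 * x"] Theta_uminus[of "2 * \<tau>" "-1/4" "2 * x"]
    Theta_uminus[of "2 * \<tau>" "-1/2" "2 * x"] Theta_uminus[of "2 * \<tau>" "1/4" "2 * x"]
    Theta_char_Suc[of "2 * \<tau>" "-1/4"] Theta_char_Suc[of "2 * \<tau>" "-1/2"]
  by simp_all

lemma T_half:
  "T0 \<tau> (x + 1/2) = T0 \<tau> x" "T1 \<tau> (x + 1/2) = \<i> * T1 \<tau> x"
  "T2 \<tau> (x + 1/2) = - T2 \<tau> x" "T3 \<tau> (x + 1/2) = - \<i> * T3 \<tau> x"
proof -
  have e: "exp (2 * of_real pi * \<i> * of_real (1/4)) = \<i>"
    using cis_pi_half by (simp add: cis_conv_exp mult.commute)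
  have "exp (2 * of_real pi * \<i> * of_real (3/4)) = exp (of_real pi * \<i>) * exp (2 * of_real pi * \<i> * of_real (1/4))"
    unfolding exp_add[symmetric] by (rule arg_cong[where f = exp]) (simp add: algebra_simps)
  then have e3: "exp (2 * of_real pi * \<i> * of_real (3/4)) = - \<i>"
    unfolding e using exp_pi_i by (simp add: mult.commute)
  have x: "2 * (x + 1/2) = 2 * x + 1" by simp
  show "T0 \<tau> (x + 1/2) = T0 \<tau> x" "T1 \<tau> (x + 1/2) = \<i> * T1 \<tau> x"
    "T2 \<tau> (x + 1/2) = - T2 \<tau> x" "T3 \<tau> (x + 1/2) = - \<i> * T3 \<tau> x"
    unfolding T_defs x Theta_plus_1 e e3 exp_pi_half by simp_all
qed

lemma T_quarter:
  "T0 \<tau> (x - 1/4) = T0 \<tau> (x + 1/4)" "T1 \<tau> (x - 1/4) = - \<i> * T1 \<tau> (x + 1/4)"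
  "T2 \<tau> (x - 1/4) = - T2 \<tau> (x + 1/4)" "T3 \<tau> (x - 1/4) = \<i> * T3 \<tau> (x + 1/4)"
proof -
  have x: "x + 1/4 = (x - 1/4) + 1/2" by simp
  show "T0 \<tau> (x - 1/4) = T0 \<tau> (x + 1/4)" "T1 \<tau> (x - 1/4) = - \<i> * T1 \<tau> (x + 1/4)"
    "T2 \<tau> (x - 1/4) = - T2 \<tau> (x + 1/4)" "T3 \<tau> (x - 1/4) = \<i> * T3 \<tau> (x + 1/4)"
    unfolding x T_half by simp_all
qed

text \<open>After a shift by 1/4, T0 is even and T2 is odd, while T1 and T3 are exchanged up to
  factors i and -i, so that T1 + i T3 is even and T1 - i T3 is odd. These pairs serve as
  \<open>e\<close> and \<open>d\<close> in \<open>relations_from_products\<close>.\<close>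

lemma T_quarter_uminus:
  "T0 \<tau> (- x + 1/4) = T0 \<tau> (x + 1/4)" "T1 \<tau> (- x + 1/4) = \<i> * T3 \<tau> (x + 1/4)"
  "T2 \<tau> (- x + 1/4) = - T2 \<tau> (x + 1/4)" "T3 \<tau> (- x + 1/4) = - \<i> * T1 \<tau> (x + 1/4)"
proof -
  have x: "- x + 1/4 = - (x - 1/4)" by simp
  show "T0 \<tau> (- x + 1/4) = T0 \<tau> (x + 1/4)" "T1 \<tau> (- x + 1/4) = \<i> * T3 \<tau> (x + 1/4)"
    "T2 \<tau> (- x + 1/4) = - T2 \<tau> (x + 1/4)" "T3 \<tau> (- x + 1/4) = - \<i> * T1 \<tau> (x + 1/4)"
    unfolding x T_uminus T_quarter by simp_all
qed

context
  fixes \<tau> :: complex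
  assumes \<tau>: "Im \<tau> > 0"
begin

text \<open>The products 33, 22 and 23 come from the addition formula. The others follow by
  translation: replacing x by x + 1/2 shifts both factors, whereas shifting x and y by quarters
  shifts just one of x + y and x - y by 1/2.\<close>

lemma theta33: "theta3 \<tau> (x + y) * theta3 \<tau> (x - y) = T0 \<tau> x * T0 \<tau> y + T2 \<tau> x * T2 \<tau> y"
  unfolding theta_eqs Theta_mult[OF \<tau>] T_defs by simp

lemma theta22: "theta2 \<tau> (x + y) * theta2 \<tau> (x - y) = T2 \<tau> x * T0 \<tau> y + T0 \<tau> x * T2 \<tau> y"
  unfolding theta_eqs Theta_mult[OF \<tau>] T_defs using Theta_char_Suc[of "2 * \<tau>" 0] by simp

lemma theta23: "theta2 \<tau> (x + y) * theta3 \<tau> (x - y) = T1 \<tau> x * T1 \<tau> y + T3 \<tau> x * T3 \<tau> y"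
  unfolding theta_eqs Theta_mult[OF \<tau>] T_defs by simp

lemma theta44: "theta4 \<tau> (x + y) * theta4 \<tau> (x - y) = T0 \<tau> x * T0 \<tau> y - T2 \<tau> x * T2 \<tau> y"
  using theta33[of "x + 1/2" y] unfolding theta4_def T_half by (simp add: algebra_simps)

lemma theta11: "theta1 \<tau> (x + y) * theta1 \<tau> (x - y) = T0 \<tau> x * T2 \<tau> y - T2 \<tau> x * T0 \<tau> y"
  using theta22[of "x + 1/2" y] unfolding theta1_theta2 T_half by (simp add: algebra_simps)

lemma theta14: "theta1 \<tau> (x + y) * theta4 \<tau> (x - y) = - \<i> * (T1 \<tau> x * T1 \<tau> y - T3 \<tau> x * T3 \<tau> y)"
  using theta23[of "x + 1/2" y] unfolding theta1_theta2 theta4_def T_half by (simp add: algebra_simps)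

lemma theta34: "theta3 \<tau> (x + y) * theta4 \<tau> (x - y) =
    T0 \<tau> (x + 1/4) * T0 \<tau> (y + 1/4) - T2 \<tau> (x + 1/4) * T2 \<tau> (y + 1/4)"
  using theta33[of "x + 1/4" "y - 1/4"] unfolding theta4_def T_quarter by (simp add: algebra_simps)

lemma theta12: "theta1 \<tau> (x + y) * theta2 \<tau> (x - y) =
    - (T2 \<tau> (x + 1/4) * T0 \<tau> (y + 1/4) + T0 \<tau> (x + 1/4) * T2 \<tau> (y + 1/4))"
  using theta22[of "x + 1/4" "y + 1/4"] unfolding theta1_theta2 by (simp add: algebra_simps)

lemma theta24: "theta2 \<tau> (x + y) * theta4 \<tau> (x - y) =
    - \<i> * (T1 \<tau> (x + 1/4) * T1 \<tau> (y + 1/4) - T3 \<tau> (x + 1/4) * T3 \<tau> (y + 1/4))"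
  using theta23[of "x + 1/4" "y - 1/4"] unfolding theta4_def T_quarter by (simp add: algebra_simps)

lemma theta13: "theta1 \<tau> (x + y) * theta3 \<tau> (x - y) =
    - (T1 \<tau> (x + 1/4) * T1 \<tau> (y + 1/4) + T3 \<tau> (x + 1/4) * T3 \<tau> (y + 1/4))"
  using theta23[of "x + 1/4" "y + 1/4"] unfolding theta1_theta2 by (simp add: algebra_simps)

end

text \<open>The choice of \<open>e\<close> even and \<open>d\<close> odd makes the values at \<open>\<eta>\<close> cancel in the first relation; the second one
  only needs the ratio of \<open>d(\<eta>)\<^sup>2\<close> and \<open>e(\<eta>)\<^sup>2\<close>, which the last assumption expresses by theta functions.\<close>

lemma relations_from_products:
  fixes e d f0 fk fl fm :: "complex \<Rightarrow> complex" and \<alpha> \<beta> \<kappa> \<eta> x A B :: complex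
  assumes even: "\<And>x. e (- x) = e x" and odd: "\<And>x. d (- x) = - d x"
    and P0: "\<And>x y. f0 (x + y) * fk (x - y) = \<beta> * (e x * d y + d x * e y)"
    and P1: "\<And>x y. fl (x + y) * fm (x - y) = \<alpha> * (e x * e y + \<kappa> * d x * d y)"
    and nz: "f0 \<eta> \<noteq> 0" "fk \<eta> \<noteq> 0" "fl \<eta> \<noteq> 0" "fm \<eta> \<noteq> 0"
    and AB: "A * \<kappa> * \<alpha>\<^sup>2 * (f0 \<eta> * fk \<eta>)\<^sup>2 + B * \<beta>\<^sup>2 * (fl \<eta> * fm \<eta>)\<^sup>2 = 0"
  defines "z \<equiv> \<lambda>f. f (x + \<eta>) / f \<eta>" and "w \<equiv> \<lambda>f. f (x - \<eta>) / f \<eta>"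
  shows "z f0 * w fk - z fk * w f0 = z fl * w fm + z fm * w fl"
    and "A * (z fl * w fm - z fm * w fl) + B * (z f0 * w fk + z fk * w f0) = 0"
proof -
  have d0: "d 0 = 0" using odd[of 0] by simp
  \<comment> \<open>At the arguments \<eta> and 0 only one term survives, since d is odd; this
    expresses the normalising values at \<eta> by e and d.\<close>
  have q0: "f0 \<eta> * fk \<eta> = \<beta> * (d \<eta> * e 0)" using P0[of \<eta> 0] d0 by simp
  have q1: "fl \<eta> * fm \<eta> = \<alpha> * (e \<eta> * e 0)" using P1[of \<eta> 0] d0 by simp
  have n: "\<beta> \<noteq> 0" "d \<eta> \<noteq> 0" "e 0 \<noteq> 0" "\<alpha> \<noteq> 0" "e \<eta> \<noteq> 0" using q0 q1 nz by auto
  have z0k: "z f0 * w fk = (e x * d \<eta> + d x * e \<eta>) / (d \<eta> * e 0)"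
    unfolding z_def w_def using q0 n by (simp add: P0)
  \<comment> \<open>The product formula at -\<eta> has the two factors in exchanged roles, and
    parity changes the sign of one of its terms.\<close>
  have zk0: "z fk * w f0 = (d x * e \<eta> - e x * d \<eta>) / (d \<eta> * e 0)"
    unfolding z_def w_def using q0 n P0[of x "- \<eta>"] by (simp add: even odd mult.commute)
  have zlm: "z fl * w fm = (e x * e \<eta> + \<kappa> * d x * d \<eta>) / (e \<eta> * e 0)"
    unfolding z_def w_def using q1 n by (simp add: P1)
  have zml: "z fm * w fl = (e x * e \<eta> - \<kappa> * d x * d \<eta>) / (e \<eta> * e 0)"
    unfolding z_def w_def using q1 n P1[of x "- \<eta>"] by (simp add: even odd mult.commute)
  show "z f0 * w fk - z fk * w f0 = z fl * w fm + z fm * w fl"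
    unfolding z0k zk0 zlm zml using n by (simp add: field_simps)
  have "(\<alpha> * \<beta> * e 0)\<^sup>2 * (A * \<kappa> * (d \<eta>)\<^sup>2 + B * (e \<eta>)\<^sup>2) = 0"
    using AB unfolding q0 q1 by (simp add: power_mult_distrib algebra_simps)
  then have AB': "A * \<kappa> * (d \<eta>)\<^sup>2 + B * (e \<eta>)\<^sup>2 = 0" using n by simp
  have "A * (z fl * w fm - z fm * w fl) + B * (z f0 * w fk + z fk * w f0) =
    2 * d x * (A * \<kappa> * (d \<eta>)\<^sup>2 + B * (e \<eta>)\<^sup>2) / (e \<eta> * d \<eta> * e 0)"
    unfolding z0k zk0 zlm zml using n by (simp add: field_simps power2_eq_square)
  then show "A * (z fl * w fm - z fm * w fl) + B * (z f0 * w fk + z fk * w f0) = 0"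
    unfolding AB' by simp
qed

lemma theta_uminus:
  "theta1 \<tau> (- x) = - theta1 \<tau> x" "theta2 \<tau> (- x) = theta2 \<tau> x"
  "theta3 \<tau> (- x) = theta3 \<tau> x" "theta4 \<tau> (- x) = theta4 \<tau> x"
proof -
  show 2: "theta2 \<tau> (- x) = theta2 \<tau> x" for x
    using Theta_uminus[of \<tau> "-1/2" x] Theta_char_Suc[of \<tau> "-1/2" x] by (simp add: theta2_eq)
  show 3: "theta3 \<tau> (- x) = theta3 \<tau> x" for x
    using Theta_uminus[of \<tau> 0 x] by (simp add: theta3_eq)
  have "theta2 \<tau> (x - 1/2 + 1) = - theta2 \<tau> (x - 1/2)"
    unfolding theta2_eq Theta_plus_1 exp_pi_half by simp
  then show "theta1 \<tau> (- x) = - theta1 \<tau> x"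
    using 2[of "x - 1/2"] by (simp add: theta1_theta2 algebra_simps)
  have "theta3 \<tau> (x - 1/2 + 1) = theta3 \<tau> (x - 1/2)"
    unfolding theta3_eq Theta_plus_1 by simp
  then show "theta4 \<tau> (- x) = theta4 \<tau> x"
    using 3[of "x - 1/2"] by (simp add: theta4_def algebra_simps)
qed

lemma theta_plus_1:
  "theta1 \<tau> (x + 1) = - theta1 \<tau> x" "theta2 \<tau> (x + 1) = - theta2 \<tau> x"
  "theta3 \<tau> (x + 1) = theta3 \<tau> x" "theta4 \<tau> (x + 1) = theta4 \<tau> x"
proof -
  show 2: "theta2 \<tau> (x + 1) = - theta2 \<tau> x" for x
    unfolding theta2_eq Theta_plus_1 exp_pi_half by simp
  show 3: "theta3 \<tau> (x + 1) = theta3 \<tau> x" for x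
    unfolding theta3_eq Theta_plus_1 by simp
  have x: "x + 1 + 1/2 = x + 1/2 + 1" by simp
  show "theta1 \<tau> (x + 1) = - theta1 \<tau> x" "theta4 \<tau> (x + 1) = theta4 \<tau> x"
    unfolding theta1_theta2 theta4_def x 2 3 by simp_all
qed

lemma theta_plus_period:
  fixes \<tau> x :: complex
  defines "E \<equiv> exp (- (of_real pi * \<i> * \<tau>) - 2 * of_real pi * \<i> * x)"
  shows "theta1 \<tau> (x + \<tau>) = - E * theta1 \<tau> x" "theta2 \<tau> (x + \<tau>) = E * theta2 \<tau> x"
    "theta3 \<tau> (x + \<tau>) = E * theta3 \<tau> x" "theta4 \<tau> (x + \<tau>) = - E * theta4 \<tau> x"
proof -
  have x: "x + \<tau> + 1/2 = x + 1/2 + \<tau>" by simp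
  have "exp (- (of_real pi * \<i> * \<tau>) - 2 * of_real pi * \<i> * (x + 1/2)) = E * exp (- (of_real pi * \<i>))"
    unfolding E_def exp_add[symmetric] by (rule arg_cong[where f = exp]) (simp add: algebra_simps)
  also have "exp (- (of_real pi * \<i>)) = -1"
    using exp_pi_i by (simp add: exp_minus mult.commute)
  finally have E: "exp (- (of_real pi * \<i> * \<tau>) - 2 * of_real pi * \<i> * (x + 1/2)) = - E" by simp
  show "theta1 \<tau> (x + \<tau>) = - E * theta1 \<tau> x" "theta2 \<tau> (x + \<tau>) = E * theta2 \<tau> x"
    "theta3 \<tau> (x + \<tau>) = E * theta3 \<tau> x" "theta4 \<tau> (x + \<tau>) = - E * theta4 \<tau> x"
    unfolding theta_eqs x Theta_plus_period E by (simp_all add: E_def)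
qed

lemma T_plus_1: "T0 \<tau> (x + 1) = T0 \<tau> x" "T2 \<tau> (x + 1) = T2 \<tau> x"
proof -
  have x: "x + 1 = x + 1/2 + 1/2" by simp
  show "T0 \<tau> (x + 1) = T0 \<tau> x" "T2 \<tau> (x + 1) = T2 \<tau> x" unfolding x T_half by simp_all
qed

lemma T_plus_period:
  fixes \<tau> x :: complex
  defines "E \<equiv> exp (- (2 * of_real pi * \<i> * \<tau>) - 4 * of_real pi * \<i> * x)"
  shows "T0 \<tau> (x + \<tau>) = E * T0 \<tau> x" "T2 \<tau> (x + \<tau>) = E * T2 \<tau> x"
  using Theta_plus_period[of "2 * \<tau>" _ "2 * x"] unfolding T_defs E_def
  by (simp_all add: distrib_left mult.assoc mult.left_commute)

section \<open>Doubly periodic entire functions and the identity theorem\<close>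

lemma constant_if_doubly_periodic:
  fixes f :: "complex \<Rightarrow> complex"
  assumes hol: "f holomorphic_on UNIV" and \<tau>: "Im \<tau> > 0"
    and p1: "\<And>z. f (z + 1) = f z" and p\<tau>: "\<And>z. f (z + \<tau>) = f z"
  obtains k where "\<And>z. f z = k"
proof -
  have shift: "g (z + of_int n * w) = g z" if g: "\<And>z. g (z + w) = g z" for g :: "complex \<Rightarrow> complex" and z w n
  proof (induction n rule: int_induct[where k = 0])
    case (step1 i)
    then show ?case using g[of "z + of_int i * w"] by (simp add: algebra_simps)
  next
    case (step2 i)
    then show ?case using g[of "z + of_int (i - 1) * w"] by (simp add: algebra_simps)
  qed simp
  define K where "K = (\<lambda>(s :: real, t :: real). of_real s + of_real t * \<tau>) ` ({0..1} \<times> {0..1})"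
  have "compact K"
    unfolding K_def
    by (intro compact_continuous_image compact_Times) (auto simp: case_prod_unfold intro!: continuous_intros)
  then have "compact (f ` K)"
    by (intro compact_continuous_image holomorphic_on_imp_continuous_on holomorphic_on_subset[OF hol]) auto
  then have "bounded (f ` K)" by (rule compact_imp_bounded)
  moreover have "f z \<in> f ` K" for z
  proof -
    define t where "t = Im z / Im \<tau>"
    define s where "s = Re z - t * Re \<tau>"
    have z: "z = of_real s + of_real t * \<tau>"
      using \<tau> by (simp add: complex_eq_iff s_def t_def)
    have "f z = f (of_real s + of_real t * \<tau> + of_int (- \<lfloor>s\<rfloor>) * 1 + of_int (- \<lfloor>t\<rfloor>) * \<tau>)"
      by (simp only: shift[of f \<tau>, OF p\<tau>] shift[of f 1, OF p1] z)
    also have "of_real s + of_real t * \<tau> + of_int (- \<lfloor>s\<rfloor>) * 1 + of_int (- \<lfloor>t\<rfloor>) * \<tau> =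
        of_real (frac s) + of_real (frac t) * \<tau>"
      by (simp add: frac_def algebra_simps)
    finally have "f z = f (of_real (frac s) + of_real (frac t) * \<tau>)" .
    moreover have "of_real (frac s) + of_real (frac t) * \<tau> \<in> K"
      unfolding K_def using frac_lt_1[of s] frac_lt_1[of t]
      by (intro image_eqI[where x = "(frac s, frac t)"]) (simp_all add: less_imp_le)
    ultimately show ?thesis by (metis imageI)
  qed
  ultimately have "bounded (range f)" by (metis bounded_subset image_subsetI)
  then show ?thesis using Liouville_theorem[OF hol] that unfolding constant_on_def by auto
qed

text \<open>The function h vanishes on the nonempty open set where g does not, hence everywhere by
  the identity theorem.\<close>

lemma product_zero_imp_zero:
  fixes g h :: "complex \<Rightarrow> complex"
  assumes "g holomorphic_on UNIV" "h holomorphic_on UNIV" "\<And>y. g y * h y = 0" "g y0 \<noteq> 0"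
  shows "h y = 0"
proof -
  have "open {y. g y \<noteq> 0}"
    by (rule open_Collect_neq) (use assms(1) in \<open>auto intro: holomorphic_on_imp_continuous_on\<close>)
  then show ?thesis
    using assms(4) analytic_continuation_open[of "{y. g y \<noteq> 0}" UNIV h "\<lambda>_. 0" y] assms(2,3) by auto
qed

lemma holomorphic_on_affine:
  assumes "g holomorphic_on UNIV"
  shows "(\<lambda>z. g (\<alpha> * z + \<beta>)) holomorphic_on A"
proof -
  have "(\<lambda>z. \<alpha> * z + \<beta>) holomorphic_on A" by (intro holomorphic_intros)
  from holomorphic_on_compose_gen[OF this assms] show ?thesis by (simp add: o_def)
qed

section \<open>The theta parametrisation of the curve\<close>

locale theta_data =
  fixes \<tau> \<eta> \<rho> a b c :: complex
  assumes \<tau>: "Im \<tau> > 0" and \<rho>: "\<rho> \<noteq> 0"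
    and nz\<eta>: "theta1 \<tau> \<eta> \<noteq> 0" "theta2 \<tau> \<eta> \<noteq> 0" "theta3 \<tau> \<eta> \<noteq> 0" "theta4 \<tau> \<eta> \<noteq> 0"
    and nz0: "theta2 \<tau> 0 \<noteq> 0" "theta3 \<tau> 0 \<noteq> 0" "theta4 \<tau> 0 \<noteq> 0"
    and abc: "a = \<rho> * (theta2 \<tau> 0)\<^sup>2 / (theta2 \<tau> \<eta>)\<^sup>2" "b = \<rho> * (theta3 \<tau> 0)\<^sup>2 / (theta3 \<tau> \<eta>)\<^sup>2"
      "c = \<rho> * (theta4 \<tau> 0)\<^sup>2 / (theta4 \<tau> \<eta>)\<^sup>2"
begin

definition theta_point :: "complex \<Rightarrow> complex^4" where
  "theta_point x = vec4 (theta1 \<tau> x / theta1 \<tau> \<eta>) (theta2 \<tau> x / theta2 \<tau> \<eta>)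
     (theta3 \<tau> x / theta3 \<tau> \<eta>) (theta4 \<tau> x / theta4 \<tau> \<eta>)"

definition "T0_at_0 = T0 \<tau> 0"
definition "T2_at_0 = T2 \<tau> 0"

text \<open>Setting y = 0 in the product formulas makes all four squares linear in the two functions
  T0 and T2, with constant coefficients. This is what places the squares of the coordinates of
  \<open>theta_point\<close> in a plane.\<close>

lemma theta_sq:
  "(theta1 \<tau> x)\<^sup>2 = T0 \<tau> x * T2_at_0 - T2 \<tau> x * T0_at_0" "(theta2 \<tau> x)\<^sup>2 = T2 \<tau> x * T0_at_0 + T0 \<tau> x * T2_at_0"
  "(theta3 \<tau> x)\<^sup>2 = T0 \<tau> x * T0_at_0 + T2 \<tau> x * T2_at_0" "(theta4 \<tau> x)\<^sup>2 = T0 \<tau> x * T0_at_0 - T2 \<tau> x * T2_at_0"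
  using theta11[OF \<tau>, of x 0] theta22[OF \<tau>, of x 0] theta33[OF \<tau>, of x 0] theta44[OF \<tau>, of x 0]
  by (simp_all add: power2_eq_square T0_at_0_def T2_at_0_def)

lemma theta0_sq: "(theta2 \<tau> 0)\<^sup>2 = 2 * T0_at_0 * T2_at_0" "(theta3 \<tau> 0)\<^sup>2 = T0_at_0\<^sup>2 + T2_at_0\<^sup>2" "(theta4 \<tau> 0)\<^sup>2 = T0_at_0\<^sup>2 - T2_at_0\<^sup>2"
  unfolding theta_sq by (simp_all add: T0_at_0_def T2_at_0_def power2_eq_square)

lemma T_at_0_nonzero: "T0_at_0 \<noteq> 0" "T2_at_0 \<noteq> 0"
  using theta0_sq(1) nz0(1) by auto

lemma abc_mult:
  "a * (theta2 \<tau> \<eta>)\<^sup>2 = \<rho> * (2 * T0_at_0 * T2_at_0)" "b * (theta3 \<tau> \<eta>)\<^sup>2 = \<rho> * (T0_at_0\<^sup>2 + T2_at_0\<^sup>2)"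
  "c * (theta4 \<tau> \<eta>)\<^sup>2 = \<rho> * (T0_at_0\<^sup>2 - T2_at_0\<^sup>2)"
  unfolding abc theta0_sq using nz\<eta> by simp_all

text \<open>The constants J as theta quotients: J23 is the square of theta1 theta2 / (theta3 theta4)
  at \<eta>, J12 the square of theta1 theta4 / (theta2 theta3), and J31 minus the square of theta1
  theta3 / (theta4 theta2). These supply the hypothesis \<open>AB\<close> of
  \<open>relations_from_products\<close>.\<close>

lemma abc_differences:
  "(b - c) * (theta3 \<tau> \<eta> * theta4 \<tau> \<eta>)\<^sup>2 = a * (theta1 \<tau> \<eta> * theta2 \<tau> \<eta>)\<^sup>2"
  "(c - a) * (theta4 \<tau> \<eta> * theta2 \<tau> \<eta>)\<^sup>2 = - b * (theta1 \<tau> \<eta> * theta3 \<tau> \<eta>)\<^sup>2"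
  "(a - b) * (theta2 \<tau> \<eta> * theta3 \<tau> \<eta>)\<^sup>2 = c * (theta1 \<tau> \<eta> * theta4 \<tau> \<eta>)\<^sup>2"
  using abc_mult theta_sq[of \<eta>] unfolding power_mult_distrib by Groebner_Basis.algebra+

text \<open>Each of the three ways of splitting the four theta functions into two pairs gives one
  R-equation and one S-equation. The even and odd functions are T0 and T2 shifted by 1/4, then T1 +
  i T3 and T1 - i T3 shifted by 1/4, then T1 + T3 and T1 - T3.\<close>

lemma rel_pair_theta_point: "rel_pair a b c (theta_point (x + \<eta>)) (theta_point (x - \<eta>))"
proof -
  have k1: "theta1 \<tau> (x + y) * theta2 \<tau> (x - y) = -1 * (T0 \<tau> (x + 1/4) * T2 \<tau> (y + 1/4) + T2 \<tau> (x + 1/4) * T0 \<tau> (y + 1/4))"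
    "theta3 \<tau> (x + y) * theta4 \<tau> (x - y) = 1 * (T0 \<tau> (x + 1/4) * T0 \<tau> (y + 1/4) + -1 * T2 \<tau> (x + 1/4) * T2 \<tau> (y + 1/4))"
    for x y
    unfolding theta12[OF \<tau>] theta34[OF \<tau>] by (simp_all add: algebra_simps)
  have k2: "theta1 \<tau> (x + y) * theta3 \<tau> (x - y) = -1/2 *
      ((T1 \<tau> (x + 1/4) + \<i> * T3 \<tau> (x + 1/4)) * (T1 \<tau> (y + 1/4) - \<i> * T3 \<tau> (y + 1/4)) +
       (T1 \<tau> (x + 1/4) - \<i> * T3 \<tau> (x + 1/4)) * (T1 \<tau> (y + 1/4) + \<i> * T3 \<tau> (y + 1/4)))"
    for x y
    unfolding theta13[OF \<tau>] by (simp add: algebra_simps)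
  have k2': "theta4 \<tau> (x + y) * theta2 \<tau> (x - y) = - \<i>/2 *
      ((T1 \<tau> (x + 1/4) + \<i> * T3 \<tau> (x + 1/4)) * (T1 \<tau> (y + 1/4) + \<i> * T3 \<tau> (y + 1/4)) + -1 *
       (T1 \<tau> (x + 1/4) - \<i> * T3 \<tau> (x + 1/4)) * (T1 \<tau> (y + 1/4) - \<i> * T3 \<tau> (y + 1/4)))"
    for x y
    using theta24[OF \<tau>, of x "- y"] T_quarter_uminus[of \<tau> y] by (simp add: algebra_simps)
  have k3: "theta1 \<tau> (x + y) * theta4 \<tau> (x - y) = - \<i>/2 *
      ((T1 \<tau> x + T3 \<tau> x) * (T1 \<tau> y - T3 \<tau> y) + (T1 \<tau> x - T3 \<tau> x) * (T1 \<tau> y + T3 \<tau> y))"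
    "theta2 \<tau> (x + y) * theta3 \<tau> (x - y) = 1/2 *
      ((T1 \<tau> x + T3 \<tau> x) * (T1 \<tau> y + T3 \<tau> y) + 1 * (T1 \<tau> x - T3 \<tau> x) * (T1 \<tau> y - T3 \<tau> y))"
    for x y
    unfolding theta14[OF \<tau>] theta23[OF \<tau>] by (simp_all add: algebra_simps)
  have e2: "T1 \<tau> (- x + 1/4) + \<i> * T3 \<tau> (- x + 1/4) = T1 \<tau> (x + 1/4) + \<i> * T3 \<tau> (x + 1/4)"
    "T1 \<tau> (- x + 1/4) - \<i> * T3 \<tau> (- x + 1/4) = - (T1 \<tau> (x + 1/4) - \<i> * T3 \<tau> (x + 1/4))" for x
    unfolding T_quarter_uminus by (simp_all add: algebra_simps)
  have e3: "T1 \<tau> (- x) + T3 \<tau> (- x) = T1 \<tau> x + T3 \<tau> x" "T1 \<tau> (- x) - T3 \<tau> (- x) = - (T1 \<tau> x - T3 \<tau> x)" for x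
    unfolding T_uminus by simp_all
  have i2: "(- \<i>/2)\<^sup>2 = -1/4" "(-1/2 :: complex)\<^sup>2 = 1/4" "(1/2 :: complex)\<^sup>2 = 1/4"
    by (simp_all add: power2_eq_square)
  have AB: "a * (-1) * 1\<^sup>2 * (theta1 \<tau> \<eta> * theta2 \<tau> \<eta>)\<^sup>2 + (b - c) * (-1)\<^sup>2 * (theta3 \<tau> \<eta> * theta4 \<tau> \<eta>)\<^sup>2 = 0"
    "b * (-1) * (- \<i>/2)\<^sup>2 * (theta1 \<tau> \<eta> * theta3 \<tau> \<eta>)\<^sup>2 + (c - a) * (-1/2)\<^sup>2 * (theta4 \<tau> \<eta> * theta2 \<tau> \<eta>)\<^sup>2 = 0"
    "c * 1 * (1/2)\<^sup>2 * (theta1 \<tau> \<eta> * theta4 \<tau> \<eta>)\<^sup>2 + (a - b) * (- \<i>/2)\<^sup>2 * (theta2 \<tau> \<eta> * theta3 \<tau> \<eta>)\<^sup>2 = 0"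
    unfolding i2 using abc_differences by simp_all
  note r1 = relations_from_products[of "\<lambda>x. T0 \<tau> (x + 1/4)" "\<lambda>x. T2 \<tau> (x + 1/4)" "theta1 \<tau>" "theta2 \<tau>" "-1"
      "theta3 \<tau>" "theta4 \<tau>" 1 "-1" \<eta> a "b - c" x,
      OF T_quarter_uminus(1) T_quarter_uminus(3) k1 nz\<eta> AB(1)]
  note r2 = relations_from_products[of "\<lambda>x. T1 \<tau> (x + 1/4) + \<i> * T3 \<tau> (x + 1/4)" "\<lambda>x. T1 \<tau> (x + 1/4) - \<i> * T3 \<tau> (x + 1/4)"
      "theta1 \<tau>" "theta3 \<tau>" "-1/2" "theta4 \<tau>" "theta2 \<tau>" "- \<i>/2" "-1" \<eta> b "c - a" x,
      OF e2 k2 k2' nz\<eta>(1,3,4,2) AB(2)]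
  note r3 = relations_from_products[of "\<lambda>x. T1 \<tau> x + T3 \<tau> x" "\<lambda>x. T1 \<tau> x - T3 \<tau> x"
      "theta1 \<tau>" "theta4 \<tau>" "- \<i>/2" "theta2 \<tau>" "theta3 \<tau>" "1/2" 1 \<eta> c "a - b" x,
      OF e3 k3 nz\<eta>(1,4,2,3) AB(3)]
  show ?thesis
    unfolding rel_pair_iff theta_point_def vec4_nth by (intro conjI r1 r2 r3)
qed

lemma theta_sq_mult:
  "(theta_point x $ 0)\<^sup>2 * (theta1 \<tau> \<eta>)\<^sup>2 = T0 \<tau> x * T2_at_0 - T2 \<tau> x * T0_at_0"
  "(theta_point x $ 1)\<^sup>2 * (theta2 \<tau> \<eta>)\<^sup>2 = T2 \<tau> x * T0_at_0 + T0 \<tau> x * T2_at_0"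
  "(theta_point x $ 2)\<^sup>2 * (theta3 \<tau> \<eta>)\<^sup>2 = T0 \<tau> x * T0_at_0 + T2 \<tau> x * T2_at_0"
  "(theta_point x $ 3)\<^sup>2 * (theta4 \<tau> \<eta>)\<^sup>2 = T0 \<tau> x * T0_at_0 - T2 \<tau> x * T2_at_0"
  unfolding theta_sq[symmetric] using nz\<eta> by (simp_all add: theta_point_def power_divide)

text \<open>On the curve the vector of the squares of the coordinates ranges over a plane, parametrised by \<open>(C, D)\<close>.\<close>

lemma on_curve_if_plane:
  assumes "(Z$0)\<^sup>2 * (theta1 \<tau> \<eta>)\<^sup>2 = C * T2_at_0 - D * T0_at_0" "(Z$1)\<^sup>2 * (theta2 \<tau> \<eta>)\<^sup>2 = D * T0_at_0 + C * T2_at_0"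
    "(Z$2)\<^sup>2 * (theta3 \<tau> \<eta>)\<^sup>2 = C * T0_at_0 + D * T2_at_0" "(Z$3)\<^sup>2 * (theta4 \<tau> \<eta>)\<^sup>2 = C * T0_at_0 - D * T2_at_0"
  shows "on_curve a b c Z"
proof -
  define A B where "A = T0 \<tau> \<eta>" and "B = T2 \<tau> \<eta>"
  define s1 s2 s3 s4 where "s1 = (theta1 \<tau> \<eta>)\<^sup>2" "s2 = (theta2 \<tau> \<eta>)\<^sup>2" "s3 = (theta3 \<tau> \<eta>)\<^sup>2" "s4 = (theta4 \<tau> \<eta>)\<^sup>2"
  note sd = this
  have s: "s1 = A * T2_at_0 - B * T0_at_0" "s2 = B * T0_at_0 + A * T2_at_0" "s3 = A * T0_at_0 + B * T2_at_0" "s4 = A * T0_at_0 - B * T2_at_0"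
    by (simp_all add: theta_sq sd A_def B_def)
  have snz: "s1 \<noteq> 0" "s2 \<noteq> 0" "s3 \<noteq> 0" "s4 \<noteq> 0" using nz\<eta> by (simp_all add: sd)
  note Z = assms[folded sd]
  note m = abc_mult[folded sd]
  \<comment> \<open>The three differences of squares turn out to be a, b, c times one common
    quantity, the determinant \<open>C * B - D * A\<close>; this is their proportionality.\<close>
  have "s1 * s2 * ((Z$0)\<^sup>2 - (Z$1)\<^sup>2) = 2 * T0_at_0 * T2_at_0 * (C * B - D * A)"
    using Z s by Groebner_Basis.algebra
  then have "s2 * (\<rho> * s1 * ((Z$0)\<^sup>2 - (Z$1)\<^sup>2)) = s2 * (a * (C * B - D * A))"
    using m by Groebner_Basis.algebra
  then have 1: "\<rho> * s1 * ((Z$0)\<^sup>2 - (Z$1)\<^sup>2) = a * (C * B - D * A)" using snz by simp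
  have "s1 * s3 * ((Z$0)\<^sup>2 - (Z$2)\<^sup>2) = (T0_at_0\<^sup>2 + T2_at_0\<^sup>2) * (C * B - D * A)"
    using Z s by Groebner_Basis.algebra
  then have "s3 * (\<rho> * s1 * ((Z$0)\<^sup>2 - (Z$2)\<^sup>2)) = s3 * (b * (C * B - D * A))"
    using m by Groebner_Basis.algebra
  then have 2: "\<rho> * s1 * ((Z$0)\<^sup>2 - (Z$2)\<^sup>2) = b * (C * B - D * A)" using snz by simp
  have "s1 * s4 * ((Z$0)\<^sup>2 - (Z$3)\<^sup>2) = (T0_at_0\<^sup>2 - T2_at_0\<^sup>2) * (C * B - D * A)"
    using Z s by Groebner_Basis.algebra
  then have "s4 * (\<rho> * s1 * ((Z$0)\<^sup>2 - (Z$3)\<^sup>2)) = s4 * (c * (C * B - D * A))"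
    using m by Groebner_Basis.algebra
  then have 3: "\<rho> * s1 * ((Z$0)\<^sup>2 - (Z$3)\<^sup>2) = c * (C * B - D * A)" using snz by simp
  have rs: "\<rho> * s1 \<noteq> 0" using snz \<rho> by simp
  have "\<rho> * s1 * (b * ((Z$0)\<^sup>2 - (Z$1)\<^sup>2)) = \<rho> * s1 * (a * ((Z$0)\<^sup>2 - (Z$2)\<^sup>2))"
    "\<rho> * s1 * (c * ((Z$0)\<^sup>2 - (Z$1)\<^sup>2)) = \<rho> * s1 * (a * ((Z$0)\<^sup>2 - (Z$3)\<^sup>2))"
    "\<rho> * s1 * (c * ((Z$0)\<^sup>2 - (Z$2)\<^sup>2)) = \<rho> * s1 * (b * ((Z$0)\<^sup>2 - (Z$3)\<^sup>2))"
    using 1 2 3 by Groebner_Basis.algebra+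
  then show ?thesis unfolding on_curve_def mult_left_cancel[OF rs] by blast
qed

lemma on_curve_theta_point: "on_curve a b c (theta_point x)"
  by (rule on_curve_if_plane[OF theta_sq_mult])

lemma plane_if_on_curve:
  assumes "on_curve a b c Z"
  obtains C D where
    "(Z$0)\<^sup>2 * (theta1 \<tau> \<eta>)\<^sup>2 = C * T2_at_0 - D * T0_at_0" "(Z$1)\<^sup>2 * (theta2 \<tau> \<eta>)\<^sup>2 = D * T0_at_0 + C * T2_at_0"
    "(Z$2)\<^sup>2 * (theta3 \<tau> \<eta>)\<^sup>2 = C * T0_at_0 + D * T2_at_0" "(Z$3)\<^sup>2 * (theta4 \<tau> \<eta>)\<^sup>2 = C * T0_at_0 - D * T2_at_0"
proof -
  define A B where "A = T0 \<tau> \<eta>" and "B = T2 \<tau> \<eta>"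
  define s1 s2 s3 s4 where "s1 = (theta1 \<tau> \<eta>)\<^sup>2" "s2 = (theta2 \<tau> \<eta>)\<^sup>2" "s3 = (theta3 \<tau> \<eta>)\<^sup>2" "s4 = (theta4 \<tau> \<eta>)\<^sup>2"
  note sd = this
  have s: "s1 = A * T2_at_0 - B * T0_at_0" "s2 = B * T0_at_0 + A * T2_at_0" "s3 = A * T0_at_0 + B * T2_at_0" "s4 = A * T0_at_0 - B * T2_at_0"
    by (simp_all add: theta_sq sd A_def B_def)
  have snz: "s1 \<noteq> 0" "s2 \<noteq> 0" "s3 \<noteq> 0" "s4 \<noteq> 0" using nz\<eta> by (simp_all add: sd)
  note m = abc_mult[folded sd]
  \<comment> \<open>Chosen to solve the first two of the four equations; the curve equations then
    determine the squares of Z2 and Z3.\<close>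
  define C D where "C = ((Z$0)\<^sup>2 * s1 + (Z$1)\<^sup>2 * s2) / (2 * T2_at_0)" and "D = ((Z$1)\<^sup>2 * s2 - (Z$0)\<^sup>2 * s1) / (2 * T0_at_0)"
  have C: "2 * (C * T2_at_0) = (Z$0)\<^sup>2 * s1 + (Z$1)\<^sup>2 * s2" and D: "2 * (D * T0_at_0) = (Z$1)\<^sup>2 * s2 - (Z$0)\<^sup>2 * s1"
    using T_at_0_nonzero by (simp_all add: C_def D_def)
  have "2 * ((Z$0)\<^sup>2 * s1) = 2 * (C * T2_at_0 - D * T0_at_0)" "2 * ((Z$1)\<^sup>2 * s2) = 2 * (D * T0_at_0 + C * T2_at_0)"
    using C D by Groebner_Basis.algebra+
  moreover have two: "(2 :: complex) \<noteq> 0" by simp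
  ultimately have 0: "(Z$0)\<^sup>2 * s1 = C * T2_at_0 - D * T0_at_0" and 1: "(Z$1)\<^sup>2 * s2 = D * T0_at_0 + C * T2_at_0"
    unfolding mult_left_cancel[OF two] by auto
  have nn: "2 * T0_at_0 * T2_at_0 * s1 \<noteq> 0" using snz T_at_0_nonzero by simp
  have eb: "b * ((Z$0)\<^sup>2 - (Z$1)\<^sup>2) = a * ((Z$0)\<^sup>2 - (Z$2)\<^sup>2)" and ec: "c * ((Z$0)\<^sup>2 - (Z$1)\<^sup>2) = a * ((Z$0)\<^sup>2 - (Z$3)\<^sup>2)"
    using assms by (auto simp: on_curve_def)
  have "(s2 * s3) * (b * ((Z$0)\<^sup>2 - (Z$1)\<^sup>2)) = (s2 * s3) * (a * ((Z$0)\<^sup>2 - (Z$2)\<^sup>2))"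
    using eb by simp
  then have "\<rho> * ((T0_at_0\<^sup>2 + T2_at_0\<^sup>2) * s2 * ((Z$0)\<^sup>2 - (Z$1)\<^sup>2)) = \<rho> * (2 * T0_at_0 * T2_at_0 * s3 * ((Z$0)\<^sup>2 - (Z$2)\<^sup>2))"
    using m by Groebner_Basis.algebra
  then have "(T0_at_0\<^sup>2 + T2_at_0\<^sup>2) * s2 * ((Z$0)\<^sup>2 - (Z$1)\<^sup>2) = 2 * T0_at_0 * T2_at_0 * s3 * ((Z$0)\<^sup>2 - (Z$2)\<^sup>2)"
    unfolding mult_left_cancel[OF \<rho>] .
  then have "(2 * T0_at_0 * T2_at_0 * s1) * ((Z$2)\<^sup>2 * s3) = (2 * T0_at_0 * T2_at_0 * s1) * (C * T0_at_0 + D * T2_at_0)"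
    using 0 1 s by Groebner_Basis.algebra
  then have 2: "(Z$2)\<^sup>2 * s3 = C * T0_at_0 + D * T2_at_0" unfolding mult_left_cancel[OF nn] .
  have "(s2 * s4) * (c * ((Z$0)\<^sup>2 - (Z$1)\<^sup>2)) = (s2 * s4) * (a * ((Z$0)\<^sup>2 - (Z$3)\<^sup>2))"
    using ec by simp
  then have "\<rho> * ((T0_at_0\<^sup>2 - T2_at_0\<^sup>2) * s2 * ((Z$0)\<^sup>2 - (Z$1)\<^sup>2)) = \<rho> * (2 * T0_at_0 * T2_at_0 * s4 * ((Z$0)\<^sup>2 - (Z$3)\<^sup>2))"
    using m by Groebner_Basis.algebra
  then have "(T0_at_0\<^sup>2 - T2_at_0\<^sup>2) * s2 * ((Z$0)\<^sup>2 - (Z$1)\<^sup>2) = 2 * T0_at_0 * T2_at_0 * s4 * ((Z$0)\<^sup>2 - (Z$3)\<^sup>2)"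
    unfolding mult_left_cancel[OF \<rho>] .
  then have "(2 * T0_at_0 * T2_at_0 * s1) * ((Z$3)\<^sup>2 * s4) = (2 * T0_at_0 * T2_at_0 * s1) * (C * T0_at_0 - D * T2_at_0)"
    using 0 1 s by Groebner_Basis.algebra
  then have 3: "(Z$3)\<^sup>2 * s4 = C * T0_at_0 - D * T2_at_0" unfolding mult_left_cancel[OF nn] .
  show ?thesis using that 0 1 2 3 unfolding sd by blast
qed

lemma theta3_holomorphic: "theta3 \<tau> holomorphic_on A"
  using Theta_holomorphic[OF \<tau>] by (simp add: theta3_eq[abs_def])

lemma T_holomorphic: "T0 \<tau> holomorphic_on A" "T2 \<tau> holomorphic_on A"
proof -
  have "Theta (2 * \<tau>) s holomorphic_on UNIV" for s
    using \<tau> by (intro Theta_holomorphic) simp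
  note h = holomorphic_on_affine[OF this, of _ 2 0 A]
  show "T0 \<tau> holomorphic_on A" "T2 \<tau> holomorphic_on A"
    unfolding T0_def[abs_def] T2_def[abs_def] using h[of 0] h[of "1/2"] by simp_all
qed

text \<open>At a common zero x, \<open>theta33\<close> would make theta3 (x + y) theta3 (x - y)
  vanish for all y. The first factor is nonzero at y = -x, so the second would vanish identically,
  in particular at y = x, against theta3 (0) \<noteq> 0.\<close>

lemma T0_T2_not_both_zero: "\<not> (T0 \<tau> x = 0 \<and> T2 \<tau> x = 0)"
proof
  assume 0: "T0 \<tau> x = 0 \<and> T2 \<tau> x = 0"
  have c: "(\<lambda>y. theta3 \<tau> (x + y)) holomorphic_on UNIV" "(\<lambda>y. theta3 \<tau> (x - y)) holomorphic_on UNIV"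
    using holomorphic_on_affine[OF theta3_holomorphic, of 1 x UNIV] holomorphic_on_affine[OF theta3_holomorphic, of "-1" x UNIV]
    by (simp_all add: add.commute)
  have "theta3 \<tau> (x - x) = 0"
    by (rule product_zero_imp_zero[OF c, of "- x"]) (use theta33[OF \<tau>, of x] 0 nz0 in auto)
  then show False using nz0 by simp
qed

lemma theta_point_nonzero: "theta_point x \<noteq> 0"
proof
  assume "theta_point x = 0"
  then have "theta1 \<tau> x = 0" "theta2 \<tau> x = 0" "theta3 \<tau> x = 0" "theta4 \<tau> x = 0"
    using nz\<eta> by (simp_all add: theta_point_def vec4_eq_iff)
  then have "T0 \<tau> x * T2_at_0 - T2 \<tau> x * T0_at_0 = 0" "T2 \<tau> x * T0_at_0 + T0 \<tau> x * T2_at_0 = 0"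
    unfolding theta_sq[symmetric] by simp_all
  then have "2 * (T0 \<tau> x * T2_at_0) = 0" "2 * (T2 \<tau> x * T0_at_0) = 0" by Groebner_Basis.algebra+
  then show False using T0_T2_not_both_zero[of x] T_at_0_nonzero by simp
qed

text \<open>T0, T2 and the combination \<open>F\<close> have the same multipliers under the periods.
  Without a zero of \<open>F\<close> the quotients T0/F and T2/F would be entire and doubly
  periodic, hence constant, and theta1^2 would be a constant multiple of \<open>F\<close>. As theta1
  vanishes at 0 that constant would be 0, against theta1 (\<eta>) \<noteq> 0.\<close>

lemma T0_T2_proportion:
  assumes "\<not> (C = 0 \<and> D = 0)"
  obtains x k where "k \<noteq> 0" "T0 \<tau> x = k * C" "T2 \<tau> x = k * D"
proof -
  define F where "F = (\<lambda>x. D * T0 \<tau> x - C * T2 \<tau> x)"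
  have "\<exists>x. F x = 0"
  proof (rule ccontr)
    assume no: "\<nexists>x. F x = 0"
    then have nF: "F x \<noteq> 0" for x by blast
    have hF: "F holomorphic_on UNIV"
      unfolding F_def by (intro holomorphic_intros T_holomorphic)
    obtain k0 where k0: "\<And>z. T0 \<tau> z / F z = k0"
    proof (rule constant_if_doubly_periodic[of "\<lambda>z. T0 \<tau> z / F z" \<tau>])
      show "(\<lambda>z. T0 \<tau> z / F z) holomorphic_on UNIV"
        by (intro holomorphic_on_divide T_holomorphic hF) (use nF in auto)
      show "T0 \<tau> (z + 1) / F (z + 1) = T0 \<tau> z / F z" for z
        by (simp add: F_def T_plus_1)
      show "T0 \<tau> (z + \<tau>) / F (z + \<tau>) = T0 \<tau> z / F z" for z
      proof -
        have "F (z + \<tau>) = exp (- (2 * of_real pi * \<i> * \<tau>) - 4 * of_real pi * \<i> * z) * F z"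
          unfolding F_def T_plus_period by (simp add: algebra_simps)
        then show ?thesis unfolding T_plus_period by simp
      qed
    qed (use \<tau> in auto)
    obtain k2 where k2: "\<And>z. T2 \<tau> z / F z = k2"
    proof (rule constant_if_doubly_periodic[of "\<lambda>z. T2 \<tau> z / F z" \<tau>])
      show "(\<lambda>z. T2 \<tau> z / F z) holomorphic_on UNIV"
        by (intro holomorphic_on_divide T_holomorphic hF) (use nF in auto)
      show "T2 \<tau> (z + 1) / F (z + 1) = T2 \<tau> z / F z" for z
        by (simp add: F_def T_plus_1)
      show "T2 \<tau> (z + \<tau>) / F (z + \<tau>) = T2 \<tau> z / F z" for z
      proof -
        have "F (z + \<tau>) = exp (- (2 * of_real pi * \<i> * \<tau>) - 4 * of_real pi * \<i> * z) * F z"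
          unfolding F_def T_plus_period by (simp add: algebra_simps)
        then show ?thesis unfolding T_plus_period by simp
      qed
    qed (use \<tau> in auto)
    have "T0 \<tau> z = k0 * F z" "T2 \<tau> z = k2 * F z" for z
      using k0[of z] k2[of z] nF[of z] by (auto simp: field_simps)
    then have sq: "(theta1 \<tau> z)\<^sup>2 = (k0 * T2_at_0 - k2 * T0_at_0) * F z" for z
      unfolding theta_sq by (simp add: algebra_simps)
    have "theta1 \<tau> 0 = 0" using theta_uminus(1)[of \<tau> 0] by simp
    then have "k0 * T2_at_0 - k2 * T0_at_0 = 0" using sq[of 0] nF[of 0] by simp
    then show False using sq[of \<eta>] nz\<eta> by simp
  qed
  then obtain x where x: "D * T0 \<tau> x = C * T2 \<tau> x" by (auto simp: F_def)
  show thesis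
  proof (cases "C = 0")
    case True
    then have "D \<noteq> 0" "T0 \<tau> x = 0" using assms x by auto
    then show ?thesis using that[of "T2 \<tau> x / D" x] T0_T2_not_both_zero[of x] True by auto
  next
    case False
    then have "T0 \<tau> x \<noteq> 0" using x T0_T2_not_both_zero[of x] by auto
    then show ?thesis using that[of "T0 \<tau> x / C" x] False x by (auto simp: field_simps)
  qed
qed

text \<open>The punctured cone over the image of the parametrisation; on vectors, unlike on points,
  single signs and scalars can be adjusted separately.\<close>

definition orbit :: "(complex^4) set" where
  "orbit = {k *s theta_point x | k x. k \<noteq> 0}"

lemma orbit_scale: "v \<in> orbit \<Longrightarrow> k \<noteq> 0 \<Longrightarrow> k *s v \<in> orbit"
  unfolding orbit_def by (auto simp: vector_smult_assoc) (metis mult_eq_0_iff)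

text \<open>The substitutions -x, x + 1 and x + \<open>\<tau>\<close> negate the coordinates {0},
  {0, 1} and {0, 3}, the last one up to a common exponential factor. Together with the scalar -1,
  which negates all four, they generate every change of signs.\<close>

lemma orbit_flips:
  assumes "vec4 p q r s \<in> orbit"
  shows "vec4 (- p) q r s \<in> orbit" "vec4 p (- q) r s \<in> orbit" "vec4 p q (- r) s \<in> orbit" "vec4 p q r (- s) \<in> orbit"
proof -
  have 0: "vec4 (- p) q r s \<in> orbit" if in_orbit: "vec4 p q r s \<in> orbit" for p q r s
  proof -
    obtain k x where kx: "k \<noteq> 0" "vec4 p q r s = k *s theta_point x" using in_orbit by (auto simp: orbit_def)
    have "vec4 (- p) q r s = k *s theta_point (- x)"
      using kx(2) by (simp add: vec4_eq_iff theta_point_def theta_uminus)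
    then show ?thesis using kx(1) unfolding orbit_def by blast
  qed
  have 01: "vec4 (- p) (- q) r s \<in> orbit" if in_orbit: "vec4 p q r s \<in> orbit" for p q r s
  proof -
    obtain k x where kx: "k \<noteq> 0" "vec4 p q r s = k *s theta_point x" using in_orbit by (auto simp: orbit_def)
    have "vec4 (- p) (- q) r s = k *s theta_point (x + 1)"
      using kx(2) by (simp add: vec4_eq_iff theta_point_def theta_plus_1)
    then show ?thesis using kx(1) unfolding orbit_def by blast
  qed
  have 03: "vec4 (- p) q r (- s) \<in> orbit" if in_orbit: "vec4 p q r s \<in> orbit" for p q r s
  proof -
    obtain k x where kx: "k \<noteq> 0" "vec4 p q r s = k *s theta_point x" using in_orbit by (auto simp: orbit_def)
    define E where "E = exp (- (of_real pi * \<i> * \<tau>) - 2 * of_real pi * \<i> * x)"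
    have "E \<noteq> 0" by (simp add: E_def)
    then have "vec4 (- p) q r (- s) = (k / E) *s theta_point (x + \<tau>)"
      using kx(2) by (simp add: vec4_eq_iff theta_point_def theta_plus_period flip: E_def)
    moreover have "k / E \<noteq> 0" using kx(1) \<open>E \<noteq> 0\<close> by simp
    ultimately show ?thesis unfolding orbit_def by blast
  qed
  have 0123: "vec4 (- p) (- q) (- r) (- s) \<in> orbit" if in_orbit: "vec4 p q r s \<in> orbit" for p q r s
  proof -
    have "vec4 (- p) (- q) (- r) (- s) = (-1) *s vec4 p q r s" by (simp add: vec4_eq_iff)
    then show ?thesis using orbit_scale[OF in_orbit, of "-1"] by simp
  qed
  show "vec4 (- p) q r s \<in> orbit" by (rule 0[OF assms])
  show 1: "vec4 p (- q) r s \<in> orbit" using 0[OF 01[OF assms]] by simp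
  show 3: "vec4 p q r (- s) \<in> orbit" using 0[OF 03[OF assms]] by simp
  show "vec4 p q (- r) s \<in> orbit" using 0123[OF 01[OF 0[OF 03[OF assms]]]] by simp
qed

lemma in_orbit_if_squares_eq:
  assumes "v \<in> orbit" "(w$0)\<^sup>2 = (v$0)\<^sup>2" "(w$1)\<^sup>2 = (v$1)\<^sup>2" "(w$2)\<^sup>2 = (v$2)\<^sup>2" "(w$3)\<^sup>2 = (v$3)\<^sup>2"
  shows "w \<in> orbit"
proof -
  have "vec4 (v$0) (v$1) (v$2) (v$3) \<in> orbit" using assms(1) by (simp add: vec4_collapse)
  moreover have "w$0 = v$0 \<or> w$0 = - v$0" using assms(2) by (simp add: power2_eq_iff)
  ultimately have "vec4 (w$0) (v$1) (v$2) (v$3) \<in> orbit" using orbit_flips(1) by auto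
  moreover have "w$1 = v$1 \<or> w$1 = - v$1" using assms(3) by (simp add: power2_eq_iff)
  ultimately have "vec4 (w$0) (w$1) (v$2) (v$3) \<in> orbit" using orbit_flips(2) by auto
  moreover have "w$2 = v$2 \<or> w$2 = - v$2" using assms(4) by (simp add: power2_eq_iff)
  ultimately have "vec4 (w$0) (w$1) (w$2) (v$3) \<in> orbit" using orbit_flips(3) by auto
  moreover have "w$3 = v$3 \<or> w$3 = - v$3" using assms(5) by (simp add: power2_eq_iff)
  ultimately have "vec4 (w$0) (w$1) (w$2) (w$3) \<in> orbit" using orbit_flips(4) by auto
  then show ?thesis by (simp add: vec4_collapse)
qed

lemma on_curve_imp_orbit:
  assumes "on_curve a b c Z" "Z \<noteq> 0"
  shows "Z \<in> orbit"
proof -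
  obtain C D where CD: "(Z$0)\<^sup>2 * (theta1 \<tau> \<eta>)\<^sup>2 = C * T2_at_0 - D * T0_at_0" "(Z$1)\<^sup>2 * (theta2 \<tau> \<eta>)\<^sup>2 = D * T0_at_0 + C * T2_at_0"
    "(Z$2)\<^sup>2 * (theta3 \<tau> \<eta>)\<^sup>2 = C * T0_at_0 + D * T2_at_0" "(Z$3)\<^sup>2 * (theta4 \<tau> \<eta>)\<^sup>2 = C * T0_at_0 - D * T2_at_0"
    using plane_if_on_curve[OF assms(1)] by metis
  have "\<not> (C = 0 \<and> D = 0)"
    using CD assms(2) nz\<eta> by (auto simp: vec4_eq_iff)
  then obtain x k where k: "k \<noteq> 0" "T0 \<tau> x = k * C" "T2 \<tau> x = k * D"
    by (rule T0_T2_proportion)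
  \<comment> \<open>The squares of the coordinates have to be scaled by k, so the vector is scaled
    by a square root of k.\<close>
  define m where "m = csqrt k"
  have m: "m\<^sup>2 = k" "m \<noteq> 0" using k(1) by (auto simp: m_def)
  have eq: "y = w" if "y * t\<^sup>2 = X" "w * t\<^sup>2 = X" "t \<noteq> 0" for y w X t :: complex
    using that by (metis mult_right_cancel power_not_zero)
  have sc: "((m *s Z)$i)\<^sup>2 * t\<^sup>2 = k * ((Z$i)\<^sup>2 * t\<^sup>2)" for i t
    by (simp add: power_mult_distrib m)
  have "m *s Z \<in> orbit"
  proof (rule in_orbit_if_squares_eq)
    show "theta_point x \<in> orbit" unfolding orbit_def by (rule CollectI, rule exI[of _ 1], rule exI[of _ x]) simp
    show "((m *s Z)$0)\<^sup>2 = (theta_point x $ 0)\<^sup>2"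
      by (rule eq[OF _ theta_sq_mult(1) nz\<eta>(1)]) (unfold sc CD(1) k, simp add: algebra_simps)
    show "((m *s Z)$1)\<^sup>2 = (theta_point x $ 1)\<^sup>2"
      by (rule eq[OF _ theta_sq_mult(2) nz\<eta>(2)]) (unfold sc CD(2) k, simp add: algebra_simps)
    show "((m *s Z)$2)\<^sup>2 = (theta_point x $ 2)\<^sup>2"
      by (rule eq[OF _ theta_sq_mult(3) nz\<eta>(3)]) (unfold sc CD(3) k, simp add: algebra_simps)
    show "((m *s Z)$3)\<^sup>2 = (theta_point x $ 3)\<^sup>2"
      by (rule eq[OF _ theta_sq_mult(4) nz\<eta>(4)]) (unfold sc CD(4) k, simp add: algebra_simps)
  qed
  then have "(1 / m) *s (m *s Z) \<in> orbit" by (rule orbit_scale) (use m(2) in simp)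
  moreover have "(1 / m) *s (m *s Z) = Z" using m(2) by (simp add: vector_smult_assoc)
  ultimately show ?thesis by simp
qed

end

subsection \<open>The quadratic relations\<close>

lemma lookup_smul: "Poly_Mapping.lookup (k \<odot> x) w = k * Poly_Mapping.lookup x w"
  unfolding smul_def lookup_mult lookup_single by (simp add: when_mult)

lemma smul_gen_mult: "(j \<odot> gen i) * (k \<odot> gen i') = (j * k) \<odot> (gen i * gen i')"
  by (simp add: smul_def gen_def mult_single)

lemma lookup_gen_mult:
  "Poly_Mapping.lookup (gen i * gen j) (Word [i', j']) = (if i = i' \<and> j = j' then 1 else 0)"
  by (simp add: gen_def mult_single lookup_single when_def)

lemma pair2_add: "pair2 (x + y) \<alpha> \<beta> = pair2 x \<alpha> \<beta> + pair2 y \<alpha> \<beta>"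
  by (simp add: pair2_def lookup_add distrib_right sum.distrib)

lemma pair2_smul: "pair2 (k \<odot> x) \<alpha> \<beta> = k * pair2 x \<alpha> \<beta>"
  by (simp add: pair2_def lookup_smul sum_distrib_left mult.assoc)

lemma pair2_diff: "pair2 (x - y) \<alpha> \<beta> = pair2 x \<alpha> \<beta> - pair2 y \<alpha> \<beta>"
  by (simp add: pair2_def lookup_minus left_diff_distrib sum_subtractf)

lemma pair2_gen_mult: "pair2 (gen i * gen j) \<alpha> \<beta> = \<alpha>$i * \<beta>$j"
proof -
  have "pair2 (gen i * gen j) \<alpha> \<beta> = (\<Sum>i'\<in>UNIV. \<Sum>j'\<in>UNIV. if i' = i then (if j' = j then \<alpha>$i * \<beta>$j else 0) else 0)"
    unfolding pair2_def lookup_gen_mult by (intro sum.cong refl) auto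
  also have "\<dots> = \<alpha>$i * \<beta>$j"
    by (subst sum.swap) (simp add: sum.delta)
  finally show ?thesis .
qed

lemma pair1_smul_gen: "pair1 (k \<odot> gen i) \<alpha> = k * \<alpha>$i"
proof -
  have "pair1 (k \<odot> gen i) \<alpha> = (\<Sum>i'\<in>UNIV. if i' = i then k * \<alpha>$i else 0)"
    unfolding pair1_def lookup_smul gen_def lookup_single when_def by (intro sum.cong refl) auto
  then show ?thesis by simp
qed

lemma pair2_span_eq_0_iff:
  "(\<forall>\<omega>\<in>tens.span S. pair2 \<omega> \<alpha> \<beta> = 0) \<longleftrightarrow> (\<forall>\<omega>\<in>S. pair2 \<omega> \<alpha> \<beta> = 0)"
proof
  assume S: "\<forall>\<omega>\<in>S. pair2 \<omega> \<alpha> \<beta> = 0"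
  have "tens.subspace {\<omega>. pair2 \<omega> \<alpha> \<beta> = 0}"
    by (rule tens.subspaceI) (simp_all add: pair2_add pair2_smul, simp add: pair2_def)
  then have "tens.span S \<subseteq> {\<omega>. pair2 \<omega> \<alpha> \<beta> = 0}"
    using S by (intro tens.span_minimal) auto
  then show "\<forall>\<omega>\<in>tens.span S. pair2 \<omega> \<alpha> \<beta> = 0" by blast
qed (use tens.span_base in blast)

lemma ring_tens_ring: "ring tens_ring"
proof (rule ringI)
  show "abelian_group tens_ring"
  proof (rule abelian_groupI)
    fix x assume "x \<in> carrier tens_ring"
    show "\<exists>y\<in>carrier tens_ring. y \<oplus>\<^bsub>tens_ring\<^esub> x = \<zero>\<^bsub>tens_ring\<^esub>"
      by (rule bexI[of _ "- x"]) (simp_all add: tens_ring_def)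
  qed (simp_all add: tens_ring_def ac_simps)
  show "monoid tens_ring"
    by (rule monoidI) (simp_all add: tens_ring_def mult.assoc)
qed (simp_all add: tens_ring_def distrib_left distrib_right)

text \<open>An ideal of the tensor algebra is closed under scalars because they act as
  multiplication by the constants \<open>Poly_Mapping.single 0 k\<close>. Relation spaces with the
  same span therefore define the same quotient.\<close>

lemma genideal_span: "Idl\<^bsub>tens_ring\<^esub> (tens.span S) = Idl\<^bsub>tens_ring\<^esub> S"
proof -
  interpret ring tens_ring by (rule ring_tens_ring)
  have c: "S \<subseteq> carrier tens_ring" for S by (simp add: tens_ring_def)
  interpret I: ideal "Idl\<^bsub>tens_ring\<^esub> S" tens_ring by (rule genideal_ideal[OF c])
  have "tens.subspace (Idl\<^bsub>tens_ring\<^esub> S)"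
  proof (rule tens.subspaceI)
    show "0 \<in> Idl\<^bsub>tens_ring\<^esub> S" using I.zero_closed by (simp add: tens_ring_def)
    show "x + y \<in> Idl\<^bsub>tens_ring\<^esub> S" if "x \<in> Idl\<^bsub>tens_ring\<^esub> S" "y \<in> Idl\<^bsub>tens_ring\<^esub> S" for x y
      using I.a_closed[OF that] by (simp add: tens_ring_def)
    show "k \<odot> x \<in> Idl\<^bsub>tens_ring\<^esub> S" if "x \<in> Idl\<^bsub>tens_ring\<^esub> S" for k x
      using I.I_l_closed[OF that, of "Poly_Mapping.single 0 k"] by (simp add: tens_ring_def smul_def)
  qed
  then have "tens.span S \<subseteq> Idl\<^bsub>tens_ring\<^esub> S"
    using genideal_self[OF c] by (intro tens.span_minimal)
  then have "Idl\<^bsub>tens_ring\<^esub> (tens.span S) \<subseteq> Idl\<^bsub>tens_ring\<^esub> S"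
    by (intro genideal_minimal I.ideal_axioms)
  moreover have "S \<subseteq> Idl\<^bsub>tens_ring\<^esub> (tens.span S)"
    using tens.span_superset genideal_self[OF c, of "tens.span S"] by blast
  then have "Idl\<^bsub>tens_ring\<^esub> S \<subseteq> Idl\<^bsub>tens_ring\<^esub> (tens.span S)"
    by (intro genideal_minimal genideal_ideal[OF c])
  ultimately show ?thesis by (rule equalityI)
qed

text \<open>Keeps four tensors opaque, so that an identity between relations is reduced to four
  scalar identities by \<open>lincomb4_cong\<close>.\<close>

definition lincomb4 :: "tens \<Rightarrow> tens \<Rightarrow> tens \<Rightarrow> tens \<Rightarrow> complex \<Rightarrow> complex \<Rightarrow> complex \<Rightarrow> complex \<Rightarrow> tens" where
  "lincomb4 p q m n x y z w = x \<odot> p + y \<odot> q + z \<odot> m + w \<odot> n"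

lemma lincomb4_add: "lincomb4 p q m n x y z w + lincomb4 p q m n x' y' z' w' =
    lincomb4 p q m n (x + x') (y + y') (z + z') (w + w')"
  by (simp add: lincomb4_def tens.scale_left_distrib ac_simps)

lemma lincomb4_smul: "k \<odot> lincomb4 p q m n x y z w = lincomb4 p q m n (k * x) (k * y) (k * z) (k * w)"
  by (simp add: lincomb4_def tens.scale_right_distrib)

lemma lincomb4_cong: "x = x' \<Longrightarrow> y = y' \<Longrightarrow> z = z' \<Longrightarrow> w = w' \<Longrightarrow>
    lincomb4 p q m n x y z w = lincomb4 p q m n x' y' z' w'"
  by simp

text \<open>Sum and difference of the two relations with index \<open>k\<close> are multiples of the relations in normal form.\<close>

lemma span_relation_pair:
  fixes p q m n :: tens and uk u0 ul um d e J :: complex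
  assumes nz: "e \<noteq> 0" "ul - um \<noteq> 0" "ul + um \<noteq> 0"
    and d: "d * (ul - um) = e * (uk + u0)" and J: "J * d * (ul + um) = (uk - u0) * e"
  defines "B1 \<equiv> uk \<odot> p - u0 \<odot> q + ul \<odot> m - um \<odot> n" and "B2 \<equiv> uk \<odot> q - u0 \<odot> p + um \<odot> m - ul \<odot> n"
    and "A1 \<equiv> (d \<odot> q - d \<odot> p) - (e \<odot> m + e \<odot> n)"
    and "A2 \<equiv> (e \<odot> m - e \<odot> n) - (- J) \<odot> (d \<odot> q + d \<odot> p)"
  shows "A1 \<in> tens.span {B1, B2}" "A2 \<in> tens.span {B1, B2}" "B1 \<in> tens.span {A1, A2}" "B2 \<in> tens.span {A1, A2}"
proof -
  let ?L = "lincomb4 p q m n"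
  define x y where "x = ul - um" and "y = ul + um"
  have xy: "x \<noteq> 0" "y \<noteq> 0" using nz by (simp_all add: x_def y_def)
  have ul: "ul = (x + y) / 2" and um: "um = (y - x) / 2" by (simp_all add: x_def y_def)
  \<comment> \<open>The hypotheses eliminate d and \<open>J * d\<close>, after which the
    coefficients are rational expressions in uk, u0, x, y and e.\<close>
  have dd: "d = e * (uk + u0) / x" using d xy(1) by (simp add: nonzero_eq_divide_eq flip: x_def)
  have JJ: "J * d = (uk - u0) * e / y" using J xy(2) by (simp add: nonzero_eq_divide_eq flip: y_def)
  have L: "B1 = ?L uk (- u0) ((x + y) / 2) (- ((y - x) / 2))" "B2 = ?L (- u0) uk ((y - x) / 2) (- ((x + y) / 2))"
    "A1 = ?L (- d) d (- e) (- e)" "A2 = ?L (J * d) (J * d) e (- e)"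
    unfolding B1_def B2_def A1_def A2_def lincomb4_def ul um
    by (simp_all add: tens.scale_right_distrib algebra_simps)
  have "A1 = (- e / x) \<odot> B1 + (e / x) \<odot> B2"
    unfolding L lincomb4_smul lincomb4_add JJ unfolding dd
    by (rule lincomb4_cong) (use nz(1) xy in \<open>simp_all add: field_simps\<close>)
  then show "A1 \<in> tens.span {B1, B2}"
    by (metis insertI1 insertI2 singletonI tens.span_add tens.span_base tens.span_scale)
  have "A2 = (e / y) \<odot> B1 + (e / y) \<odot> B2"
    unfolding L lincomb4_smul lincomb4_add JJ unfolding dd
    by (rule lincomb4_cong) (use nz(1) xy in \<open>simp_all add: field_simps\<close>)
  then show "A2 \<in> tens.span {B1, B2}"
    by (metis insertI1 insertI2 singletonI tens.span_add tens.span_base tens.span_scale)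
  have "B1 = (- x / (2 * e)) \<odot> A1 + (y / (2 * e)) \<odot> A2"
    unfolding L lincomb4_smul lincomb4_add JJ unfolding dd
    by (rule lincomb4_cong) (use nz(1) xy in \<open>simp_all add: field_simps\<close>)
  then show "B1 \<in> tens.span {A1, A2}"
    by (metis insertI1 insertI2 singletonI tens.span_add tens.span_base tens.span_scale)
  have "B2 = (x / (2 * e)) \<odot> A1 + (y / (2 * e)) \<odot> A2"
    unfolding L lincomb4_smul lincomb4_add JJ unfolding dd
    by (rule lincomb4_cong) (use nz(1) xy in \<open>simp_all add: field_simps\<close>)
  then show "B2 \<in> tens.span {A1, A2}"
    by (metis insertI1 insertI2 singletonI tens.span_add tens.span_base tens.span_scale)
qed

section \<open>Diagonal changes of coordinates and genericity\<close>

definition diag :: "(4 \<Rightarrow> complex) \<Rightarrow> complex^4 \<Rightarrow> complex^4" where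
  "diag \<kappa> v = (\<chi> \<mu>. \<kappa> \<mu> * v $ \<mu>)"

lemma diag_scale: "diag \<kappa> (k *s v) = k *s diag \<kappa> v"
  by (simp add: diag_def vec_eq_iff)

lemma diag_eq_0: "(\<And>\<mu>. \<kappa> \<mu> \<noteq> 0) \<Longrightarrow> diag \<kappa> v = 0 \<longleftrightarrow> v = 0"
  by (simp add: diag_def vec_eq_iff)

lemma form_maps_diag: "f \<in> form_maps UNIV d \<Longrightarrow> (\<lambda>v. diag \<kappa> (f v)) \<in> form_maps UNIV d"
  unfolding form_maps_def diag_def by (auto intro!: complex_coefficients.forms_cmult)

lemma form_maps_rows_diag:
  "(\<lambda>v. rowR1 (diag \<kappa> v)) \<in> form_maps UNIV 1" "(\<lambda>v. rowR2 (diag \<kappa> v)) \<in> form_maps UNIV 1"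
  "(\<lambda>v. rowR3 (diag \<kappa> v)) \<in> form_maps UNIV 1" "(\<lambda>v. rowS1 a b c (diag \<kappa> v)) \<in> form_maps UNIV 1"
  "(\<lambda>v. rowS2 a b c (diag \<kappa> v)) \<in> form_maps UNIV 1"
  unfolding form_maps_def row_defs mem_Collect_eq forall_index4 vec4_nth diag_def vec_lambda_beta
  by (intro conjI complex_coefficients.forms_cmult complex_coefficients.forms_uminus complex_coefficients.forms_coordinate UNIV_I)+

text \<open>Nine quadratic factors, one for each inequality of \<open>nondegenerate\<close>; hence
  the degree 18.\<close>

definition generic_poly :: "complex^4 \<Rightarrow> complex" where
  "generic_poly u = par_a u * par_b u * par_c u *
     ((par_a u - par_b u) * (par_b u - par_c u) * (par_c u - par_a u)) *
     ((par_a u + par_b u - par_c u) * (par_b u + par_c u - par_a u) * (par_c u + par_a u - par_b u))"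

lemma forms_generic_poly: "generic_poly \<in> forms UNIV 18"
proof -
  have lin: "(\<lambda>v. v$i + v$j) \<in> forms UNIV 1" for i j :: 4
    by (intro complex_coefficients.forms_add complex_coefficients.forms_coordinate)
  have m2: "(\<lambda>v. f v * g v) \<in> forms UNIV 2" if "f \<in> forms UNIV 1" "g \<in> forms UNIV 1" for f g :: "complex^4 \<Rightarrow> complex"
    using complex_coefficients.forms_mult[OF that] by (simp add: eval_nat_numeral)
  have p: "(\<lambda>u. par_a u) \<in> forms UNIV 2" "(\<lambda>u. par_b u) \<in> forms UNIV 2" "(\<lambda>u. par_c u) \<in> forms UNIV 2"
    unfolding par_a_def par_b_def par_c_def by (intro m2 lin)+
  have m6: "(\<lambda>v. f v * g v * h v) \<in> forms UNIV 6"
    if "f \<in> forms UNIV 2" "g \<in> forms UNIV 2" "h \<in> forms UNIV 2" for f g h :: "complex^4 \<Rightarrow> complex"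
    using complex_coefficients.forms_mult[OF complex_coefficients.forms_mult[OF that(1,2)] that(3)]
    by (simp add: eval_nat_numeral)
  have m18: "(\<lambda>v. f v * g v * h v) \<in> forms UNIV 18"
    if "f \<in> forms UNIV 6" "g \<in> forms UNIV 6" "h \<in> forms UNIV 6" for f g h :: "complex^4 \<Rightarrow> complex"
    using complex_coefficients.forms_mult[OF complex_coefficients.forms_mult[OF that(1,2)] that(3)]
    by (simp add: eval_nat_numeral)
  have "(\<lambda>u. generic_poly u) \<in> forms UNIV 18"
    unfolding generic_poly_def
    by (intro m18 m6 complex_coefficients.forms_add complex_coefficients.forms_diff p)
  then show ?thesis by simp
qed

text \<open>At this point (a, b, c) = (6, 10, 12).\<close>

lemma generic_poly_nonzero_somewhere: "generic_poly (vec4 0 1 2 4) \<noteq> 0"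
  by (simp add: generic_poly_def par_a_def par_b_def par_c_def)

locale generic_point =
  fixes u :: "complex^4" and r s :: "4 \<Rightarrow> complex"
  assumes roots: "roots_for u r s" and generic: "generic_poly u \<noteq> 0"
begin

abbreviation "a \<equiv> par_a u"
abbreviation "b \<equiv> par_b u"
abbreviation "c \<equiv> par_c u"

sublocale nondegenerate a b c
  using generic unfolding generic_poly_def by unfold_locales auto

lemma root_eqs:
  "(r 1)\<^sup>2 = u$2 - u$3" "(r 2)\<^sup>2 = u$3 - u$1" "(r 3)\<^sup>2 = u$1 - u$2"
  "(s 1)\<^sup>2 = u$0 + u$1" "(s 2)\<^sup>2 = u$0 + u$2" "(s 3)\<^sup>2 = u$0 + u$3"
  using roots unfolding roots_for_def cyc_def by auto

lemma differences: "b - c = (u$1 - u$0) * (u$2 - u$3)" "c - a = (u$2 - u$0) * (u$3 - u$1)" "a - b = (u$3 - u$0) * (u$1 - u$2)"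
  unfolding par_a_def par_b_def par_c_def by (simp_all add: algebra_simps)

lemma u_nz: "u$0 + u$1 \<noteq> 0" "u$0 + u$2 \<noteq> 0" "u$0 + u$3 \<noteq> 0" "u$2 + u$3 \<noteq> 0" "u$3 + u$1 \<noteq> 0" "u$1 + u$2 \<noteq> 0"
  "u$2 - u$3 \<noteq> 0" "u$3 - u$1 \<noteq> 0" "u$1 - u$2 \<noteq> 0"
proof -
  show "u$0 + u$1 \<noteq> 0" "u$0 + u$2 \<noteq> 0" "u$0 + u$3 \<noteq> 0" "u$2 + u$3 \<noteq> 0" "u$3 + u$1 \<noteq> 0" "u$1 + u$2 \<noteq> 0"
    using nz unfolding par_a_def par_b_def par_c_def by auto
  have "b - c \<noteq> 0" "c - a \<noteq> 0" "a - b \<noteq> 0" using distinct by auto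
  then show "u$2 - u$3 \<noteq> 0" "u$3 - u$1 \<noteq> 0" "u$1 - u$2 \<noteq> 0" unfolding differences by auto
qed

lemma roots_nz: "r 1 \<noteq> 0" "r 2 \<noteq> 0" "r 3 \<noteq> 0" "s 1 \<noteq> 0" "s 2 \<noteq> 0" "s 3 \<noteq> 0"
  using root_eqs u_nz by auto

lemma scaling_nz: "scaling r s \<mu> \<noteq> 0"
  unfolding scaling_def using roots_nz by simp

abbreviation "Y \<equiv> genY r s"
abbreviation "iv \<mu> \<equiv> inverse (scaling r s \<mu>)"

lemma gen_eq: "gen \<mu> = scaling r s \<mu> \<odot> Y \<mu>"
  using scaling_nz[of \<mu>] by (simp add: genY_def)

text \<open>The quotient of the products of the scaling factors 2, 3 and 0, 1 is (s 1)^2 / (r 1)^2 =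
  (u0 + u1) / (u2 - u3). The roots enter through their squares only, so the outcome is the same for
  every choice of roots. This is the hypothesis on d and e in
  \<open>span_relation_pair\<close>.\<close>

lemma scaling_products:
  "iv 0 * iv 1 * (u$2 - u$3) = iv 2 * iv 3 * (u$1 + u$0)"
  "iv 0 * iv 2 * (u$3 - u$1) = iv 3 * iv 1 * (u$2 + u$0)"
  "iv 0 * iv 3 * (u$1 - u$2) = iv 1 * iv 2 * (u$3 + u$0)"
proof -
  have "scaling r s 2 * scaling r s 3 * (u$2 - u$3) = scaling r s 0 * scaling r s 1 * (u$1 + u$0)"
    "scaling r s 3 * scaling r s 1 * (u$3 - u$1) = scaling r s 0 * scaling r s 2 * (u$2 + u$0)"
    "scaling r s 1 * scaling r s 2 * (u$1 - u$2) = scaling r s 0 * scaling r s 3 * (u$3 + u$0)"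
    unfolding add.commute[of _ "u$0"] root_eqs[symmetric] scaling_def
    by (simp_all add: power2_eq_square)
  then show "iv 0 * iv 1 * (u$2 - u$3) = iv 2 * iv 3 * (u$1 + u$0)"
    "iv 0 * iv 2 * (u$3 - u$1) = iv 3 * iv 1 * (u$2 + u$0)"
    "iv 0 * iv 3 * (u$1 - u$2) = iv 1 * iv 2 * (u$3 + u$0)"
    using scaling_nz by (simp_all add: field_simps)
qed

lemma J_mult: "a * par_J u 2 3 = b - c" "b * par_J u 3 1 = c - a" "c * par_J u 1 2 = a - b"
  using nz by (simp_all add: par_J_def)

lemma J_products:
  "par_J u 2 3 * (iv 0 * iv 1) * (u$2 + u$3) = (u$1 - u$0) * (iv 2 * iv 3)"
  "par_J u 3 1 * (iv 0 * iv 2) * (u$3 + u$1) = (u$2 - u$0) * (iv 3 * iv 1)"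
  "par_J u 1 2 * (iv 0 * iv 3) * (u$1 + u$2) = (u$3 - u$0) * (iv 1 * iv 2)"
proof -
  \<comment> \<open>The extra factor u0 + u1 completes u2 + u3 to a, and a J23 = b - c factors as
    (u1 - u0) (u2 - u3).\<close>
  have "(u$0 + u$1) * (par_J u 2 3 * (iv 0 * iv 1) * (u$2 + u$3)) = (u$0 + u$1) * ((u$1 - u$0) * (iv 2 * iv 3))"
    using J_mult(1) scaling_products(1) differences(1) unfolding par_a_def by Groebner_Basis.algebra
  then show "par_J u 2 3 * (iv 0 * iv 1) * (u$2 + u$3) = (u$1 - u$0) * (iv 2 * iv 3)" 
    unfolding mult_left_cancel[OF u_nz(1)] .
  have "(u$0 + u$2) * (par_J u 3 1 * (iv 0 * iv 2) * (u$3 + u$1)) = (u$0 + u$2) * ((u$2 - u$0) * (iv 3 * iv 1))"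
    using J_mult(2) scaling_products(2) differences(2) unfolding par_b_def by Groebner_Basis.algebra
  then show "par_J u 3 1 * (iv 0 * iv 2) * (u$3 + u$1) = (u$2 - u$0) * (iv 3 * iv 1)"
    unfolding mult_left_cancel[OF u_nz(2)] .
  have "(u$0 + u$3) * (par_J u 1 2 * (iv 0 * iv 3) * (u$1 + u$2)) = (u$0 + u$3) * ((u$3 - u$0) * (iv 1 * iv 2))"
    using J_mult(3) scaling_products(3) differences(3) unfolding par_c_def by Groebner_Basis.algebra
  then show "par_J u 1 2 * (iv 0 * iv 3) * (u$1 + u$2) = (u$3 - u$0) * (iv 1 * iv 2)"
    unfolding mult_left_cancel[OF u_nz(3)] .
qed

definition rel_set :: "4 \<Rightarrow> 4 \<Rightarrow> 4 \<Rightarrow> tens set" where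
  "rel_set k l m = {(u$k) \<odot> (gen k * gen 0) - (u$0) \<odot> (gen 0 * gen k)
        + (u$l) \<odot> (gen l * gen m) - (u$m) \<odot> (gen m * gen l),
      (u$k) \<odot> (gen 0 * gen k) - (u$0) \<odot> (gen k * gen 0)
        + (u$m) \<odot> (gen l * gen m) - (u$l) \<odot> (gen m * gen l)}"

definition relY_set :: "4 \<Rightarrow> 4 \<Rightarrow> 4 \<Rightarrow> tens set" where
  "relY_set k l m = {(Y 0 * Y k - Y k * Y 0) - (Y l * Y m + Y m * Y l),
      (Y l * Y m - Y m * Y l) - (- par_J u l m) \<odot> (Y 0 * Y k + Y k * Y 0)}"

lemma rels_eq: "rels u = rel_set 1 2 3 \<union> rel_set 2 3 1 \<union> rel_set 3 1 2"
  unfolding rels_def rel_set_def cyc_def by auto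

lemma relsY_eq: "relsY u Y = relY_set 1 2 3 \<union> relY_set 2 3 1 \<union> relY_set 3 1 2"
  unfolding relsY_def relY_set_def cyc_def by auto

lemma genY_mult: "Y i * Y j = (iv i * iv j) \<odot> (gen i * gen j)"
  unfolding genY_def by (rule smul_gen_mult)

lemma span_rel_sets:
  assumes "(k, l, m) \<in> {(1, 2, 3), (2, 3, 1), (3, 1, 2)}"
  shows "relY_set k l m \<subseteq> tens.span (rel_set k l m)" "rel_set k l m \<subseteq> tens.span (relY_set k l m)"
proof -
  have e: "iv l * iv m \<noteq> 0" using scaling_nz by simp
  have n: "u$l - u$m \<noteq> 0" "u$l + u$m \<noteq> 0" using assms u_nz by auto
  have d: "(iv 0 * iv k) * (u$l - u$m) = (iv l * iv m) * (u$k + u$0)"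
    "par_J u l m * (iv 0 * iv k) * (u$l + u$m) = (u$k - u$0) * (iv l * iv m)"
    using assms scaling_products J_products by auto
  have Y: "relY_set k l m = {((iv 0 * iv k) \<odot> (gen 0 * gen k) - (iv 0 * iv k) \<odot> (gen k * gen 0)) -
        ((iv l * iv m) \<odot> (gen l * gen m) + (iv l * iv m) \<odot> (gen m * gen l)),
      ((iv l * iv m) \<odot> (gen l * gen m) - (iv l * iv m) \<odot> (gen m * gen l)) -
        (- par_J u l m) \<odot> ((iv 0 * iv k) \<odot> (gen 0 * gen k) + (iv 0 * iv k) \<odot> (gen k * gen 0))}"
    unfolding relY_set_def genY_mult by (simp add: mult.commute[of "iv k" "iv 0"] mult.commute[of "iv m" "iv l"])
  note sp = span_relation_pair[OF e n d, where p = "gen k * gen 0" and q = "gen 0 * gen k" and m = "gen l * gen m" and n = "gen m * gen l"]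
  show "relY_set k l m \<subseteq> tens.span (rel_set k l m)"
    unfolding Y rel_set_def by (simp only: insert_subset empty_subsetI sp simp_thms)
  show "rel_set k l m \<subseteq> tens.span (relY_set k l m)"
    unfolding Y rel_set_def by (simp only: insert_subset empty_subsetI sp simp_thms)
qed

lemma rel_space_eq: "rel_space u = tens.span (relsY u Y)"
proof -
  have "relsY u Y \<subseteq> tens.span (rels u)"
    unfolding relsY_eq using span_rel_sets(1)[of 1 2 3] span_rel_sets(1)[of 2 3 1] span_rel_sets(1)[of 3 1 2]
      tens.span_mono[of "rel_set 1 2 3" "rels u"] tens.span_mono[of "rel_set 2 3 1" "rels u"]
      tens.span_mono[of "rel_set 3 1 2" "rels u"] rels_eq by auto
  moreover have "rels u \<subseteq> tens.span (relsY u Y)"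
    unfolding rels_eq using span_rel_sets(2)[of 1 2 3] span_rel_sets(2)[of 2 3 1] span_rel_sets(2)[of 3 1 2]
      tens.span_mono[of "relY_set 1 2 3" "relsY u Y"] tens.span_mono[of "relY_set 2 3 1" "relsY u Y"]
      tens.span_mono[of "relY_set 3 1 2" "relsY u Y"] relsY_eq by auto
  ultimately show ?thesis
    unfolding rel_space_def by (metis tens.span_minimal tens.subspace_span subset_antisym)
qed

lemma alg_u_eq: "alg_u u = quadratic_algebra (relsY u Y)"
  unfolding alg_u_def rel_space_eq quadratic_algebra_def genideal_span ..

text \<open>The coordinates dual to the rescaled generators: the linear form with values \<alpha> on
  the original generators has the values \<open>toZ \<alpha>\<close> on the \<open>Y\<close>, see
  \<open>coords_pt\<close>.\<close>

definition toZ :: "complex^4 \<Rightarrow> complex^4" where "toZ = diag iv"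
definition fromZ :: "complex^4 \<Rightarrow> complex^4" where "fromZ = diag (scaling r s)"

lemma toZ_fromZ [simp]: "toZ (fromZ v) = v" "fromZ (toZ v) = v"
  using scaling_nz by (simp_all add: toZ_def fromZ_def diag_def vec_eq_iff)

lemma toZ_eq_0 [simp]: "toZ v = 0 \<longleftrightarrow> v = 0" "fromZ v = 0 \<longleftrightarrow> v = 0"
  unfolding toZ_def fromZ_def using scaling_nz by (simp_all add: diag_eq_0)

lemma toZ_scale: "toZ (k *s v) = k *s toZ v" "fromZ (k *s v) = k *s fromZ v"
  unfolding toZ_def fromZ_def by (rule diag_scale)+

lemma pair2_genY_mult: "pair2 (Y i * Y j) \<alpha> \<beta> = toZ \<alpha> $ i * toZ \<beta> $ j"
  unfolding genY_mult pair2_smul pair2_gen_mult by (simp add: toZ_def diag_def)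

lemma rel_space_iff: "(\<forall>\<omega>\<in>rel_space u. pair2 \<omega> \<alpha> \<beta> = 0) \<longleftrightarrow> rel_pair a b c (toZ \<alpha>) (toZ \<beta>)"
proof -
  let ?Z = "toZ \<alpha>" and ?W = "toZ \<beta>"
  have set: "(\<forall>\<omega>\<in>relY_set k l m. pair2 \<omega> \<alpha> \<beta> = 0) \<longleftrightarrow>
      ?Z$0 * ?W$k - ?Z$k * ?W$0 = ?Z$l * ?W$m + ?Z$m * ?W$l \<and>
      (?Z$l * ?W$m - ?Z$m * ?W$l) + par_J u l m * (?Z$0 * ?W$k + ?Z$k * ?W$0) = 0" for k l m
    unfolding relY_set_def by (simp add: pair2_add pair2_diff pair2_smul pair2_genY_mult)
  have J: "x + J * y = 0 \<longleftrightarrow> p * x + q * y = 0" if "p * J = q" "p \<noteq> 0" for x J y p q :: complex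
  proof -
    have "p * x + q * y = p * (x + J * y)" using that by (simp add: distrib_left flip: that(1))
    then show ?thesis using that(2) by simp
  qed
  show ?thesis
    unfolding rel_space_eq pair2_span_eq_0_iff relsY_eq ball_Un set rel_pair_iff
      J[OF J_mult(1) nz(1)] J[OF J_mult(2) nz(2)] J[OF J_mult(3) nz(3)] by blast
qed

lemma coords_pt: "coords Y (pt \<alpha>) = pt (toZ \<alpha>)"
proof -
  have "(\<chi> \<mu>. pair1 (Y \<mu>) \<alpha>) = toZ \<alpha>" for \<alpha>
    by (simp add: genY_def pair1_smul_gen toZ_def diag_def)
  then show ?thesis by (simp add: coords_def pt_eq image_image toZ_scale)
qed

end

section \<open>The symmetry exchanging the factors, and the charts\<close>

lemma on_curve_flip0: "on_curve a b c (flip0 Z) \<longleftrightarrow> on_curve a b c Z"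
  by (simp add: on_curve_def flip0_def)

lemma on_curve_scale:
  assumes "k \<noteq> 0"
  shows "on_curve a b c (k *s Z) \<longleftrightarrow> on_curve a b c Z"
proof -
  have k: "k\<^sup>2 \<noteq> 0" using assms by simp
  have "x * ((k * y)\<^sup>2 - (k * z)\<^sup>2) = k\<^sup>2 * (x * (y\<^sup>2 - z\<^sup>2))" for x y z
    by (simp add: power_mult_distrib algebra_simps)
  then show ?thesis unfolding on_curve_def vector_smult_component by (simp only: mult_left_cancel[OF k])
qed

context nondegenerate
begin

lemma on_char_flip0: "on_char (flip0 Z) \<Longrightarrow> on_char Z"
proof -
  assume "on_char (flip0 Z)"
  moreover have "Z = Z$\<nu> *s axis \<nu> 1" if "flip0 Z = flip0 Z $ \<nu> *s axis \<nu> 1" for \<nu>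
    using that index4_cases[of \<nu>] by (auto simp: vec4_eq_iff flip0_def axis_def)
  ultimately show ?thesis unfolding on_char_def on_curve_flip0 by blast
qed

lemma on_char_scale:
  assumes "k \<noteq> 0" "on_char Z"
  shows "on_char (k *s Z)"
proof -
  have "k *s Z = (k *s Z)$\<nu> *s axis \<nu> 1" if "Z = Z$\<nu> *s axis \<nu> 1" for \<nu>
    by (subst that) (simp add: vector_smult_assoc)
  then show ?thesis using assms on_curve_scale unfolding on_char_def by blast
qed

text \<open>The symmetry \<open>rel_pair_flip0\<close> turns W into a first component, so the result
  for first components applies to it.\<close>

lemma on_char_image: "rel_pair a b c Z W \<Longrightarrow> Z \<noteq> 0 \<Longrightarrow> W \<noteq> 0 \<Longrightarrow> on_char W"
  using on_char_if_rel_pair[of "flip0 W" "flip0 Z"] on_char_flip0 by (simp add: rel_pair_flip0)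

lemma on_char_preimage:
  assumes "on_char W" "W \<noteq> 0"
  obtains Z where "Z \<noteq> 0" "rel_pair a b c Z W"
proof -
  have "on_char (flip0 W)" using on_char_flip0[of "flip0 W"] assms(1) by simp
  then obtain V where "V \<noteq> 0" "rel_pair a b c (flip0 W) V" using rel_pair_exists assms(2) by (metis flip0_eq_0)
  then show ?thesis using that[of "flip0 V"] rel_pair_flip0[of a b c V "flip0 W"]
    by simp
qed

lemma rel_pair_unique_left:
  assumes "rel_pair a b c Z W" "rel_pair a b c Z' W" "Z \<noteq> 0" "Z' \<noteq> 0" "W \<noteq> 0"
  obtains k where "k \<noteq> 0" "Z' = k *s Z"
proof -
  have "rel_pair a b c (flip0 W) (flip0 Z)" "rel_pair a b c (flip0 W) (flip0 Z')"
    using assms by (simp_all add: rel_pair_flip0)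
  from rel_pair_unique[OF this] assms obtain k where k: "k \<noteq> 0" "flip0 Z' = k *s flip0 Z" by auto
  have "flip0 (flip0 Z') = flip0 (k *s flip0 Z)" using k by simp
  then have "Z' = k *s Z" by (simp add: flip0_scale)
  then show ?thesis using k that by blast
qed

text \<open>The forms \<^term>\<open>cremona\<close> and \<^term>\<open>chart2\<close> represent the automorphism wherever they do not vanish.\<close>

definition charts :: "(complex^4 \<Rightarrow> complex^4) set" where
  "charts = {cremona, chart2}"

lemma chart_exists:
  assumes "on_char Z" "Z \<noteq> 0"
  obtains F where "F \<in> charts" "F Z \<noteq> 0"
  using chart2_nonzero[OF special_point_if_on_char[OF assms]] assms unfolding charts_def by (metis insert_iff)

lemma rel_pair_chart:
  assumes "F \<in> charts" "on_char Z" "Z \<noteq> 0" "F Z \<noteq> 0"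
  shows "rel_pair a b c Z (F Z)"
proof -
  obtain W where W: "W \<noteq> 0" "rel_pair a b c Z W" using rel_pair_exists[OF assms(2,3)] by blast
  then obtain k where k: "k \<noteq> 0" "W = k *s F Z"
    using assms(1,4) rel_pair_cremona[OF W(2,1)] rel_pair_chart2[OF W(2,1)] unfolding charts_def
    by (metis insert_iff singletonD)
  then show ?thesis using W(2) rel_pair_scale[of 1 k a b c Z "F Z"] by simp
qed

lemma form_maps_chart_diag:
  assumes "F \<in> charts"
  shows "(\<lambda>v. F (diag \<kappa> v)) \<in> form_maps UNIV 3"
proof -
  have "(\<lambda>v. cremona (diag \<kappa> v)) \<in> form_maps UNIV 3" "(\<lambda>v. chart2 (diag \<kappa> v)) \<in> form_maps UNIV 3"
    unfolding cremona_def chart2_def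
    by (intro complex_coefficients.form_maps_cross4 form_maps_rows_diag)+
  then show ?thesis using assms by (auto simp: charts_def)
qed

lemma finite_special_points: "finite {pt v | v. v \<noteq> 0 \<and> special_point v}"
proof (rule finite_subset)
  let ?S = "(\<lambda>(x, y, z). pt (vec4 1 x y z)) ` ({1, -1} \<times> {1, -1} \<times> {1, -1})"
  show "{pt v | v. v \<noteq> 0 \<and> special_point v} \<subseteq> ?S"
  proof
    fix p assume "p \<in> {pt v | v. v \<noteq> 0 \<and> special_point v}"
    then obtain v where v: "p = pt v" "v \<noteq> 0" "special_point v" by blast
    have v0: "v$0 \<noteq> 0" using v(2,3) by (auto simp: special_point_def vec4_eq_iff)
    have q: "v$i / v$0 \<in> {1, -1}" if "(v$i)\<^sup>2 = (v$0)\<^sup>2" for i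
      using that v0 by (auto simp: power2_eq_iff)
    have "v = v$0 *s vec4 1 (v$1 / v$0) (v$2 / v$0) (v$3 / v$0)"
      using v0 by (simp add: vec4_eq_iff)
    then have "p = pt (vec4 1 (v$1 / v$0) (v$2 / v$0) (v$3 / v$0))"
      using v(1) v0 by (metis pt_scale)
    then show "p \<in> ?S"
      using q[of 1] q[of 2] q[of 3] v(3) unfolding special_point_def
      by (intro image_eqI[of _ _ "(v$1 / v$0, v$2 / v$0, v$3 / v$0)"]) (simp_all only: case_prod_conv mem_Sigma_iff)
  qed
qed simp

end

section \<open>The characteristic variety and its automorphism\<close>

context generic_point
begin

lemma char_graph_eq:
  "char_graph (rel_space u) = {(pt \<alpha>, pt \<beta>) | \<alpha> \<beta>. \<alpha> \<noteq> 0 \<and> \<beta> \<noteq> 0 \<and> rel_pair a b c (toZ \<alpha>) (toZ \<beta>)}"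
  unfolding char_graph_def rel_space_iff ..

abbreviation "\<Gamma> \<equiv> char_graph (rel_space u)"
abbreviation "E \<equiv> char_variety (rel_space u)"
abbreviation "\<sigma> \<equiv> char_map (rel_space u)"

lemma char_graph_iff:
  assumes "\<alpha> \<noteq> 0" "\<beta> \<noteq> 0"
  shows "(pt \<alpha>, pt \<beta>) \<in> \<Gamma> \<longleftrightarrow> rel_pair a b c (toZ \<alpha>) (toZ \<beta>)"
proof
  assume "(pt \<alpha>, pt \<beta>) \<in> \<Gamma>"
  then obtain \<alpha>' \<beta>' where e: "pt \<alpha> = pt \<alpha>'" "pt \<beta> = pt \<beta>'" "\<alpha>' \<noteq> 0" "\<beta>' \<noteq> 0" "rel_pair a b c (toZ \<alpha>') (toZ \<beta>')"
    unfolding char_graph_eq by blast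
  obtain j where "j \<noteq> 0" "\<alpha> = j *s \<alpha>'" using e(1) pt_eq_iff[OF e(3)] by blast
  moreover obtain k where "k \<noteq> 0" "\<beta> = k *s \<beta>'" using e(2) pt_eq_iff[OF e(4)] by blast
  ultimately show "rel_pair a b c (toZ \<alpha>) (toZ \<beta>)"
    using e(5) by (simp add: toZ_scale rel_pair_scale)
qed (use assms in \<open>auto simp: char_graph_eq\<close>)

lemma char_graph_functional:
  assumes "(p, q) \<in> \<Gamma>" "(p, q') \<in> \<Gamma>"
  shows "q = q'"
proof -
  obtain \<alpha> \<beta> where 1: "p = pt \<alpha>" "q = pt \<beta>" "\<alpha> \<noteq> 0" "\<beta> \<noteq> 0" using assms(1) unfolding char_graph_eq by blast
  obtain \<beta>' where 2: "q' = pt \<beta>'" "\<beta>' \<noteq> 0" using assms(2) unfolding char_graph_eq by blast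
  have "rel_pair a b c (toZ \<alpha>) (toZ \<beta>)" "rel_pair a b c (toZ \<alpha>) (toZ \<beta>')"
    using assms char_graph_iff 1 2 by auto
  from rel_pair_unique[OF this] 1 2 obtain k where k: "k \<noteq> 0" "toZ \<beta>' = k *s toZ \<beta>" by auto
  have "fromZ (toZ \<beta>') = fromZ (k *s toZ \<beta>)" using k by simp
  then have "\<beta>' = k *s \<beta>" by (simp add: toZ_scale)
  then show ?thesis using 1 2 k by (simp add: pt_scale)
qed

lemma char_graph_injective:
  assumes "(p, q) \<in> \<Gamma>" "(p', q) \<in> \<Gamma>"
  shows "p = p'"
proof -
  obtain \<alpha> \<beta> where 1: "p = pt \<alpha>" "q = pt \<beta>" "\<alpha> \<noteq> 0" "\<beta> \<noteq> 0" using assms(1) unfolding char_graph_eq by blast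
  obtain \<alpha>' where 2: "p' = pt \<alpha>'" "\<alpha>' \<noteq> 0" using assms(2) unfolding char_graph_eq by blast
  have "rel_pair a b c (toZ \<alpha>) (toZ \<beta>)" "rel_pair a b c (toZ \<alpha>') (toZ \<beta>)"
    using assms char_graph_iff 1 2 by auto
  from rel_pair_unique_left[OF this] 1 2 obtain k where k: "k \<noteq> 0" "toZ \<alpha>' = k *s toZ \<alpha>" by auto
  have "fromZ (toZ \<alpha>') = fromZ (k *s toZ \<alpha>)" using k by simp
  then have "\<alpha>' = k *s \<alpha>" by (simp add: toZ_scale)
  then show ?thesis using 1 2 k by (simp add: pt_scale)
qed

lemma char_map_eqI: "(p, q) \<in> \<Gamma> \<Longrightarrow> \<sigma> p = q"
  unfolding char_map_def by (rule the_equality) (use char_graph_functional in blast)+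

lemma char_map_eq:
  assumes "\<alpha> \<noteq> 0" "\<beta> \<noteq> 0" "rel_pair a b c (toZ \<alpha>) (toZ \<beta>)"
  shows "\<sigma> (pt \<alpha>) = pt \<beta>"
  by (rule char_map_eqI) (simp add: char_graph_iff assms)

lemma char_variety_eq: "E = {pt \<alpha> | \<alpha>. \<alpha> \<noteq> 0 \<and> on_char (toZ \<alpha>)}"
proof (intro equalityI subsetI)
  fix p assume "p \<in> E"
  then obtain \<alpha> \<beta> where "p = pt \<alpha>" "\<alpha> \<noteq> 0" "\<beta> \<noteq> 0" "rel_pair a b c (toZ \<alpha>) (toZ \<beta>)"
    unfolding char_variety_def char_graph_eq by force
  then show "p \<in> {pt \<alpha> | \<alpha>. \<alpha> \<noteq> 0 \<and> on_char (toZ \<alpha>)}"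
    using on_char_if_rel_pair[of "toZ \<alpha>" "toZ \<beta>"] by auto
next
  fix p assume "p \<in> {pt \<alpha> | \<alpha>. \<alpha> \<noteq> 0 \<and> on_char (toZ \<alpha>)}"
  then obtain \<alpha> where \<alpha>: "p = pt \<alpha>" "\<alpha> \<noteq> 0" "on_char (toZ \<alpha>)" by blast
  then obtain W where "W \<noteq> 0" "rel_pair a b c (toZ \<alpha>) W" using rel_pair_exists[of "toZ \<alpha>"] by auto
  then have "(pt \<alpha>, pt (fromZ W)) \<in> \<Gamma>" using \<alpha> by (simp add: char_graph_iff)
  then show "p \<in> E" using \<alpha>(1) unfolding char_variety_def by force
qed

lemma pt_in_char_variety: "\<alpha> \<noteq> 0 \<Longrightarrow> pt \<alpha> \<in> E \<longleftrightarrow> on_char (toZ \<alpha>)"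
proof
  assume "\<alpha> \<noteq> 0" "pt \<alpha> \<in> E"
  then obtain \<alpha>' where e: "pt \<alpha> = pt \<alpha>'" "\<alpha>' \<noteq> 0" "on_char (toZ \<alpha>')" unfolding char_variety_eq by blast
  then obtain k where "k \<noteq> 0" "\<alpha> = k *s \<alpha>'" using pt_eq_iff by blast
  then show "on_char (toZ \<alpha>)" using e on_char_scale by (simp add: toZ_scale)
qed (auto simp: char_variety_eq)

lemma char_graph_snd: "snd ` \<Gamma> = E"
proof (intro equalityI subsetI)
  fix q assume "q \<in> snd ` \<Gamma>"
  then obtain \<alpha> \<beta> where "q = pt \<beta>" "\<alpha> \<noteq> 0" "\<beta> \<noteq> 0" "rel_pair a b c (toZ \<alpha>) (toZ \<beta>)"
    unfolding char_graph_eq by force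
  then show "q \<in> E" using on_char_image[of "toZ \<alpha>" "toZ \<beta>"] by (simp add: pt_in_char_variety)
next
  fix q assume "q \<in> E"
  then obtain \<beta> where \<beta>: "q = pt \<beta>" "\<beta> \<noteq> 0" "on_char (toZ \<beta>)" unfolding char_variety_eq by blast
  then obtain Z where "Z \<noteq> 0" "rel_pair a b c Z (toZ \<beta>)" using on_char_preimage[of "toZ \<beta>"] by auto
  then have "(pt (fromZ Z), pt \<beta>) \<in> \<Gamma>" using \<beta> by (simp add: char_graph_iff)
  then show "q \<in> snd ` \<Gamma>" using \<beta>(1) by force
qed

lemma char_map_in_graph: "p \<in> E \<Longrightarrow> (p, \<sigma> p) \<in> \<Gamma>"
  unfolding char_variety_def using char_map_eqI by force

lemma char_graph_is_graph: "\<Gamma> = {(p, \<sigma> p) | p. p \<in> E}"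
proof -
  have "(p, q) \<in> \<Gamma> \<longleftrightarrow> p \<in> E \<and> q = \<sigma> p" for p q
    using char_map_in_graph[of p] char_map_eqI[of p q] unfolding char_variety_def by (metis fst_conv image_eqI)
  then show ?thesis by auto
qed

lemma bij_char_map: "bij_betw \<sigma> E E"
  unfolding bij_betw_def
proof
  show "inj_on \<sigma> E" using char_graph_injective char_map_in_graph by (metis inj_onI)
  show "\<sigma> ` E = E"
  proof (intro equalityI subsetI)
    fix q assume "q \<in> \<sigma> ` E"
    then obtain p where "(p, q) \<in> \<Gamma>" using char_map_in_graph by blast
    then show "q \<in> E" unfolding char_graph_snd[symmetric] by (rule image_eqI[rotated]) simp
  next
    fix q assume "q \<in> E"
    then obtain p where p: "(p, q) \<in> \<Gamma>" unfolding char_graph_snd[symmetric] by auto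
    then have "p \<in> E" unfolding char_variety_def by (rule image_eqI[rotated]) simp
    then show "q \<in> \<sigma> ` E" using char_map_eqI[OF p] by blast
  qed
qed

lemma regular_char_map: "regular_on E \<sigma>"
  unfolding regular_on_def
proof (intro allI impI)
  fix v :: "complex^4" assume v: "v \<noteq> 0" "pt v \<in> E"
  then obtain F where F: "F \<in> charts" "F (toZ v) \<noteq> 0"
    using chart_exists[of "toZ v"] by (auto simp: pt_in_char_variety)
  define f where "f = (\<lambda>v. fromZ (F (toZ v)))"
  have "f \<in> form_maps UNIV 3"
    unfolding f_def fromZ_def toZ_def by (rule form_maps_diag[OF form_maps_chart_diag[OF F(1)]])
  moreover have "f v \<noteq> 0" using F by (simp add: f_def)
  moreover have "\<sigma> (pt w) = pt (f w)" if w: "w \<noteq> 0" "pt w \<in> E" "f w \<noteq> 0" for w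
    using w rel_pair_chart[OF F(1), of "toZ w"] by (intro char_map_eq) (simp_all add: f_def pt_in_char_variety)
  ultimately show "\<exists>d. \<exists>f\<in>form_maps UNIV d. f v \<noteq> 0 \<and>
      (\<forall>w. w \<noteq> 0 \<longrightarrow> pt w \<in> E \<longrightarrow> f w \<noteq> 0 \<longrightarrow> \<sigma> (pt w) = pt (f w))"
    by blast
qed

lemma flip0_diag: "flip0 (diag \<kappa> v) = diag (\<lambda>\<mu>. if \<mu> = 0 then - \<kappa> \<mu> else \<kappa> \<mu>) v"
  by (simp add: flip0_def diag_def vec4_eq_iff)

text \<open>The inverse is represented by a chart conjugated with \<open>flip0\<close>, chosen so as
  not to vanish at the flipped point. In the coordinates of the original generators the flip is
  absorbed into the diagonal scaling by \<open>flip0_diag\<close>.\<close>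

lemma regular_char_map_inverse: "regular_on E (the_inv_into E \<sigma>)"
  unfolding regular_on_def
proof (intro allI impI)
  have flip: "on_char (flip0 (toZ w))" if "w \<noteq> 0" "pt w \<in> E" for w
    using that on_char_flip0[of "flip0 (toZ w)"] by (simp add: pt_in_char_variety)
  fix v :: "complex^4" assume v: "v \<noteq> 0" "pt v \<in> E"
  then obtain F where F: "F \<in> charts" "F (flip0 (toZ v)) \<noteq> 0"
    using chart_exists[OF flip[OF v]] by auto
  define f where "f = (\<lambda>v. fromZ (flip0 (F (flip0 (toZ v)))))"
  have fl: "(\<lambda>v. F (flip0 (toZ v))) \<in> form_maps UNIV 3"
    unfolding toZ_def flip0_diag by (rule form_maps_chart_diag[OF F(1)])
  have "f \<in> form_maps UNIV 3"
    unfolding f_def fromZ_def by (rule form_maps_diag[OF complex_coefficients.form_maps_flip0[OF fl]])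
  moreover have "f v \<noteq> 0" using F by (simp add: f_def)
  moreover have "the_inv_into E \<sigma> (pt w) = pt (f w)" if w: "w \<noteq> 0" "pt w \<in> E" "f w \<noteq> 0" for w
  proof (rule the_inv_into_f_eq)
    show "inj_on \<sigma> E" using bij_char_map by (simp add: bij_betw_def)
    have "rel_pair a b c (flip0 (toZ w)) (F (flip0 (toZ w)))"
      using rel_pair_chart[OF F(1) flip[OF w(1,2)]] w by (simp add: f_def)
    then have "rel_pair a b c (toZ (f w)) (toZ w)"
      using rel_pair_flip0[of a b c "F (flip0 (toZ w))" "flip0 (toZ w)"] by (simp add: f_def)
    then have g: "(pt (f w), pt w) \<in> \<Gamma>" using w by (simp add: char_graph_iff)
    show "\<sigma> (pt (f w)) = pt w" by (rule char_map_eqI[OF g])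
    show "pt (f w) \<in> E" using g unfolding char_variety_def by force
  qed
  ultimately show "\<exists>d. \<exists>f\<in>form_maps UNIV d. f v \<noteq> 0 \<and>
      (\<forall>w. w \<noteq> 0 \<longrightarrow> pt w \<in> E \<longrightarrow> f w \<noteq> 0 \<longrightarrow> the_inv_into E \<sigma> (pt w) = pt (f w))"
    by blast
qed

lemma variety_automorphism_char_map: "variety_automorphism E \<sigma>"
  unfolding variety_automorphism_def
  using bij_char_map regular_char_map regular_char_map_inverse by blast

lemma curveF_u: "curveF u = {pt Z | Z. Z \<noteq> 0 \<and> on_curve a b c Z}"
  by (rule curveF_eq[OF nz(1)])

lemma pt_in_curveF: "v \<noteq> 0 \<Longrightarrow> pt v \<in> curveF u \<longleftrightarrow> on_curve a b c v"
proof
  assume "v \<noteq> 0" "pt v \<in> curveF u"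
  then obtain Z where e: "pt v = pt Z" "Z \<noteq> 0" "on_curve a b c Z" unfolding curveF_u by blast
  then obtain k where "k \<noteq> 0" "v = k *s Z" using pt_eq_iff by blast
  then show "on_curve a b c v" using e on_curve_scale by simp
qed (auto simp: curveF_u)

lemma coords_char_variety: "coords Y ` E = curveF u \<union> range (\<lambda>\<nu>. pt (axis \<nu> 1))"
proof -
  have "coords Y ` E = {pt Z | Z. Z \<noteq> 0 \<and> on_char Z}"
  proof (intro equalityI subsetI)
    fix p assume "p \<in> {pt Z | Z. Z \<noteq> 0 \<and> on_char Z}"
    then obtain Z where Z: "p = pt Z" "Z \<noteq> 0" "on_char Z" by blast
    then have "pt (fromZ Z) \<in> E" by (simp add: pt_in_char_variety)
    moreover have "p = coords Y (pt (fromZ Z))" by (simp add: coords_pt Z)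
    ultimately show "p \<in> coords Y ` E" by blast
  next
    fix p assume "p \<in> coords Y ` E"
    then obtain \<alpha> where "p = coords Y (pt \<alpha>)" "\<alpha> \<noteq> 0" "on_char (toZ \<alpha>)" unfolding char_variety_eq by blast
    then show "p \<in> {pt Z | Z. Z \<noteq> 0 \<and> on_char Z}" by (auto simp: coords_pt)
  qed
  also have "\<dots> = curveF u \<union> range (\<lambda>\<nu>. pt (axis \<nu> 1))"
  proof (intro equalityI subsetI)
    fix p assume "p \<in> {pt Z | Z. Z \<noteq> 0 \<and> on_char Z}"
    then obtain Z where Z: "p = pt Z" "Z \<noteq> 0" "on_char Z" by blast
    show "p \<in> curveF u \<union> range (\<lambda>\<nu>. pt (axis \<nu> 1))"
    proof (cases "on_curve a b c Z")
      case False
      then obtain \<nu> where \<nu>: "Z = Z$\<nu> *s axis \<nu> 1" using Z(3) unfolding on_char_def by blast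
      then have "Z$\<nu> \<noteq> 0" using Z(2) by auto
      then have "p = pt (axis \<nu> 1)" using Z(1) \<nu> by (metis pt_scale)
      then show ?thesis by blast
    qed (use Z in \<open>auto simp: curveF_u\<close>)
  next
    fix p assume "p \<in> curveF u \<union> range (\<lambda>\<nu>. pt (axis \<nu> 1))"
    moreover have "(axis \<nu> 1 :: complex^4) \<noteq> 0" "on_char (axis \<nu> 1)" for \<nu>
    proof -
      show "(axis \<nu> 1 :: complex^4) \<noteq> 0" by simp
      then show "on_char (axis \<nu> 1)" by (intro on_char_if_rel_pair[OF rel_pair_axis])
    qed
    ultimately show "p \<in> {pt Z | Z. Z \<noteq> 0 \<and> on_char Z}" unfolding curveF_u on_char_def by blast
  qed
  finally show ?thesis .
qed

text \<open>Reduces each statement on values of \<sigma> to exhibiting one nonzero solution W of the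
  six equations; it applies to coordinate points, to the Cremona map and to theta functions
  alike.\<close>

lemma coords_char_map:
  assumes "p \<in> E" "coords Y p = pt Z" "W \<noteq> 0" "rel_pair a b c Z W"
  shows "coords Y (\<sigma> p) = pt W"
proof -
  obtain \<alpha> where \<alpha>: "p = pt \<alpha>" "\<alpha> \<noteq> 0" using assms(1) unfolding char_variety_eq by blast
  then have e: "pt (toZ \<alpha>) = pt Z" using assms(2) by (simp add: coords_pt)
  then have "Z \<noteq> 0" using pt_eq_0[OF e] \<alpha>(2) by simp
  then obtain k where k: "k \<noteq> 0" "toZ \<alpha> = k *s Z" using e pt_eq_iff by blast
  have "rel_pair a b c (toZ \<alpha>) W" using assms(4) rel_pair_scale[OF k(1), of 1 a b c Z W] k by simp
  then have "\<sigma> p = pt (fromZ W)" unfolding \<alpha>(1) using assms(3) \<alpha>(2) by (intro char_map_eq) simp_all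
  then show ?thesis by (simp add: coords_pt)
qed

lemma coords_char_map_axis: "p \<in> E \<Longrightarrow> coords Y p = pt (axis \<nu> 1) \<Longrightarrow> coords Y (\<sigma> p) = pt (axis \<nu> 1)"
  by (rule coords_char_map[OF _ _ _ rel_pair_axis]) simp_all

lemma coords_char_map_cremona:
  assumes "p \<in> E" "v \<noteq> 0" "coords Y p = pt v" "pt v \<in> curveF u" "cremona v \<noteq> 0"
  shows "coords Y (\<sigma> p) = pt (cremona v)"
  using assms rel_pair_cremona_if_on_curve[of v]
  by (intro coords_char_map[OF assms(1,3,5)]) (simp add: pt_in_curveF)

text \<open>On the curve the rational map can be undefined only at vertices of the tetrahedron, so
  comparing it with \<sigma> where it is defined covers all but finitely many points of the
  curve.\<close>

lemma finite_cremona_indeterminacy: "finite {pt v | v. v \<noteq> 0 \<and> pt v \<in> curveF u \<and> cremona v = 0}"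
  by (rule finite_subset[OF _ finite_special_points]) (use special_point_if_on_curve pt_in_curveF in blast)

text \<open>If \<open>\<theta>\<^sub>1(\<eta>)\<close> vanished, then \<open>\<theta>\<^sub>3(0)\<^sup>2 \<theta>\<^sub>4(\<eta>)\<^sup>2 = \<theta>\<^sub>4(0)\<^sup>2 \<theta>\<^sub>3(\<eta>)\<^sup>2\<close>, hence \<open>b = c\<close>.\<close>

lemma theta_data_if_params:
  assumes "theta_params u \<tau> \<eta>"
  obtains \<rho> where "theta_data \<tau> \<eta> \<rho> a b c"
proof -
  let ?v = "vector [(theta2 \<tau> 0)\<^sup>2 / (theta2 \<tau> \<eta>)\<^sup>2, (theta3 \<tau> 0)\<^sup>2 / (theta3 \<tau> \<eta>)\<^sup>2,
                 (theta4 \<tau> 0)\<^sup>2 / (theta4 \<tau> \<eta>)\<^sup>2] :: complex^3"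
  have \<tau>: "Im \<tau> > 0" and e: "pt (vector [a, b, c] :: complex^3) = pt ?v"
    using assms by (auto simp: theta_params_def)
  have "(vector [a, b, c] :: complex^3) \<noteq> 0" using nz by (simp add: vec_eq_iff forall_3)
  then have "?v \<noteq> 0" using pt_eq_0[OF e] by blast
  then obtain \<rho> where \<rho>: "\<rho> \<noteq> 0" "(vector [a, b, c] :: complex^3) = \<rho> *s ?v" using e pt_eq_iff by blast
  then have abc: "a = \<rho> * (theta2 \<tau> 0)\<^sup>2 / (theta2 \<tau> \<eta>)\<^sup>2" "b = \<rho> * (theta3 \<tau> 0)\<^sup>2 / (theta3 \<tau> \<eta>)\<^sup>2"
      "c = \<rho> * (theta4 \<tau> 0)\<^sup>2 / (theta4 \<tau> \<eta>)\<^sup>2"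
    by (simp_all add: vec_eq_iff forall_3)
  \<comment> \<open>Since division by zero yields 0, the nonvanishing of a, b, c gives nonzero
    denominators as well as nonzero numerators.\<close>
  then have t: "theta2 \<tau> \<eta> \<noteq> 0" "theta3 \<tau> \<eta> \<noteq> 0" "theta4 \<tau> \<eta> \<noteq> 0" "theta2 \<tau> 0 \<noteq> 0" "theta3 \<tau> 0 \<noteq> 0" "theta4 \<tau> 0 \<noteq> 0"
    using nz by auto
  have "theta1 \<tau> \<eta> \<noteq> 0"
  proof
    assume "theta1 \<tau> \<eta> = 0"
    then have A: "T0 \<tau> \<eta> * T2 \<tau> 0 = T2 \<tau> \<eta> * T0 \<tau> 0"
      using theta11[OF \<tau>, of \<eta> 0] by simp
    have sq: "(theta3 \<tau> \<eta>)\<^sup>2 = T0 \<tau> \<eta> * T0 \<tau> 0 + T2 \<tau> \<eta> * T2 \<tau> 0" "(theta4 \<tau> \<eta>)\<^sup>2 = T0 \<tau> \<eta> * T0 \<tau> 0 - T2 \<tau> \<eta> * T2 \<tau> 0"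
      "(theta3 \<tau> 0)\<^sup>2 = T0 \<tau> 0 * T0 \<tau> 0 + T2 \<tau> 0 * T2 \<tau> 0" "(theta4 \<tau> 0)\<^sup>2 = T0 \<tau> 0 * T0 \<tau> 0 - T2 \<tau> 0 * T2 \<tau> 0"
      using theta33[OF \<tau>, of \<eta> 0] theta44[OF \<tau>, of \<eta> 0] theta33[OF \<tau>, of 0 0] theta44[OF \<tau>, of 0 0]
      by (simp_all add: power2_eq_square)
    have "(theta3 \<tau> 0)\<^sup>2 * (theta4 \<tau> \<eta>)\<^sup>2 = (theta4 \<tau> 0)\<^sup>2 * (theta3 \<tau> \<eta>)\<^sup>2"
      unfolding sq using A by Groebner_Basis.algebra
    then have "b = c" unfolding abc using t by (simp add: frac_eq_eq)
    then show False using distinct by blast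
  qed
  then have "theta_data \<tau> \<eta> \<rho> a b c"
    using \<tau> \<rho>(1) t abc by unfold_locales simp_all
  then show ?thesis by (rule that)
qed

lemma psi_eq:
  assumes "theta_data \<tau> \<eta> \<rho> a b c"
  shows "psi \<tau> \<eta> z = pt (theta_data.theta_point \<tau> \<eta> (2 * z - \<eta>))"
  unfolding psi_def theta_data.theta_point_def[OF assms] vec4_def ..

lemma range_psi:
  assumes "theta_params u \<tau> \<eta>"
  shows "range (psi \<tau> \<eta>) = curveF u"
proof -
  obtain \<rho> where td: "theta_data \<tau> \<eta> \<rho> a b c" using theta_data_if_params[OF assms] .
  interpret t: theta_data \<tau> \<eta> \<rho> a b c by (rule td)
  show ?thesis
  proof (intro equalityI subsetI)
    fix p assume "p \<in> range (psi \<tau> \<eta>)"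
    then show "p \<in> curveF u"
      unfolding psi_eq[OF td] using t.theta_point_nonzero t.on_curve_theta_point by (auto simp: pt_in_curveF)
  next
    fix p assume "p \<in> curveF u"
    then obtain Z where Z: "p = pt Z" "Z \<noteq> 0" "on_curve a b c Z" unfolding curveF_u by blast
    then obtain k x where "k \<noteq> 0" "Z = k *s t.theta_point x" using t.on_curve_imp_orbit unfolding t.orbit_def by blast
    then have "p = pt (t.theta_point x)" using Z by (simp add: pt_scale)
    also have "x = 2 * ((x + \<eta>) / 2) - \<eta>" by (simp add: field_simps)
    also have "pt (t.theta_point (2 * ((x + \<eta>) / 2) - \<eta>)) = psi \<tau> \<eta> ((x + \<eta>) / 2)" unfolding psi_eq[OF td] ..
    finally show "p \<in> range (psi \<tau> \<eta>)" by blast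
  qed
qed

lemma coords_char_map_psi:
  assumes "theta_params u \<tau> \<eta>" "p \<in> E" "coords Y p = psi \<tau> \<eta> z"
  shows "coords Y (\<sigma> p) = psi \<tau> \<eta> (z - \<eta>)"
proof -
  obtain \<rho> where td: "theta_data \<tau> \<eta> \<rho> a b c" using theta_data_if_params[OF assms(1)] .
  interpret t: theta_data \<tau> \<eta> \<rho> a b c by (rule td)
  \<comment> \<open>The arguments for z and z - \<eta> lie at distance \<eta> on either side of 2 z
    - 2 \<eta>, which matches the symmetric form of \<open>rel_pair_theta_point\<close>.\<close>
  have x: "2 * z - \<eta> = (2 * z - 2 * \<eta>) + \<eta>" "2 * (z - \<eta>) - \<eta> = (2 * z - 2 * \<eta>) - \<eta>" by simp_all
  show ?thesis
    using coords_char_map[OF assms(2) _ t.theta_point_nonzero t.rel_pair_theta_point, of "2 * z - 2 * \<eta>"] assms(3)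
    unfolding psi_eq[OF td] x .
qed

end

theorem theorem9p5:
  shows "\<exists>(X :: (complex^4) set set) (f :: complex^4 \<Rightarrow> complex^4).
    proper_algebraic_subset X \<and> birational_automorphism \<rat> f \<and>
    (\<forall>u r s. u \<noteq> 0 \<longrightarrow> pt u \<notin> X \<longrightarrow> roots_for u r s \<longrightarrow>
      (let Y = genY r s; R = rel_space u; E = char_variety R; \<sigma> = char_map R in
        (\<forall>\<mu>. gen \<mu> = scaling r s \<mu> \<odot> Y \<mu>) \<and>
        R = tens.span (relsY u Y) \<and>
        alg_u u = quadratic_algebra (relsY u Y) \<and>

        coords Y ` E = curveF u \<union> range (\<lambda>\<nu>. pt (axis \<nu> 1)) \<and>

        snd ` char_graph R = E \<and>
        char_graph R = {(p, \<sigma> p) | p. p \<in> E} \<and>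
        variety_automorphism E \<sigma> \<and>
        (\<forall>\<tau> \<eta>. theta_params u \<tau> \<eta> \<longrightarrow>
           range (psi \<tau> \<eta>) = curveF u \<and>
           (\<forall>p\<in>E. \<forall>z. coords Y p = psi \<tau> \<eta> z \<longrightarrow> coords Y (\<sigma> p) = psi \<tau> \<eta> (z - \<eta>))) \<and>
        (\<forall>p\<in>E. \<forall>\<nu>. coords Y p = pt (axis \<nu> 1) \<longrightarrow> coords Y (\<sigma> p) = pt (axis \<nu> 1)) \<and>

        finite {pt v | v. v \<noteq> 0 \<and> pt v \<in> curveF u \<and> f v = 0} \<and>
        (\<forall>p\<in>E. \<forall>v. v \<noteq> 0 \<longrightarrow> coords Y p = pt v \<longrightarrow> pt v \<in> curveF u \<longrightarrow> f v \<noteq> 0 \<longrightarrow>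
           coords Y (\<sigma> p) = pt (f v))))"
proof (rule exI[of _ "hypersurface generic_poly"], rule exI[of _ cremona], intro conjI allI impI)
  have "(vec4 0 1 2 4) \<noteq> 0" by (simp add: vec4_eq_iff)
  then show "proper_algebraic_subset (hypersurface generic_poly)"
    by (rule proper_hypersurface[OF forms_generic_poly generic_poly_nonzero_somewhere])
  show "birational_automorphism \<rat> cremona" by (rule birational_cremona)
next
  fix u r s assume "u \<noteq> 0" "pt u \<notin> hypersurface generic_poly" "roots_for u r s"
  then interpret generic_point u r s
    using pt_in_hypersurface[OF forms_generic_poly] by unfold_locales auto
  show "let Y = genY r s; R = rel_space u; E = char_variety R; \<sigma> = char_map R in
        (\<forall>\<mu>. gen \<mu> = scaling r s \<mu> \<odot> Y \<mu>) \<and>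
        R = tens.span (relsY u Y) \<and>
        alg_u u = quadratic_algebra (relsY u Y) \<and>
        coords Y ` E = curveF u \<union> range (\<lambda>\<nu>. pt (axis \<nu> 1)) \<and>
        snd ` char_graph R = E \<and>
        char_graph R = {(p, \<sigma> p) | p. p \<in> E} \<and>
        variety_automorphism E \<sigma> \<and>
        (\<forall>\<tau> \<eta>. theta_params u \<tau> \<eta> \<longrightarrow>
           range (psi \<tau> \<eta>) = curveF u \<and>
           (\<forall>p\<in>E. \<forall>z. coords Y p = psi \<tau> \<eta> z \<longrightarrow> coords Y (\<sigma> p) = psi \<tau> \<eta> (z - \<eta>))) \<and>
        (\<forall>p\<in>E. \<forall>\<nu>. coords Y p = pt (axis \<nu> 1) \<longrightarrow> coords Y (\<sigma> p) = pt (axis \<nu> 1)) \<and>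
        finite {pt v | v. v \<noteq> 0 \<and> pt v \<in> curveF u \<and> cremona v = 0} \<and>
        (\<forall>p\<in>E. \<forall>v. v \<noteq> 0 \<longrightarrow> coords Y p = pt v \<longrightarrow> pt v \<in> curveF u \<longrightarrow> cremona v \<noteq> 0 \<longrightarrow>
           coords Y (\<sigma> p) = pt (cremona v))"
    unfolding Let_def
    by (intro conjI allI impI ballI gen_eq rel_space_eq alg_u_eq coords_char_variety char_graph_snd
        char_graph_is_graph variety_automorphism_char_map range_psi coords_char_map_psi
        coords_char_map_axis finite_cremona_indeterminacy coords_char_map_cremona)
qed

end
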